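(* (Pitchfork–Hopf mode interaction.) Consider the normal form system $$\dot y_1=y_2,\quad \dot y_2=[\alpha_1+\phi_1]y_1+[\alpha_2+\phi_2]y_2,\quad \dot r=[\alpha_3+\phi_3]r,\quad \dot\theta=1+\phi_4$$ in a neighbourhood of the $\alpha_2$-axis $(\alpha_1,\alpha_3)=(0,0)$, for $\alpha_2<0$. Setting $\dot y_1=y_2=0$ and $\dot r=0$, suppressing the $\theta$ equation, and retaining only leading order terms in $\phi_1$ and $\phi_3$, gives $$0=[\alpha_1+\phi_{1,10}y_1^2+\phi_{1,01}r^2]\,y_1,\qquad 0=[\alpha_3+\phi_{3,10}y_1^2+\phi_{3,01}r^2]\,r .$$ Assume the nondegeneracy conditions $$\Delta_1\equiv\phi_{1,10}\phi_{3,01}-\phi_{3,10}\phi_{1,01}\ne0,\qquad \phi_{1,10}\phi_{3,01}\neq0 .$$ Then these truncated equations have four branches of solutions $$(y_1^2,r^2)=(0,0),$$ $$(y_1^2,r^2)=\Bigl(-\frac{\alpha_1}{\phi_{1,10}},\,0\Bigr),$$ $$(y_1^2,r^2)=\Bigl(0,\,-\frac{\alpha_3}{\phi_{3,01}}\Bigr),$$ $$(y_1^2,r^2)=\Bigl(\frac{\alpha_3\phi_{1,01}-\alpha_1\phi_{3,01}}{\Delta_1},\ \frac{\alpha_1\phi_{3,10}-\alpha_3\phi_{1,10}}{\Delta_1}\Bigr),$$ where the nonzero quantities on the right must be positive for the solutions to be real. The first three are the trivial, primary pitchfork $P$ and primary Hopf $H_1$ solutions, respectively. The fourth is a mixed-mode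 solution, which joins the $P$ and $H_1$ solutions, at the two ends of its interval of existence, in secondary bifurcations. Due to symmetry, the primary bifurcations have two symmetric branches $\pm y_1$, $\pm r$, and the secondary bifurcations have four branches; however, in the full dynamics the solutions with $\pm r$ give the same periodic orbit with a phase shift. The secondary bifurcation from $P$ is an Andronov–Hopf bifurcation, while the secondary bifurcation from $H_1$ is a pitchfork bifurcation of two new limit cycles. While these results are deduced only from the cubic truncation, they extend by standard arguments to the full equations, using the nondegeneracy assumptions above, the Implicit Function Theorem and transversality.
   Context: Here $y_1,y_2\in\mathbb{R}$, $z=re^{i\theta}\in\mathbb{C}$, and $\alpha_1,\alpha_2,\alpha_3$ are real unfolding parameters. The $\phi_j=\phi_j(y_1^2,r^2)$, $j=1,\dots,4$, are real-valued formal power series (which may not converge) in $y_1^2$ and $r^2=z\bar z$ with $\phi_j(0,0)=0$; $\phi_{j,kl}$ is the coefficient of $y_1^{2k}r^{2l}$ in $\phi_j(y_1^2,r^2)$. On the $\alpha_2$-axis the linearization at the origin has a simple zero eigenvalue, with a $\mathbb{Z}_2$-symmetry on the corresponding eigenspace $y_1$, and a pair of purely imaginary eigenvalues $\pm i$. $P$ denotes the pair of nontrivial equilibria on the $y_1$-axis branching from the trivial solution as $\alpha_1$ crosses $0$; $H_1$ denotes the limit cycle in the $z$-plane ($y_1=y_2=0$) bifurcating from the trivial solution as $\alpha_3$ crosses $0$. *)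

theory Defs
  imports "HOL-Analysis.Analysis" "HOL-Computational_Algebra.Computational_Algebra"
begin

section \<open>Formal power series in two variables and smooth functions realizing them\<close>

definition coeff2 :: "real fps fps \<Rightarrow> nat \<Rightarrow> nat \<Rightarrow> real" where
  "coeff2 \<phi> k l = fps_nth (fps_nth \<phi> k) l"

definition partial1 :: "(real \<times> real \<Rightarrow> real) \<Rightarrow> real \<times> real \<Rightarrow> real" where
  "partial1 f p = deriv (\<lambda>s. f (s, snd p)) (fst p)"

definition partial2 :: "(real \<times> real \<Rightarrow> real) \<Rightarrow> real \<times> real \<Rightarrow> real" where
  "partial2 f p = deriv (\<lambda>s. f (fst p, s)) (snd p)"

primrec Ck_on :: "nat \<Rightarrow> (real \<times> real) set \<Rightarrow> (real \<times> real \<Rightarrow> real) \<Rightarrow> bool" where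
  "Ck_on 0 S f = continuous_on S f"
| "Ck_on (Suc n) S f =
    ((\<forall>p\<in>S. f differentiable (at p)) \<and> Ck_on n S (partial1 f) \<and> Ck_on n S (partial2 f))"

definition smooth_on :: "(real \<times> real) set \<Rightarrow> (real \<times> real \<Rightarrow> real) \<Rightarrow> bool" where
  "smooth_on S f \<longleftrightarrow> (\<forall>n. Ck_on n S f)"

text \<open>A formal power series need not converge, so it does not itself define a vector field.
  Its meaning in the differential equation is that of a smooth germ whose Taylor series at the
  origin is the given formal series.\<close>

definition realizes :: "(real \<times> real \<Rightarrow> real) \<Rightarrow> real fps fps \<Rightarrow> bool" where
  "realizes f \<phi> \<longleftrightarrow>
    (\<exists>S. open S \<and> (0, 0) \<in> S \<and> smooth_on S f) \<and>
    (\<forall>k l. ((partial1 ^^ k) ((partial2 ^^ l) f)) (0, 0) = fact k * fact l * coeff2 \<phi> k l)"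


section \<open>Flows on Euclidean space: periodic orbits, eigenvalues, Floquet multipliers\<close>

definition solution :: "(real^'n \<Rightarrow> real^'n) \<Rightarrow> (real \<Rightarrow> real^'n) \<Rightarrow> bool" where
  "solution F x \<longleftrightarrow> (\<forall>t. (x has_vector_derivative F (x t)) (at t))"

definition periodic_orbit :: "(real^'n \<Rightarrow> real^'n) \<Rightarrow> (real^'n) set \<Rightarrow> bool" where
  "periodic_orbit F C \<longleftrightarrow>
    (\<exists>x T. solution F x \<and> T > 0 \<and> (\<forall>t. x (t + T) = x t) \<and> (\<exists>t. x t \<noteq> x 0) \<and> C = range x)"

definition limit_cycle :: "(real^'n \<Rightarrow> real^'n) \<Rightarrow> (real^'n) set \<Rightarrow> bool" where
  "limit_cycle F C \<longleftrightarrow> periodic_orbit F C \<and>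
    (\<exists>U. open U \<and> C \<subseteq> U \<and> (\<forall>C'. periodic_orbit F C' \<and> C' \<subseteq> U \<longrightarrow> C' = C))"

definition jacobian_at :: "(real^'n \<Rightarrow> real^'n) \<Rightarrow> real^'n \<Rightarrow> real^'n^'n" where
  "jacobian_at F x = matrix (frechet_derivative F (at x))"

definition charpoly :: "real^'n^'n \<Rightarrow> complex poly" where
  "charpoly A = det (\<chi> i j. (if i = j then [:0, 1:] else 0) - [:complex_of_real (A $ i $ j):])"

definition eigenvalue :: "real^'n^'n \<Rightarrow> complex \<Rightarrow> bool" where
  "eigenvalue A z \<longleftrightarrow> poly (charpoly A) z = 0"

text \<open>The matrix M is the monodromy matrix of the periodic orbit C (with respect to some
  base point on C): the value, after one minimal period, of the fundamental solution of
  the variational equation. Floquet multipliers are its eigenvalues; one of them is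
  always 1.\<close>

definition monodromy :: "(real^'n \<Rightarrow> real^'n) \<Rightarrow> (real^'n) set \<Rightarrow> real^'n^'n \<Rightarrow> bool" where
  "monodromy F C M \<longleftrightarrow>
    (\<exists>x T X. solution F x \<and> C = range x \<and>
      T > 0 \<and> x T = x 0 \<and> (\<forall>t. 0 < t \<and> t < T \<longrightarrow> x t \<noteq> x 0) \<and>
      (\<forall>t. F differentiable (at (x t))) \<and>
      X 0 = mat 1 \<and>
      (\<forall>t. (X has_vector_derivative (jacobian_at F (x t) ** X t)) (at t)) \<and>
      M = X T)"


section \<open>Bifurcations in one-parameter families of vector fields\<close>

text \<open>In each definition \<open>\<sigma>\<close> records on which side of \<open>\<mu>0\<close> the new branches exist; the
  arguments after \<open>\<mu>0\<close> are the original branch followed by the bifurcating ones, whose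
  values on the other side are irrelevant. The branches are required to be all the equilibria
  (respectively periodic orbits) in a fixed neighbourhood of the bifurcation point.\<close>

definition symmetry_of :: "(real \<Rightarrow> real^'n \<Rightarrow> real^'n) \<Rightarrow> (real^'n \<Rightarrow> real^'n) \<Rightarrow> bool" where
  "symmetry_of F S \<longleftrightarrow> linear S \<and> S \<circ> S = id \<and> (\<forall>\<mu> x. F \<mu> (S x) = S (F \<mu> x))"

definition pitchfork_of_equilibria ::
  "(real \<Rightarrow> real^'n \<Rightarrow> real^'n) \<Rightarrow> (real^'n \<Rightarrow> real^'n) \<Rightarrow> real \<Rightarrow>
   (real \<Rightarrow> real^'n) \<Rightarrow> (real \<Rightarrow> real^'n) \<Rightarrow> (real \<Rightarrow> real^'n) \<Rightarrow> bool" where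
  "pitchfork_of_equilibria F S \<mu>0 e e1 e2 \<longleftrightarrow>
    symmetry_of F S \<and>
    isCont e \<mu>0 \<and>
    (\<forall>\<^sub>F \<mu> in nhds \<mu>0. F \<mu> (e \<mu>) = 0 \<and> S (e \<mu>) = e \<mu> \<and> F \<mu> differentiable (at (e \<mu>))) \<and>
    \<comment> \<open>a simple real eigenvalue crosses 0 with nonzero speed, the others staying hyperbolic\<close>
    (\<exists>l d. l \<mu>0 = 0 \<and> (l has_real_derivative d) (at \<mu>0) \<and> d \<noteq> 0 \<and>
      (\<forall>\<^sub>F \<mu> in nhds \<mu>0. eigenvalue (jacobian_at (F \<mu>) (e \<mu>)) (complex_of_real (l \<mu>)))) \<and>
    order 0 (charpoly (jacobian_at (F \<mu>0) (e \<mu>0))) = 1 \<and>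
    (\<forall>z. eigenvalue (jacobian_at (F \<mu>0) (e \<mu>0)) z \<and> Re z = 0 \<longrightarrow> z = 0) \<and>
    (\<exists>\<sigma>\<in>{-1, 1}.
      (\<exists>U. open U \<and> e \<mu>0 \<in> U \<and>
        (\<forall>\<^sub>F \<mu> in nhds \<mu>0. {x \<in> U. F \<mu> x = 0} =
          (if \<sigma> * (\<mu> - \<mu>0) > 0 then {e \<mu>, e1 \<mu>, e2 \<mu>} else {e \<mu>}))) \<and>
      (\<forall>\<^sub>F \<mu> in nhds \<mu>0. \<sigma> * (\<mu> - \<mu>0) > 0 \<longrightarrow>
          e1 \<mu> \<noteq> e \<mu> \<and> e2 \<mu> \<noteq> e \<mu> \<and> e1 \<mu> \<noteq> e2 \<mu> \<and> S (e1 \<mu>) = e2 \<mu>) \<and>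
      (\<forall>V. open V \<and> e \<mu>0 \<in> V \<longrightarrow>
        (\<forall>\<^sub>F \<mu> in nhds \<mu>0. \<sigma> * (\<mu> - \<mu>0) > 0 \<longrightarrow> e1 \<mu> \<in> V \<and> e2 \<mu> \<in> V)))"

definition andronov_hopf ::
  "(real \<Rightarrow> real^'n \<Rightarrow> real^'n) \<Rightarrow> real \<Rightarrow> (real \<Rightarrow> real^'n) \<Rightarrow> (real \<Rightarrow> (real^'n) set) \<Rightarrow> bool" where
  "andronov_hopf F \<mu>0 e C \<longleftrightarrow>
    isCont e \<mu>0 \<and>
    (\<forall>\<^sub>F \<mu> in nhds \<mu>0. F \<mu> (e \<mu>) = 0 \<and> F \<mu> differentiable (at (e \<mu>))) \<and>
    \<comment> \<open>a simple complex pair crosses the imaginary axis at \<open>\<plusminus>i\<omega>\<close> with nonzero speed,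
      the other eigenvalues staying hyperbolic\<close>
    (\<exists>\<omega> l d. \<omega> > 0 \<and> l \<mu>0 = \<i> * complex_of_real \<omega> \<and>
      (l has_vector_derivative d) (at \<mu>0) \<and> Re d \<noteq> 0 \<and>
      (\<forall>\<^sub>F \<mu> in nhds \<mu>0. eigenvalue (jacobian_at (F \<mu>) (e \<mu>)) (l \<mu>)) \<and>
      order (l \<mu>0) (charpoly (jacobian_at (F \<mu>0) (e \<mu>0))) = 1 \<and>
      (\<forall>z. eigenvalue (jacobian_at (F \<mu>0) (e \<mu>0)) z \<and> Re z = 0 \<longrightarrow>
        z = l \<mu>0 \<or> z = cnj (l \<mu>0))) \<and>
    (\<exists>\<sigma>\<in>{-1, 1}.
      (\<exists>U. open U \<and> e \<mu>0 \<in> U \<and>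
        (\<forall>\<^sub>F \<mu> in nhds \<mu>0. {D. periodic_orbit (F \<mu>) D \<and> D \<subseteq> U} =
          (if \<sigma> * (\<mu> - \<mu>0) > 0 then {C \<mu>} else {}))) \<and>
      (\<forall>V. open V \<and> e \<mu>0 \<in> V \<longrightarrow>
        (\<forall>\<^sub>F \<mu> in nhds \<mu>0. \<sigma> * (\<mu> - \<mu>0) > 0 \<longrightarrow> C \<mu> \<subseteq> V)))"

definition pitchfork_of_cycles ::
  "(real \<Rightarrow> real^'n \<Rightarrow> real^'n) \<Rightarrow> (real^'n \<Rightarrow> real^'n) \<Rightarrow> real \<Rightarrow>
   (real \<Rightarrow> (real^'n) set) \<Rightarrow> (real \<Rightarrow> (real^'n) set) \<Rightarrow> (real \<Rightarrow> (real^'n) set) \<Rightarrow> bool" where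
  "pitchfork_of_cycles F S \<mu>0 C C1 C2 \<longleftrightarrow>
    symmetry_of F S \<and>
    (\<forall>\<^sub>F \<mu> in nhds \<mu>0. periodic_orbit (F \<mu>) (C \<mu>) \<and> (\<forall>x\<in>C \<mu>. S x = x)) \<and>
    \<comment> \<open>a Floquet multiplier crosses 1 with nonzero speed; at \<open>\<mu>0\<close> the multiplier 1 is double
      (the trivial and the critical one) and the others are off the unit circle\<close>
    (\<exists>m d. m \<mu>0 = 1 \<and> (m has_real_derivative d) (at \<mu>0) \<and> d \<noteq> 0 \<and>
      (\<forall>\<^sub>F \<mu> in nhds \<mu>0. \<exists>M. monodromy (F \<mu>) (C \<mu>) M \<and> eigenvalue M (complex_of_real (m \<mu>)))) \<and>
    (\<exists>M. monodromy (F \<mu>0) (C \<mu>0) M \<and> order 1 (charpoly M) = 2 \<and>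
      (\<forall>z. eigenvalue M z \<and> cmod z = 1 \<longrightarrow> z = 1)) \<and>
    (\<exists>\<sigma>\<in>{-1, 1}.
      (\<exists>U. open U \<and> C \<mu>0 \<subseteq> U \<and>
        (\<forall>\<^sub>F \<mu> in nhds \<mu>0. {D. periodic_orbit (F \<mu>) D \<and> D \<subseteq> U} =
          (if \<sigma> * (\<mu> - \<mu>0) > 0 then {C \<mu>, C1 \<mu>, C2 \<mu>} else {C \<mu>}))) \<and>
      (\<forall>\<^sub>F \<mu> in nhds \<mu>0. \<sigma> * (\<mu> - \<mu>0) > 0 \<longrightarrow>
          C1 \<mu> \<noteq> C \<mu> \<and> C2 \<mu> \<noteq> C \<mu> \<and> C1 \<mu> \<noteq> C2 \<mu> \<and> S ` C1 \<mu> = C2 \<mu>) \<and>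
      (\<forall>V. open V \<and> C \<mu>0 \<subseteq> V \<longrightarrow>
        (\<forall>\<^sub>F \<mu> in nhds \<mu>0. C \<mu> \<subseteq> V \<and>
          (\<sigma> * (\<mu> - \<mu>0) > 0 \<longrightarrow> C1 \<mu> \<subseteq> V \<and> C2 \<mu> \<subseteq> V))))"


section \<open>The normal form\<close>

text \<open>The system in the coordinates \<open>(y1, y2, Re z, Im z)\<close>: with \<open>z = r exp (i \<theta>)\<close>, the
  equations \<open>r' = a r\<close>, \<open>\<theta>' = w\<close> say \<open>z' = (a + i w) z\<close>.\<close>

definition nf_field ::
  "(nat \<Rightarrow> real \<times> real \<Rightarrow> real) \<Rightarrow> real \<times> real \<times> real \<Rightarrow> real^4 \<Rightarrow> real^4" where
  "nf_field f = (\<lambda>(\<alpha>1, \<alpha>2, \<alpha>3) x.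
    (let p = ((x$1)^2, (x$3)^2 + (x$4)^2); a = \<alpha>3 + f 3 p; w = 1 + f 4 p
     in vector [x$2,
                (\<alpha>1 + f 1 p) * x$1 + (\<alpha>2 + f 2 p) * x$2,
                a * x$3 - w * x$4,
                w * x$3 + a * x$4]))"

text \<open>The \<open>(y1, y2, r)\<close> part of the system, with the \<open>\<theta>\<close> equation suppressed.\<close>

definition polar_field ::
  "(nat \<Rightarrow> real \<times> real \<Rightarrow> real) \<Rightarrow> real \<times> real \<times> real \<Rightarrow> real \<times> real \<times> real \<Rightarrow> real \<times> real \<times> real" where
  "polar_field f = (\<lambda>(\<alpha>1, \<alpha>2, \<alpha>3) (y1, y2, r).
    (y2,
     (\<alpha>1 + f 1 (y1^2, r^2)) * y1 + (\<alpha>2 + f 2 (y1^2, r^2)) * y2,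
     (\<alpha>3 + f 3 (y1^2, r^2)) * r))"

definition truncated_eqs ::
  "(nat \<Rightarrow> real fps fps) \<Rightarrow> real \<Rightarrow> real \<Rightarrow> real \<Rightarrow> real \<Rightarrow> bool" where
  "truncated_eqs \<phi> \<alpha>1 \<alpha>3 y1 r \<longleftrightarrow>
    0 = (\<alpha>1 + coeff2 (\<phi> 1) 1 0 * y1^2 + coeff2 (\<phi> 1) 0 1 * r^2) * y1 \<and>
    0 = (\<alpha>3 + coeff2 (\<phi> 3) 1 0 * y1^2 + coeff2 (\<phi> 3) 0 1 * r^2) * r"

definition Delta1 :: "(nat \<Rightarrow> real fps fps) \<Rightarrow> real" where
  "Delta1 \<phi> = coeff2 (\<phi> 1) 1 0 * coeff2 (\<phi> 3) 0 1 - coeff2 (\<phi> 3) 1 0 * coeff2 (\<phi> 1) 0 1"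

definition trunc_P :: "(nat \<Rightarrow> real fps fps) \<Rightarrow> real \<Rightarrow> real" where
  "trunc_P \<phi> \<alpha>1 = - \<alpha>1 / coeff2 (\<phi> 1) 1 0"

definition trunc_H :: "(nat \<Rightarrow> real fps fps) \<Rightarrow> real \<Rightarrow> real" where
  "trunc_H \<phi> \<alpha>3 = - \<alpha>3 / coeff2 (\<phi> 3) 0 1"

definition trunc_M :: "(nat \<Rightarrow> real fps fps) \<Rightarrow> real \<times> real \<Rightarrow> real \<times> real" where
  "trunc_M \<phi> = (\<lambda>(\<alpha>1, \<alpha>3).
    ((\<alpha>3 * coeff2 (\<phi> 1) 0 1 - \<alpha>1 * coeff2 (\<phi> 3) 0 1) / Delta1 \<phi>,
     (\<alpha>1 * coeff2 (\<phi> 3) 1 0 - \<alpha>3 * coeff2 (\<phi> 1) 1 0) / Delta1 \<phi>))"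

text \<open>The real points \<open>(y1, r)\<close> on the trivial branch, on P (with \<open>y1^2 = p\<close>), on H1 (with
  \<open>r^2 = h\<close>) and on the mixed-mode branch (with \<open>(y1^2, r^2) = m\<close>). A branch contributes
  nothing when its value of \<open>y1^2\<close> or \<open>r^2\<close> is negative.\<close>

definition branches :: "real \<Rightarrow> real \<Rightarrow> real \<times> real \<Rightarrow> (real \<times> real) set" where
  "branches p h m = {(y1, r). (y1^2, r^2) \<in> {(0, 0), (p, 0), (0, h), m}}"

definition branch_counts :: "(real \<times> real) set \<Rightarrow> real \<Rightarrow> real \<Rightarrow> real \<times> real \<Rightarrow> bool" where
  "branch_counts B p h m \<longleftrightarrow>
    finite B \<and>
    card {(y1, r) \<in> B. y1 \<noteq> 0 \<and> r = 0} = (if p > 0 then 2 else 0) \<and>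
    card {(y1, r) \<in> B. y1 = 0 \<and> r \<noteq> 0} = (if h > 0 then 2 else 0) \<and>
    card {(y1, r) \<in> B. y1 \<noteq> 0 \<and> r \<noteq> 0} = (if fst m > 0 \<and> snd m > 0 then 4 else 0)"

text \<open>Along a \<open>2 \<pi>\<close>-periodic parameter loop \<open>t\<close>, with \<open>y1^2 = p t\<close> on P, \<open>r^2 = h t\<close> on H1 and
  \<open>(y1^2, r^2) = m t\<close> on the mixed-mode branch: the mixed mode exists on a single open interval
  (modulo \<open>2 \<pi>\<close>), at one end of which it meets P and at the other H1.\<close>

definition mixed_mode_joins ::
  "(real \<Rightarrow> real) \<Rightarrow> (real \<Rightarrow> real) \<Rightarrow> (real \<Rightarrow> real \<times> real) \<Rightarrow> real \<Rightarrow> real \<Rightarrow> bool" where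
  "mixed_mode_joins p h m tP tH \<longleftrightarrow>
    tP \<noteq> tH \<and> \<bar>tP - tH\<bar> < pi \<and>
    (\<forall>t. (fst (m t) > 0 \<and> snd (m t) > 0) \<longleftrightarrow>
         (\<exists>k::int. t + 2 * pi * of_int k \<in> open_segment tP tH)) \<and>
    p tP > 0 \<and> m tP = (p tP, 0) \<and> isCont m tP \<and>
    h tH > 0 \<and> m tH = (0, h tH) \<and> isCont m tH"

definition eq_pt :: "real \<Rightarrow> real^4" where
  "eq_pt y1 = vector [y1, 0, 0, 0]"

definition circ :: "real \<Rightarrow> real \<Rightarrow> (real^4) set" where
  "circ y1 v = {x. x$1 = y1 \<and> x$2 = 0 \<and> (x$3)^2 + (x$4)^2 = v}"

definition rotating :: "real \<Rightarrow> real \<Rightarrow> real \<Rightarrow> real \<Rightarrow> real^4" where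
  "rotating y1 r \<omega> t = vector [y1, 0, r * cos (\<omega> * t), r * sin (\<omega> * t)]"

definition y_flip :: "real^4 \<Rightarrow> real^4" where
  "y_flip x = vector [- (x$1), - (x$2), x$3, x$4]"

end

theory Submission
  imports Defs
begin

text \<open>The system for \<open>(y1, y2, v)\<close> with \<open>v = r\<^sup>2\<close> decouples from the phase, and periodic orbits off
  the \<open>y\<close>-plane lie over its steady states: the velocity of a periodic solution solves a linear
  equation whose coefficients are close to those at a bifurcation point, where the only possible
  critical eigenvalue is a simple zero. Two quadratic forms are strictly monotone along that
  equation wherever they are nonnegative, so the velocity vanishes somewhere and hence everywhere.
  This replaces centre manifold reduction and gives all periodic orbits in a neighbourhood.
  The steady states are the zeros of \<open>(\<alpha>1 + \<phi>1) y1\<close> and \<open>(\<alpha>3 + \<phi>3) r\<close>; the inverse function theorem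
  in the variables \<open>(y1\<^sup>2, r\<^sup>2)\<close> solves them. The Jacobians are block diagonal at equilibria and
  along the cycle \<open>H1\<close>, where a rotating frame makes the variational equation autonomous.
  On small loops the mixed-mode branch is \<open>C\<^sup>1\<close>-close to its linearization, whose two components
  are sine waves.\<close>

text \<open>The obstacle is that the definitions of the bifurcations ask for all periodic orbits in
  a fixed neighbourhood, whatever their period, so an analysis of orbits of nearly the expected
  period would not suffice. Passing to the velocity W of the (y1, y2, r^2) motion removes it: W
  satisfies a linear equation without remainder, whose matrix is the Jacobian along the orbit, so
  smallness enters only through the closeness of that matrix to a constant one. Using r^2 instead of
  r turns the critical pair of a Hopf bifurcation into a simple zero eigenvalue and puts Hopf and
  pitchfork bifurcations under one criterion. The quadratic forms are in general indefinite, since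
  the noncritical eigenvalues may have either sign; strictness in the y directions comes from
  \<alpha>2 + \<phi>2 < 0, which is available near the axis because \<alpha>2 < 0. The branches are
  solved for values of y1^2 and r^2 of either sign, so they are differentiable functions of the
  parameters, and solutions appear or disappear where one of these values changes sign.\<close>

no_notation fps_nth (infixl \<open>$\<close> 75) \<comment> \<open>otherwise each \<open>x $ i\<close> below is ambiguous\<close>

section \<open>Scalar differential inequalities and periodic functions\<close>

text \<open>Gronwall's inequality in both time directions. On the compact interval between
  \<open>a\<close> and \<open>t\<close> the coefficient \<open>L\<close> is at most some
  \<open>K\<close>; then \<open>exp (- K * t) * N t\<close> is nonincreasing and
  \<open>exp (K * t) * N t\<close> is nondecreasing, so a zero of the nonnegative function
  \<open>N\<close> spreads to both sides.\<close>

lemma zero_of_derivative_bound: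
  fixes N L :: "real \<Rightarrow> real"
  assumes N: "\<And>t. (N has_real_derivative N' t) (at t)"
    and bd: "\<And>t. \<bar>N' t\<bar> \<le> L t * N t" and nn: "\<And>t. N t \<ge> 0"
    and L: "continuous_on UNIV L" and z: "N a = 0"
  shows "N t = 0"
proof -
  define I where "I = {min a t..max a t}"
  have "compact (L ` I)"
    unfolding I_def by (intro compact_continuous_image continuous_on_subset[OF L]) auto
  then obtain K where K: "\<And>s. s \<in> I \<Longrightarrow> L s \<le> K"
    using compact_imp_bounded bounded_real by (metis abs_le_D1 imageI)
  have KN: "\<bar>N' s\<bar> \<le> K * N s" if "s \<in> I" for s
    using bd[of s] mult_right_mono[OF K[OF that] nn[of s]] by linarith
  have "N t \<le> 0"
  proof (cases "a \<le> t")
    case True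
    have "exp (- K * t) * N t \<le> exp (- K * a) * N a"
    proof (rule DERIV_nonpos_imp_nonincreasing[OF True])
      fix s assume "a \<le> s" "s \<le> t"
      then have "s \<in> I" by (auto simp: I_def)
      then have "exp (- K * s) * (N' s - K * N s) \<le> 0"
        using KN[of s] by (simp add: mult_le_0_iff)
      moreover have "((\<lambda>s. exp (- K * s) * N s) has_real_derivative exp (- K * s) * (N' s - K * N s)) (at s)"
        by (auto intro!: derivative_eq_intros N simp: algebra_simps)
      ultimately show "\<exists>y. ((\<lambda>s. exp (- K * s) * N s) has_real_derivative y) (at s) \<and> y \<le> 0" by blast
    qed
    then show ?thesis using z by (simp add: mult_le_0_iff)
  next
    case False
    then have "t \<le> a" by simp
    have "exp (K * t) * N t \<le> exp (K * a) * N a"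
    proof (rule DERIV_nonneg_imp_nondecreasing[OF \<open>t \<le> a\<close>])
      fix s assume "t \<le> s" "s \<le> a"
      then have "s \<in> I" by (auto simp: I_def)
      then have "exp (K * s) * (N' s + K * N s) \<ge> 0"
        using KN[of s] by (simp add: zero_le_mult_iff)
      moreover have "((\<lambda>s. exp (K * s) * N s) has_real_derivative exp (K * s) * (N' s + K * N s)) (at s)"
        by (auto intro!: derivative_eq_intros N simp: algebra_simps)
      ultimately show "\<exists>y. ((\<lambda>s. exp (K * s) * N s) has_real_derivative y) (at s) \<and> y \<ge> 0" by blast
    qed
    then show ?thesis using z by (simp add: mult_le_0_iff)
  qed
  with nn[of t] show ?thesis by simp
qed

lemma periodic_reduce:
  fixes f :: "real \<Rightarrow> 'a" and T :: real
  assumes "T > 0" and per: "\<And>t. f (t + T) = f t"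
  obtains s where "s \<in> {a..a + T}" "f t = f s"
proof -
  have nat: "f (u + real n * T) = f u" for n u
    by (induction n arbitrary: u) (use per in \<open>simp_all add: distrib_right add.assoc[symmetric]\<close>)
  have int: "f (u + of_int k * T) = f u" for k u
  proof (cases "k \<ge> 0")
    case True then show ?thesis using nat[of u "nat k"] by simp
  next
    case False then show ?thesis using nat[of "u + of_int k * T" "nat (- k)"] by simp
  qed
  define k where "k = \<lfloor>(t - a) / T\<rfloor>"
  have "of_int k * T \<le> t - a" "t - a \<le> (of_int k + 1) * T"
    unfolding k_def using \<open>T > 0\<close> by (simp_all flip: pos_le_divide_eq pos_divide_le_eq)
  then have "t - of_int k * T \<in> {a..a+T}" by (simp add: algebra_simps)
  moreover have "f t = f (t - of_int k * T)" using int[of "t - of_int k * T" k] by simp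
  ultimately show ?thesis using that by blast
qed

lemma periodic_max:
  fixes S :: "real \<Rightarrow> real"
  assumes "T > 0" "\<And>t. S (t + T) = S t" "\<And>t. (S has_real_derivative S' t) (at t)"
  obtains m where "\<And>t. S t \<le> S m" "S' m = 0"
proof -
  have "continuous_on {0..0+T} S"
    using assms(3) DERIV_isCont by (blast intro: continuous_at_imp_continuous_on)
  then obtain m where m: "\<And>t. t \<in> {0..0+T} \<Longrightarrow> S t \<le> S m"
    using continuous_attains_sup[of "{0..0+T}" S] \<open>T > 0\<close> by force
  have le: "S t \<le> S m" for t
    using periodic_reduce[of T S 0 t, OF assms(1,2)] m by metis
  then have "S' m = 0"
    using DERIV_local_max[OF assms(3)[of m], of 1] by simp
  with le show ?thesis using that by blast
qed

section \<open>Quadratic forms that are strictly monotone along a linear equation\<close>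

lemma compact_nonvanishing_stable:
  fixes \<Phi> :: "'a::metric_space \<Rightarrow> 'b::topological_space \<Rightarrow> real"
  assumes "compact K" and cont: "continuous_on UNIV (\<lambda>(c, w). \<Phi> c w)" and nz: "\<And>w. w \<in> K \<Longrightarrow> \<Phi> c0 w \<noteq> 0"
  shows "\<exists>\<epsilon>>0. \<forall>c. dist c c0 < \<epsilon> \<longrightarrow> (\<forall>w\<in>K. \<Phi> c w \<noteq> 0)"
proof -
  have "open {z. (\<lambda>(c, w). \<Phi> c w) z \<noteq> 0}"
    by (intro open_Collect_neq cont continuous_on_const)
  moreover have "{c0} \<times> K \<subseteq> {z. (\<lambda>(c, w). \<Phi> c w) z \<noteq> 0}"
    using nz by auto
  ultimately obtain X0 where "open X0" "c0 \<in> X0" and X0: "X0 \<times> K \<subseteq> {z. (\<lambda>(c, w). \<Phi> c w) z \<noteq> 0}"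
    using Elementary_Topology.tube_lemma[OF \<open>compact K\<close>] by metis
  then obtain \<epsilon> where \<epsilon>: "\<epsilon> > 0" "ball c0 \<epsilon> \<subseteq> X0" using open_contains_ball by blast
  have "\<Phi> c w \<noteq> 0" if "dist c c0 < \<epsilon>" "w \<in> K" for c w
  proof -
    have "(c, w) \<in> X0 \<times> K" using that \<epsilon>(2) by (auto simp: dist_commute)
    then show ?thesis using subsetD[OF X0] by fastforce
  qed
  with \<epsilon>(1) show ?thesis by blast
qed

text \<open>For symmetric \<open>B\<close>, \<open>2 * B w (lin c w)\<close> is the derivative of
  \<open>B w w\<close> along the equation w' = lin c w. The condition is homogeneous in
  \<open>w\<close>, so only the unit vectors of the cone \<open>B w w \<ge> 0\<close> matter; they
  form a compact set, on which nonvanishing at \<open>c0\<close> survives for all nearby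
  \<open>c\<close>.\<close>

lemma quadratic_form_stable:
  fixes B :: "'a::euclidean_space \<Rightarrow> 'a \<Rightarrow> real" and lin :: "'c::metric_space \<Rightarrow> 'a \<Rightarrow> 'a"
  assumes B: "bounded_bilinear B" and cont: "continuous_on UNIV (\<lambda>(c, w). lin c w)"
    and scale: "\<And>c r w. lin c (r *\<^sub>R w) = r *\<^sub>R lin c w"
    and nz: "\<And>w. w \<noteq> 0 \<Longrightarrow> B w w \<ge> 0 \<Longrightarrow> B w (lin c0 w) \<noteq> 0"
  shows "\<exists>\<epsilon>>0. \<forall>c. dist c c0 < \<epsilon> \<longrightarrow> (\<forall>w. B w w \<ge> 0 \<longrightarrow> B w (lin c w) = 0 \<longrightarrow> w = 0)"
proof -
  interpret B: bounded_bilinear B by fact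
  define K where "K = {w::'a. norm w = 1 \<and> B w w \<ge> 0}"
  have "K = sphere 0 1 \<inter> {w. B w w \<ge> 0}" by (auto simp: K_def)
  moreover have "closed {w. B w w \<ge> 0}"
    by (intro closed_Collect_le continuous_intros B.continuous_on)
  ultimately have "compact K" by (simp add: compact_Int_closed)
  moreover have "continuous_on UNIV (\<lambda>(c, w). B w (lin c w))"
    using cont unfolding case_prod_beta by (intro B.continuous_on continuous_intros)
  moreover have "\<And>w. w \<in> K \<Longrightarrow> B w (lin c0 w) \<noteq> 0"
    using nz unfolding K_def by (metis (mono_tags, lifting) mem_Collect_eq norm_zero zero_neq_one)
  ultimately have "\<exists>\<epsilon>>0. \<forall>c. dist c c0 < \<epsilon> \<longrightarrow> (\<forall>w\<in>K. B w (lin c w) \<noteq> 0)"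
    by (rule compact_nonvanishing_stable)
  then obtain \<epsilon> where \<epsilon>: "\<epsilon> > 0" "\<And>c w. dist c c0 < \<epsilon> \<Longrightarrow> w \<in> K \<Longrightarrow> B w (lin c w) \<noteq> 0"
    by blast
  have "w = 0" if c: "dist c c0 < \<epsilon>" and w: "B w w \<ge> 0" "B w (lin c w) = 0" for c w
  proof (rule ccontr)
    assume "w \<noteq> 0"
    define u where "u = (1 / norm w) *\<^sub>R w"
    have "u \<in> K"
      using \<open>w \<noteq> 0\<close> w(1) by (simp add: u_def K_def B.scaleR_left B.scaleR_right)
    moreover have "B u (lin c u) = 0"
      using w(2) by (simp add: u_def scale B.scaleR_left B.scaleR_right)
    ultimately show False using \<epsilon>(2)[OF c] by blast
  qed
  with \<epsilon>(1) show ?thesis by blast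
qed

text \<open>Where the periodic function \<open>B (w t) (w t)\<close> is maximal its value is
  nonnegative, because of \<open>t0\<close>, and its derivative vanishes; \<open>nz\<close> turns
  this point into a zero of \<open>w\<close>.\<close>

lemma periodic_linear_vanishes:
  fixes B :: "'a::euclidean_space \<Rightarrow> 'a \<Rightarrow> real" and w :: "real \<Rightarrow> 'a"
  assumes B: "bounded_bilinear B" and sym: "\<And>u v. B u v = B v u"
    and "T > 0" "\<And>t. w (t + T) = w t"
    and w: "\<And>t. (w has_vector_derivative w' t) (at t)"
    and nz: "\<And>t. B (w t) (w t) \<ge> 0 \<Longrightarrow> B (w t) (w' t) = 0 \<Longrightarrow> w t = 0"
    and t0: "B (w t0) (w t0) \<ge> 0"
  shows "\<exists>t. w t = 0"
proof -
  interpret B: bounded_bilinear B by fact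
  have "((\<lambda>t. B (w t) (w t)) has_real_derivative 2 * B (w t) (w' t)) (at t)" for t
    using B.has_vector_derivative[OF w[of t] w[of t]] sym[of "w' t" "w t"]
    by (simp add: has_real_derivative_iff_has_vector_derivative)
  from periodic_max[of T "\<lambda>t. B (w t) (w t)", OF _ _ this] assms(3,4)
  obtain m where "\<And>t. B (w t) (w t) \<le> B (w m) (w m)" "2 * B (w m) (w' m) = 0" by auto
  with t0 nz[of m] show ?thesis by (metis mult_eq_0_iff order_trans zero_neq_numeral)
qed

text \<open>The forms \<open>\<plusminus>G - (l \<bullet> w)\<^sup>2\<close> are strictly monotone along the flow where they are nonnegative,
  the functional \<open>l\<close> being conserved by the unperturbed equation. On a periodic solution
  \<open>l \<bullet> w\<close> is the derivative of a periodic function, so it vanishes somewhere, and there one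
  of the two forms is nonnegative.\<close>

lemma periodic_velocity_vanishes:
  fixes G :: "'a::euclidean_space \<Rightarrow> 'a \<Rightarrow> real" and lin :: "'c::metric_space \<Rightarrow> 'a \<Rightarrow> 'a"
  assumes G: "bounded_bilinear G" and sym: "\<And>u v. G u v = G v u"
    and cont: "continuous_on UNIV (\<lambda>(c, w). lin c w)"
    and scale: "\<And>c r w. lin c (r *\<^sub>R w) = r *\<^sub>R lin c w"
    and l: "\<And>w. l \<bullet> lin c0 w = 0"
    and nz: "\<And>w. G w (lin c0 w) = 0 \<Longrightarrow> (l \<bullet> w)\<^sup>2 \<le> \<bar>G w w\<bar> \<Longrightarrow> w = 0"
  shows "\<exists>\<epsilon>>0. \<forall>c T X W. T > 0 \<longrightarrow> (\<forall>t. X (t + T) = X t) \<longrightarrow>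
    (\<forall>t. (X has_vector_derivative W t) (at t)) \<longrightarrow>
    (\<forall>t. (W has_vector_derivative lin (c t) (W t)) (at t)) \<longrightarrow>
    (\<forall>t. dist (c t) c0 < \<epsilon>) \<longrightarrow> (\<exists>t. W t = 0)"
proof -
  interpret G: bounded_bilinear G by fact
  define B where "B \<sigma> u v = \<sigma> * G u v - (l \<bullet> u) * (l \<bullet> v)" for \<sigma> u v
  have "bilinear (B \<sigma>)" for \<sigma>
    unfolding bilinear_def B_def
    by (auto intro!: linearI simp: G.add_left G.add_right G.scaleR_left G.scaleR_right inner_add_right algebra_simps)
  then have bil: "bounded_bilinear (B \<sigma>)" for \<sigma>
    by (simp add: bilinear_conv_bounded_bilinear)
  \<comment> \<open>As \<open>l\<close> annihilates \<open>lin c0\<close>, the subtracted square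
    contributes nothing to the derivative at \<open>c0\<close>, while
    \<open>B \<sigma> w w \<ge> 0\<close> becomes the bound on \<open>l \<bullet> w\<close> that
    \<open>nz\<close> asks for.\<close>
  have nzB: "B \<sigma> w (lin c0 w) \<noteq> 0" if "\<bar>\<sigma>\<bar> = 1" "w \<noteq> 0" "B \<sigma> w w \<ge> 0" for \<sigma> w
  proof -
    have "\<sigma> * G w w \<le> \<bar>G w w\<bar>" using that(1) by (metis abs_ge_self abs_mult mult_1)
    then have "(l \<bullet> w)\<^sup>2 \<le> \<bar>G w w\<bar>" using that(3) by (simp add: B_def power2_eq_square)
    then show ?thesis using nz[of w] that(1,2) l by (auto simp: B_def)
  qed
  obtain e1 where e1: "e1 > 0" "\<And>c w. dist c c0 < e1 \<Longrightarrow> B 1 w w \<ge> 0 \<Longrightarrow> B 1 w (lin c w) = 0 \<Longrightarrow> w = 0"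
    using quadratic_form_stable[OF bil cont scale nzB, of 1] by auto
  obtain e2 where e2: "e2 > 0" "\<And>c w. dist c c0 < e2 \<Longrightarrow> B (-1) w w \<ge> 0 \<Longrightarrow> B (-1) w (lin c w) = 0 \<Longrightarrow> w = 0"
    using quadratic_form_stable[OF bil cont scale nzB, of "-1"] by auto
  have "\<exists>t. W t = 0"
    if T: "T > 0" and X: "\<And>t. X (t + T) = X t" "\<And>t. (X has_vector_derivative W t) (at t)"
      and W: "\<And>t. (W has_vector_derivative lin (c t) (W t)) (at t)" and c: "\<And>t. dist (c t) c0 < min e1 e2"
    for c T and X W :: "real \<Rightarrow> 'a"
  proof -
    have perW: "W (t + T) = W t" for t
    proof -
      have "((X \<circ> (\<lambda>s. s + T)) has_vector_derivative 1 *\<^sub>R W (t + T)) (at t)"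
        by (rule vector_diff_chain_at) (auto intro!: derivative_eq_intros X)
      then have "(X has_vector_derivative W (t + T)) (at t)" using X(1) by (simp add: o_def)
      then show ?thesis using X(2) vector_derivative_unique_at by blast
    qed
    have lX: "((\<lambda>t. l \<bullet> X t) has_real_derivative l \<bullet> W t) (at t)" for t
      using bounded_linear.has_vector_derivative[OF bounded_linear_inner_right X(2)]
      by (simp add: has_real_derivative_iff_has_vector_derivative)
    have "l \<bullet> X (t + T) = l \<bullet> X t" for t by (simp add: X(1))
    then obtain t0 where "l \<bullet> W t0 = 0"
      using periodic_max[of T "\<lambda>t. l \<bullet> X t", OF T _ lX] by metis
    then have "B 1 (W t0) (W t0) \<ge> 0 \<or> B (-1) (W t0) (W t0) \<ge> 0" by (auto simp: B_def)
    moreover have sB: "B \<sigma> u v = B \<sigma> v u" for \<sigma> u v by (simp add: B_def sym)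
    ultimately show ?thesis
      using periodic_linear_vanishes[OF bil sB T perW W, of 1 t0] e1(2)
        periodic_linear_vanishes[OF bil sB T perW W, of "-1" t0] e2(2) c by (metis min_less_iff_conj)
  qed
  then have "\<forall>c T X W. T > 0 \<longrightarrow> (\<forall>t. X (t + T) = X t) \<longrightarrow>
    (\<forall>t. (X has_vector_derivative W t) (at t)) \<longrightarrow>
    (\<forall>t. (W has_vector_derivative lin (c t) (W t)) (at t)) \<longrightarrow>
    (\<forall>t. dist (c t) c0 < min e1 e2) \<longrightarrow> (\<exists>t. W t = 0)"
    by (intro allI impI) metis
  moreover have "min e1 e2 > 0" using e1(1) e2(1) by simp
  ultimately show ?thesis by blast
qed

text \<open>The matrix with rows (0, 1, 0), (p, b, q), (n, 0, s): \<open>b\<close> is the damping in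
  the y equation, \<open>p\<close> its restoring coefficient, \<open>q\<close> and \<open>n\<close>
  are the couplings between y and v, and \<open>s\<close> is the linear rate of v. At the centres
  used below \<open>n = 0\<close>, so the spectrum there consists of \<open>s\<close> and the roots
  of z^2 - b z - p.\<close>

fun vel_lin :: "real \<times> real \<times> real \<times> real \<times> real \<Rightarrow> real \<times> real \<times> real \<Rightarrow> real \<times> real \<times> real" where
  "vel_lin (p, b, q, n, s) (x, y, v) = (y, p * x + b * y + q * v, n * x + s * v)"

text \<open>At most one eigenvalue of the constant matrix is critical, and it is zero: for
  \<open>p \<noteq> 0\<close> the y block is hyperbolic, as \<open>b < 0\<close>, and only
  \<open>s\<close> can vanish; for \<open>p = 0\<close> the zero belongs to the y block and
  \<open>s \<noteq> 0\<close>. The conserved functional is v in the first situation, when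
  \<open>s = 0\<close>, and \<open>x - y / b\<close> in the second.\<close>

lemma periodic_velocity_vanishes_3d:
  assumes "b < 0" and pqs: "p \<noteq> 0 \<and> s = 0 \<or> q = 0 \<and> s \<noteq> 0"
  shows "\<exists>\<epsilon>>0. \<forall>c T X W. T > 0 \<longrightarrow> (\<forall>t. X (t + T) = X t) \<longrightarrow>
    (\<forall>t. (X has_vector_derivative W t) (at t)) \<longrightarrow>
    (\<forall>t. (W has_vector_derivative vel_lin (c t) (W t)) (at t)) \<longrightarrow>
    (\<forall>t. dist (c t) (p, b, q, 0, s) < \<epsilon>) \<longrightarrow> (\<exists>t. W t = 0)"
proof -
  have cont: "continuous_on UNIV (\<lambda>(c, w). vel_lin c w)"
  proof -
    have "(\<lambda>(c, w). vel_lin c w) = (\<lambda>z. (fst (snd (snd z)),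
      fst (fst z) * fst (snd z) + fst (snd (fst z)) * fst (snd (snd z)) + fst (snd (snd (fst z))) * snd (snd (snd z)),
      fst (snd (snd (snd (fst z)))) * fst (snd z) + snd (snd (snd (snd (fst z)))) * snd (snd (snd z))))"
      by auto
    then show ?thesis by (simp only:) (intro continuous_intros)
  qed
  have scale: "vel_lin c (r *\<^sub>R w) = r *\<^sub>R vel_lin c w" for c r w
    by (cases c; cases w) (simp add: algebra_simps)
  have bil: "bounded_bilinear G" if "bilinear G" for G :: "real \<times> real \<times> real \<Rightarrow> real \<times> real \<times> real \<Rightarrow> real"
    using that by (simp add: bilinear_conv_bounded_bilinear)
  note main = periodic_velocity_vanishes[OF bil _ cont scale]
  show ?thesis
  proof (cases "p = 0")
    case False
    \<comment> \<open>\<open>C\<close> is half of the damping with the sign of \<open>p\<close>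
      attached, so that \<open>C * p\<close> and \<open>b + C\<close> are both negative;
      \<open>d\<close> makes the v term of the derivative nonpositive as well. If
      \<open>s = 0\<close> that term is absent, and \<open>e\<close> lets the functional
      \<open>l\<close> detect v instead.\<close>
    define C d e where "C = sgn p * b / 2" and "d = sgn s" and "e = (if s = 0 then 1 else 0 :: real)"
    define k where "k = q / p"
    have pk: "p * k = q" using False by (simp add: k_def)
    \<comment> \<open>Shifting x by \<open>k\<close> times v absorbs the coupling:
      \<open>p * x + q * v\<close> becomes \<open>p\<close> times \<open>X\<close>. The derivative
      of \<open>X\<close> is still y, because either \<open>s = 0\<close> or
      \<open>k = 0\<close>.\<close>
    define X where "X w = fst w + k * snd (snd w)" for w :: "real \<times> real \<times> real"
    \<comment> \<open>The coefficient \<open>p + C * b\<close> is the one that cancels the mixed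
      product of \<open>X\<close> and y in the derivative, leaving the three nonpositive terms of
      \<open>dG\<close>.\<close>
    define G where "G w w' = fst (snd w) * fst (snd w') - (p + C * b) * X w * X w'
        + C * (X w * fst (snd w') + fst (snd w) * X w') - d * snd (snd w) * snd (snd w')"
      for w w' :: "real \<times> real \<times> real"
    have dG: "G (x, y, v) (vel_lin (p, b, q, 0, s) (x, y, v)) =
      (b + C) * y\<^sup>2 + \<bar>p\<bar> * b / 2 * (X (x, y, v))\<^sup>2 - \<bar>s\<bar> * v\<^sup>2" for x y v
    proof -
      have "C * p = \<bar>p\<bar> * b / 2" by (simp add: C_def abs_sgn)
      moreover have "d * s = \<bar>s\<bar>" by (simp add: d_def abs_sgn mult.commute)
      moreover have "p * x + q * v = p * X (x, y, v)" by (simp add: X_def pk[symmetric] algebra_simps)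
      moreover have "X (y, p * x + b * y + q * v, s * v) = y" using pqs pk by (auto simp: X_def k_def)
      ultimately show ?thesis
        unfolding G_def by simp algebra
    qed
    have bC: "b + C < 0" using \<open>b < 0\<close> False by (auto simp: C_def sgn_if)
    show ?thesis
    proof (rule main[where G = G and l = "(0, 0, e)"])
      show "bilinear G"
        unfolding bilinear_def G_def X_def by (auto intro!: linearI simp: algebra_simps)
      show "G u v = G v u" for u v by (simp add: G_def algebra_simps)
      show "(0, 0, e) \<bullet> vel_lin (p, b, q, 0, s) w = 0" for w
        by (cases w) (auto simp: e_def)
      show "w = 0" if "G w (vel_lin (p, b, q, 0, s) w) = 0" "((0, 0, e) \<bullet> w)\<^sup>2 \<le> \<bar>G w w\<bar>" for w
      proof (cases w)
        case w: (fields x y v)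
        have "(b + C) * y\<^sup>2 \<le> 0" "\<bar>p\<bar> * b / 2 * (X w)\<^sup>2 \<le> 0" "\<bar>s\<bar> * v\<^sup>2 \<ge> 0"
          using bC \<open>b < 0\<close> by (auto simp: mult_le_0_iff)
        with that(1) have "(b + C) * y\<^sup>2 = 0" "\<bar>p\<bar> * b / 2 * (X w)\<^sup>2 = 0" "\<bar>s\<bar> * v\<^sup>2 = 0"
          unfolding w dG by linarith+
        then have "y = 0" "X w = 0" "s = 0 \<or> v = 0" using bC False \<open>b < 0\<close> by auto
        moreover from this have "v = 0"
          using that(2) by (auto simp: G_def d_def e_def w)
        ultimately show ?thesis by (simp add: w X_def zero_prod_def)
      qed
    qed
  next
    case True
    then have s: "s \<noteq> 0" "q = 0" "p = 0" using pqs by auto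
    define G where "G w w' = fst (snd w) * fst (snd w') - sgn s * snd (snd w) * snd (snd w')"
      for w w' :: "real \<times> real \<times> real"
    have dG: "G (x, y, v) (vel_lin (p, b, q, 0, s) (x, y, v)) = b * y\<^sup>2 - \<bar>s\<bar> * v\<^sup>2" for x y v
      by (simp add: G_def s abs_sgn power2_eq_square algebra_simps)
    show ?thesis
    \<comment> \<open>With \<open>p = 0\<close> and \<open>q = 0\<close> the equations are x' = y
      and y' = b y, so \<open>x - y / b\<close> is conserved. It detects the kernel direction, on
      which \<open>G\<close> vanishes.\<close>
    proof (rule main[where G = G and l = "(1, - 1 / b, 0)"])
      show "bilinear G"
        unfolding bilinear_def G_def by (auto intro!: linearI simp: algebra_simps)
      show "G u v = G v u" for u v by (simp add: G_def algebra_simps)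
      show "(1, - 1 / b, 0) \<bullet> vel_lin (p, b, q, 0, s) w = 0" for w
        using \<open>b < 0\<close> by (cases w) (auto simp: s)
      show "w = 0" if "G w (vel_lin (p, b, q, 0, s) w) = 0" "((1, - 1 / b, 0) \<bullet> w)\<^sup>2 \<le> \<bar>G w w\<bar>" for w
      proof (cases w)
        case w: (fields x y v)
        have "b * y\<^sup>2 \<le> 0" "\<bar>s\<bar> * v\<^sup>2 \<ge> 0"
          using \<open>b < 0\<close> by (auto simp: mult_le_0_iff)
        with that(1) have "b * y\<^sup>2 = 0" "\<bar>s\<bar> * v\<^sup>2 = 0"
          unfolding w dG by linarith+
        then have "y = 0" "v = 0" using \<open>b < 0\<close> s by auto
        moreover from this have "x = 0"
          using that(2) by (auto simp: G_def w)
        ultimately show ?thesis by (simp add: w zero_prod_def)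
      qed
    qed
  qed
qed

text \<open>Uniqueness for the zero solution: the inequality 2 |a d| \<le> a^2 + d^2, applied to
  each product of components, bounds the derivative of the squared norm by a continuous multiple of
  the squared norm, and \<open>zero_of_derivative_bound\<close> applies.\<close>

lemma linear_ode_zero:
  assumes W: "\<And>t. (W has_vector_derivative vel_lin (c t) (W t)) (at t)"
    and c: "continuous_on UNIV c" and z: "W a = 0"
  shows "W t = 0"
proof -
  obtain p b q n s where ceq: "c = (\<lambda>t. (p t, b t, q t, n t, s t))"
    by (rule that[of "\<lambda>t. fst (c t)" "\<lambda>t. fst (snd (c t))" "\<lambda>t. fst (snd (snd (c t)))"
          "\<lambda>t. fst (snd (snd (snd (c t))))" "\<lambda>t. snd (snd (snd (snd (c t))))"]) auto
  define x y v where "x t = fst (W t)" and "y t = fst (snd (W t))" and "v t = snd (snd (W t))" for t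
  have Weq: "W t = (x t, y t, v t)" for t by (simp add: x_def y_def v_def)
  have "continuous_on UNIV (\<lambda>t. fst (c t))" "continuous_on UNIV (\<lambda>t. fst (snd (c t)))"
    "continuous_on UNIV (\<lambda>t. fst (snd (snd (c t))))" "continuous_on UNIV (\<lambda>t. fst (snd (snd (snd (c t)))))"
    "continuous_on UNIV (\<lambda>t. snd (snd (snd (snd (c t)))))"
    by (intro continuous_intros c)+
  then have cont: "continuous_on UNIV (\<lambda>t. 2 * (1 + \<bar>p t\<bar> + \<bar>b t\<bar> + \<bar>q t\<bar> + \<bar>n t\<bar> + \<bar>s t\<bar>))"
    unfolding ceq by (intro continuous_intros) simp_all
  have d1: "((\<lambda>t. fst (W t)) has_vector_derivative y t) (at t)" for t
    using bounded_linear.has_vector_derivative[OF bounded_linear_fst W[of t]]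
    by (simp add: ceq Weq)
  have d23: "((\<lambda>t. snd (W t)) has_vector_derivative (p t * x t + b t * y t + q t * v t, n t * x t + s t * v t)) (at t)" for t
    using bounded_linear.has_vector_derivative[OF bounded_linear_snd W[of t]]
    by (simp add: ceq Weq)
  have dx: "(x has_real_derivative y t) (at t)" for t
    using d1 by (simp add: has_real_derivative_iff_has_vector_derivative x_def[abs_def])
  have dy: "(y has_real_derivative p t * x t + b t * y t + q t * v t) (at t)" for t
    using bounded_linear.has_vector_derivative[OF bounded_linear_fst d23]
    by (simp add: has_real_derivative_iff_has_vector_derivative y_def[abs_def])
  have dv: "(v has_real_derivative n t * x t + s t * v t) (at t)" for t
    using bounded_linear.has_vector_derivative[OF bounded_linear_snd d23]
    by (simp add: has_real_derivative_iff_has_vector_derivative v_def[abs_def])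
  define N where "N t = (x t)\<^sup>2 + (y t)\<^sup>2 + (v t)\<^sup>2" for t
  define N' where "N' t = 2 * (x t * y t) + 2 * p t * (x t * y t) + 2 * b t * (y t * y t) + 2 * q t * (y t * v t)
     + 2 * n t * (x t * v t) + 2 * s t * (v t * v t)" for t
  have dN: "(N has_real_derivative N' t) (at t)" for t
    unfolding N_def[abs_def] N'_def
    by (auto intro!: derivative_eq_intros dx dy dv simp: algebra_simps)
  have bd: "\<bar>N' t\<bar> \<le> 2 * (1 + \<bar>p t\<bar> + \<bar>b t\<bar> + \<bar>q t\<bar> + \<bar>n t\<bar> + \<bar>s t\<bar>) * N t" for t
  proof -
    have *: "\<bar>k * (a * d)\<bar> \<le> \<bar>k\<bar> * N t" if "2 * \<bar>a * d\<bar> \<le> 2 * N t" for k a d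
      using that by (simp add: abs_mult mult_left_mono)
    have tri: "\<bar>a + d\<bar> \<le> a' + d'" if "\<bar>a\<bar> \<le> a'" "\<bar>d\<bar> \<le> d'" for a d a' d' :: real
      using that by linarith
    have am: "2 * \<bar>a * d\<bar> \<le> a\<^sup>2 + d\<^sup>2" for a d :: real
      using zero_le_power2[of "\<bar>a\<bar> - \<bar>d\<bar>"] by (simp add: power2_diff abs_mult)
    have m1: "2 * \<bar>x t * y t\<bar> \<le> 2 * N t"
      by (rule order_trans[OF am]) (simp add: N_def)
    have m2: "2 * \<bar>y t * y t\<bar> \<le> 2 * N t"
      by (rule order_trans[OF am]) (simp add: N_def)
    have m3: "2 * \<bar>y t * v t\<bar> \<le> 2 * N t"
      by (rule order_trans[OF am]) (simp add: N_def)
    have m4: "2 * \<bar>x t * v t\<bar> \<le> 2 * N t"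
      by (rule order_trans[OF am]) (simp add: N_def)
    have m5: "2 * \<bar>v t * v t\<bar> \<le> 2 * N t"
      by (rule order_trans[OF am]) (simp add: N_def)
    have "\<bar>N' t\<bar> \<le> \<bar>2\<bar> * N t + \<bar>2 * p t\<bar> * N t + \<bar>2 * b t\<bar> * N t + \<bar>2 * q t\<bar> * N t + \<bar>2 * n t\<bar> * N t + \<bar>2 * s t\<bar> * N t"
      unfolding N'_def
      by (rule tri[OF tri[OF tri[OF tri[OF tri[OF *[OF m1] *[OF m1]] *[OF m2]] *[OF m3]] *[OF m4]] *[OF m5]])
    then show ?thesis by (simp add: abs_mult algebra_simps)
  qed
  have "N t = 0"
    by (rule zero_of_derivative_bound[OF dN bd _ cont, of a])
      (use z in \<open>auto simp: N_def Weq zero_prod_def\<close>)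
  then show ?thesis
    by (auto simp: N_def Weq zero_prod_def add_nonneg_eq_0_iff)
qed

section \<open>Inverse functions in the plane and the branches of solutions\<close>

text \<open>Restricting first to the open set of nonzero determinant makes Cramer's formula for the
  derivative of \<open>g\<close> valid on all of \<open>V\<close> and not only at the origin. This
  is what later makes the branches differentiable on a whole square of parameters, with explicit
  derivatives.\<close>

lemma plane_inverse:
  fixes G1 G2 a b c d :: "real \<times> real \<Rightarrow> real"
  assumes "open S" "(0, 0) \<in> S"
    and G1: "\<And>z. z \<in> S \<Longrightarrow> (G1 has_derivative (\<lambda>(s, t). a z * s + b z * t)) (at z)"
    and G2: "\<And>z. z \<in> S \<Longrightarrow> (G2 has_derivative (\<lambda>(s, t). c z * s + d z * t)) (at z)"
    and cont: "continuous_on S a" "continuous_on S b" "continuous_on S c" "continuous_on S d"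
    and zero: "G1 (0, 0) = 0" "G2 (0, 0) = 0"
    and det: "a (0, 0) * d (0, 0) - b (0, 0) * c (0, 0) \<noteq> 0"
  obtains U V g where "open U" "(0, 0) \<in> U" "U \<subseteq> S" "open V" "(0, 0) \<in> V"
    "inj_on (\<lambda>z. (G1 z, G2 z)) U"
    "\<And>y. y \<in> V \<Longrightarrow> g y \<in> U" "\<And>y. y \<in> V \<Longrightarrow> G1 (g y) = fst y" "\<And>y. y \<in> V \<Longrightarrow> G2 (g y) = snd y"
    "\<And>y. y \<in> V \<Longrightarrow> (g has_derivative (\<lambda>(s, t). let e = a (g y) * d (g y) - b (g y) * c (g y) in
        ((d (g y) * s - b (g y) * t) / e, (a (g y) * t - c (g y) * s) / e))) (at y)"
proof -
  define S' where "S' = {z \<in> S. a z * d z - b z * c z \<noteq> 0}"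
  have "open S'"
  proof -
    have "continuous_on S (\<lambda>z. a z * d z - b z * c z)" by (intro continuous_intros cont)
    then have "open (S \<inter> (\<lambda>z. a z * d z - b z * c z) -` (- {0}))"
      using \<open>open S\<close> by (intro continuous_open_preimage) auto
    moreover have "S' = S \<inter> (\<lambda>z. a z * d z - b z * c z) -` (- {0})" by (auto simp: S'_def)
    ultimately show ?thesis by simp
  qed
  define G where "G z = (G1 z, G2 z)" for z
  define L where "L z st = (a z * fst st + b z * snd st, c z * fst st + d z * snd st)" for z and st :: "real \<times> real"
  have bl: "bounded_linear (L z)" for z
    unfolding L_def[abs_def] by (intro bounded_linear_intros)
  then have apply_L: "blinfun_apply (Blinfun (L z)) = L z" for z
    by (simp add: bounded_linear_Blinfun_apply)
  have "(G has_derivative L z) (at z)" if "z \<in> S'" for z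
    unfolding G_def[abs_def] L_def[abs_def]
    using has_derivative_Pair[OF G1[of z] G2[of z]] that by (simp add: S'_def case_prod_beta)
  then have G: "(G has_derivative blinfun_apply (Blinfun (L z))) (at z)" if "z \<in> S'" for z
    using that by (simp add: apply_L)
  have "continuous_on S' (\<lambda>z. Blinfun (L z))"
  proof (rule continuous_on_blinfun_componentwise)
    fix i :: "real \<times> real"
    have "continuous_on S' (\<lambda>z. L z i)"
      unfolding L_def by (intro continuous_intros continuous_on_subset[OF cont(1)] continuous_on_subset[OF cont(2)]
          continuous_on_subset[OF cont(3)] continuous_on_subset[OF cont(4)]) (auto simp: S'_def)
    then show "continuous_on S' (\<lambda>z. blinfun_apply (Blinfun (L z)) i)" by (simp add: apply_L)
  qed
  define I where "I z st = (let e = a z * d z - b z * c z in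
      ((d z * fst st - b z * snd st) / e, (a z * snd st - c z * fst st) / e))" for z and st :: "real \<times> real"
  have IL: "I z (L z st) = st" and LI: "L z (I z st) = st" if "z \<in> S'" for z st
    using that by (auto simp: I_def L_def S'_def Let_def prod_eq_iff divide_simps) (auto simp: algebra_simps)
  have blI: "bounded_linear (I z)" for z
    unfolding I_def[abs_def] Let_def divide_inverse by (intro bounded_linear_intros)
  have "(0, 0) \<in> S'" using assms(2) det by (simp add: S'_def)
  then have "Blinfun (I (0, 0)) o\<^sub>L Blinfun (L (0, 0)) = id_blinfun"
    by (intro blinfun_eqI) (simp add: bounded_linear_Blinfun_apply blI apply_L IL)
  from inverse_function_theorem[OF \<open>open S'\<close> G \<open>continuous_on S' _\<close> \<open>(0, 0) \<in> S'\<close> this]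
  obtain U V g g' where U: "open U" "U \<subseteq> S'" "(0, 0) \<in> U" and V: "open V" "G (0, 0) \<in> V"
    and hom: "homeomorphism U V G g"
    and g: "\<And>y. y \<in> V \<Longrightarrow> (g has_derivative g' y) (at y)"
      "\<And>y. y \<in> V \<Longrightarrow> g' y = inv (blinfun_apply (Blinfun (L (g y))))" by metis
  have gU: "g y \<in> U" "G (g y) = y" if "y \<in> V" for y
    using hom that by (auto simp: homeomorphism_def)
  have "(g has_derivative I (g y)) (at y)" if "y \<in> V" for y
  proof -
    have "g y \<in> S'" using subsetD[OF U(2) gU(1)[OF that]] .
    then have "inv (L (g y)) = I (g y)"
      by (intro inv_unique_comp) (auto simp: fun_eq_iff IL LI)
    then show ?thesis using g[OF that] by (simp add: apply_L)
  qed
  moreover have "inj_on G U" using hom by (metis homeomorphism_def inj_on_inverseI)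
  ultimately show ?thesis
    using U V gU
    by (intro that[of U V g])
      (auto simp: G_def[abs_def] zero S'_def I_def[abs_def] case_prod_unfold prod_eq_iff)
qed

section \<open>From realized power series to C^1 functions of y1^2 and r^2\<close>

lemma has_derivative_partials:
  assumes "f differentiable (at z)"
  shows "(f has_derivative (\<lambda>(s, t). partial1 f z * s + partial2 f z * t)) (at z)"
proof -
  obtain D where D: "(f has_derivative D) (at z)" using assms by (auto simp: differentiable_def)
  then interpret D: bounded_linear D by (rule has_derivative_bounded_linear)
  define d1 d2 where "d1 = D (1, 0)" and "d2 = D (0, 1)"
  have eq1: "D (s, 0) = d1 * s" and eq2: "D (0, s) = d2 * s" for s
    using D.scaleR[of s "(1, 0)"] D.scaleR[of s "(0, 1)"] by (simp_all add: d1_def d2_def mult.commute)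
  have eq: "D (s, t) = d1 * s + d2 * t" for s t
    using D.add[of "(s, 0)" "(0, t)"] eq1[of s] eq2[of t] by simp
  have "((\<lambda>s. f (s, snd z)) has_derivative (\<lambda>s. D (s, 0))) (at (fst z))"
    using has_derivative_compose[OF has_derivative_Pair[OF has_derivative_ident has_derivative_const],
        of f D "fst z" "snd z"] D by simp
  then have "partial1 f z = d1"
    unfolding partial1_def eq1 by (intro DERIV_imp_deriv) (simp add: has_field_derivative_def)
  moreover have "((\<lambda>s. f (fst z, s)) has_derivative (\<lambda>s. D (0, s))) (at (snd z))"
    using has_derivative_compose[OF has_derivative_Pair[OF has_derivative_const has_derivative_ident],
        of f D "fst z" "snd z"] D by simp
  then have "partial2 f z = d2"
    unfolding partial2_def eq2 by (intro DERIV_imp_deriv) (simp add: has_field_derivative_def)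
  ultimately have "D = (\<lambda>(s, t). partial1 f z * s + partial2 f z * t)"
    using eq by (simp add: fun_eq_iff)
  with D show ?thesis by simp
qed

text \<open>The arguments of \<open>f j\<close> are u = y1^2 and v = r^2, with partial derivatives
  \<open>fu j\<close> and \<open>fv j\<close>. Of the realized series the locale keeps the C^1
  regularity, the zero constant term and the two nondegeneracy conditions; all later arguments start
  from these data.\<close>

locale mode_interaction =
  fixes f fu fv :: "nat \<Rightarrow> real \<times> real \<Rightarrow> real" and S :: "(real \<times> real) set"
  assumes open_S: "open S" and zero_S: "(0, 0) \<in> S"
    and der: "\<And>j z. j \<in> {1..4} \<Longrightarrow> z \<in> S \<Longrightarrow> (f j has_derivative (\<lambda>(s, t). fu j z * s + fv j z * t)) (at z)"
    and cont_fu: "\<And>j. j \<in> {1..4} \<Longrightarrow> continuous_on S (fu j)"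
    and cont_fv: "\<And>j. j \<in> {1..4} \<Longrightarrow> continuous_on S (fv j)"
    and f_zero: "\<And>j. j \<in> {1..4} \<Longrightarrow> f j (0, 0) = 0"
    and nondeg: "fu 1 (0, 0) * fv 3 (0, 0) - fu 3 (0, 0) * fv 1 (0, 0) \<noteq> 0" "fu 1 (0, 0) * fv 3 (0, 0) \<noteq> 0"

text \<open>On the intersection of the four neighbourhoods every \<open>f j\<close> is C^1, and the
  Taylor conditions of orders (0, 0), (1, 0) and (0, 1) give the value and the first partial
  derivatives at the origin.\<close>

lemma realizes_mode_interaction:
  assumes "\<forall>j\<in>{1..4}. coeff2 (\<phi> j) 0 0 = 0" and real: "\<forall>j\<in>{1..4}. realizes (f j) (\<phi> j)"
    and "Delta1 \<phi> \<noteq> 0" "coeff2 (\<phi> 1) 1 0 * coeff2 (\<phi> 3) 0 1 \<noteq> 0"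
  obtains S where "mode_interaction f (\<lambda>j. partial1 (f j)) (\<lambda>j. partial2 (f j)) S"
    "\<And>j. j \<in> {1..4} \<Longrightarrow> partial1 (f j) (0, 0) = coeff2 (\<phi> j) 1 0"
    "\<And>j. j \<in> {1..4} \<Longrightarrow> partial2 (f j) (0, 0) = coeff2 (\<phi> j) 0 1"
proof -
  have "\<exists>S. \<forall>j\<in>{1..4}. open (S j) \<and> (0, 0) \<in> S j \<and> smooth_on (S j) (f j)"
    using real unfolding realizes_def by (intro bchoice) auto
  then obtain S where S: "\<And>j. j \<in> {1..4} \<Longrightarrow> open (S j) \<and> (0, 0) \<in> S j \<and> smooth_on (S j) (f j)" by blast
  define S' where "S' = (\<Inter>j\<in>{1..4}. S j)"
  have C1: "Ck_on (Suc 0) (S j) (f j)" if "j \<in> {1..4}" for j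
    using S[OF that] unfolding smooth_on_def by blast
  have vals: "f j (0, 0) = 0" "partial1 (f j) (0, 0) = coeff2 (\<phi> j) 1 0" "partial2 (f j) (0, 0) = coeff2 (\<phi> j) 0 1"
    if "j \<in> {1..4}" for j
  proof -
    have *: "((partial1 ^^ k) ((partial2 ^^ l) (f j))) (0, 0) = fact k * fact l * coeff2 (\<phi> j) k l" for k l
      using real that unfolding realizes_def by blast
    show "f j (0, 0) = 0" "partial1 (f j) (0, 0) = coeff2 (\<phi> j) 1 0" "partial2 (f j) (0, 0) = coeff2 (\<phi> j) 0 1"
      using *[of 0 0] *[of 1 0] *[of 0 1] assms(1) that by simp_all
  qed
  have "mode_interaction f (\<lambda>j. partial1 (f j)) (\<lambda>j. partial2 (f j)) S'"
  proof
    show "open S'" unfolding S'_def using S by (intro open_INT) auto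
    show "(0, 0) \<in> S'" using S by (auto simp: S'_def)
    fix j :: nat assume j: "j \<in> {1..4}"
    then have sub: "S' \<subseteq> S j" by (auto simp: S'_def)
    show "(f j has_derivative (\<lambda>(s, t). partial1 (f j) z * s + partial2 (f j) z * t)) (at z)" if "z \<in> S'" for z
      using C1[OF j] sub that by (intro has_derivative_partials) auto
    show "continuous_on S' (partial1 (f j))" "continuous_on S' (partial2 (f j))"
      using C1[OF j] continuous_on_subset[OF _ sub] by auto
    show "f j (0, 0) = 0" using vals[OF j] by simp
  next
    show "partial1 (f 1) (0, 0) * partial2 (f 3) (0, 0) - partial1 (f 3) (0, 0) * partial2 (f 1) (0, 0) \<noteq> 0"
      "partial1 (f 1) (0, 0) * partial2 (f 3) (0, 0) \<noteq> 0"
      using vals assms(3,4) by (simp_all add: Delta1_def)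
  qed
  with vals(2,3) show ?thesis using that by blast
qed

section \<open>The branches as inverse functions, and their uniqueness in a box\<close>

context mode_interaction
begin

definition jac :: "real \<times> real \<Rightarrow> real" where
  "jac z = fu 1 z * fv 3 z - fu 3 z * fv 1 z"

text \<open>The inverse of minus the Jacobian matrix of \<open>(f 1, f 3)\<close>, by Cramer's rule.
  The mixed mode solves \<open>f 1 z = - \<alpha>1\<close> and \<open>f 3 z = - \<alpha>3\<close>,
  hence the minus sign; at the origin this is the truncated branch \<open>trunc_M\<close>.\<close>

definition inv_jac :: "real \<times> real \<Rightarrow> real \<times> real \<Rightarrow> real \<times> real" where
  "inv_jac z = (\<lambda>(s, t). ((t * fv 1 z - s * fv 3 z) / jac z, (s * fu 3 z - t * fu 1 z) / jac z))"

lemma has_derivative_slice1: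
  assumes "j \<in> {1..4}" "(u, v) \<in> S"
  shows "((\<lambda>u. f j (u, v)) has_real_derivative fu j (u, v)) (at u)"
  using has_derivative_compose[OF has_derivative_Pair[OF has_derivative_ident has_derivative_const] der[OF assms, simplified]]
  by (simp add: has_field_derivative_def case_prod_beta)

lemma has_derivative_slice2:
  assumes "j \<in> {1..4}" "(u, v) \<in> S"
  shows "((\<lambda>v. f j (u, v)) has_real_derivative fv j (u, v)) (at v)"
  using has_derivative_compose[OF has_derivative_Pair[OF has_derivative_const has_derivative_ident] der[OF assms, simplified]]
  by (simp add: has_field_derivative_def case_prod_beta)

end

text \<open>\<open>\<eta>\<close> bounds the values u and v, \<open>\<delta>\<close> the parameters.
  \<open>p\<close>, \<open>h\<close> and \<open>m\<close> return values of either sign, so that they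
  remain differentiable where a branch ceases to be real. The condition \<open>box\<close> fixes the
  signs of \<open>fu 1\<close> and \<open>fv 3\<close> and keeps the phase speed
  \<open>1 + f 4\<close> positive; \<open>inj_p\<close>, \<open>inj_h\<close> and
  \<open>inj_m\<close> make the solutions unique within the box.\<close>

locale mode_branches = mode_interaction +
  fixes \<eta> \<delta> :: real and p h :: "real \<Rightarrow> real" and m :: "real \<times> real \<Rightarrow> real \<times> real"
  assumes eta_pos: "\<eta> > 0" and delta_pos: "\<delta> > 0"
    and box: "\<And>u v. \<bar>u\<bar> < \<eta> \<Longrightarrow> \<bar>v\<bar> < \<eta> \<Longrightarrow> (u, v) \<in> S \<and> fu 1 (u, v) * fu 1 (0, 0) > 0 \<and>
      fv 3 (u, v) * fv 3 (0, 0) > 0 \<and> f 4 (u, v) > -1 \<and> jac (u, v) \<noteq> 0"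
    and p: "\<And>\<alpha>. \<bar>\<alpha>\<bar> < \<delta> \<Longrightarrow> \<bar>p \<alpha>\<bar> < \<eta> \<and> f 1 (p \<alpha>, 0) = - \<alpha>"
    and h: "\<And>\<alpha>. \<bar>\<alpha>\<bar> < \<delta> \<Longrightarrow> \<bar>h \<alpha>\<bar> < \<eta> \<and> f 3 (0, h \<alpha>) = - \<alpha>"
    and m: "\<And>\<alpha>1 \<alpha>3. \<bar>\<alpha>1\<bar> < \<delta> \<Longrightarrow> \<bar>\<alpha>3\<bar> < \<delta> \<Longrightarrow>
      \<bar>fst (m (\<alpha>1, \<alpha>3))\<bar> < \<eta> \<and> \<bar>snd (m (\<alpha>1, \<alpha>3))\<bar> < \<eta> \<and>
      f 1 (m (\<alpha>1, \<alpha>3)) = - \<alpha>1 \<and> f 3 (m (\<alpha>1, \<alpha>3)) = - \<alpha>3"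
    and inj_p: "\<And>u u'. \<bar>u\<bar> < \<eta> \<Longrightarrow> \<bar>u'\<bar> < \<eta> \<Longrightarrow> f 1 (u, 0) = f 1 (u', 0) \<Longrightarrow> u = u'"
    and inj_h: "\<And>u u'. \<bar>u\<bar> < \<eta> \<Longrightarrow> \<bar>u'\<bar> < \<eta> \<Longrightarrow> f 3 (0, u) = f 3 (0, u') \<Longrightarrow> u = u'"
    and inj_m: "\<And>u v u' v'. \<bar>u\<bar> < \<eta> \<Longrightarrow> \<bar>v\<bar> < \<eta> \<Longrightarrow> \<bar>u'\<bar> < \<eta> \<Longrightarrow> \<bar>v'\<bar> < \<eta> \<Longrightarrow>
      f 1 (u, v) = f 1 (u', v') \<Longrightarrow> f 3 (u, v) = f 3 (u', v') \<Longrightarrow> (u, v) = (u', v')"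
    and p_deriv: "\<And>\<alpha>. \<bar>\<alpha>\<bar> < \<delta> \<Longrightarrow> (p has_real_derivative - 1 / fu 1 (p \<alpha>, 0)) (at \<alpha>)"
    and h_deriv: "\<And>\<alpha>. \<bar>\<alpha>\<bar> < \<delta> \<Longrightarrow> (h has_real_derivative - 1 / fv 3 (0, h \<alpha>)) (at \<alpha>)"
    and m_deriv: "\<And>\<alpha>1 \<alpha>3. \<bar>\<alpha>1\<bar> < \<delta> \<Longrightarrow> \<bar>\<alpha>3\<bar> < \<delta> \<Longrightarrow>
      (m has_derivative inv_jac (m (\<alpha>1, \<alpha>3))) (at (\<alpha>1, \<alpha>3))"

lemma open_contains_box:
  assumes "open U" "(0, 0) \<in> (U :: (real \<times> real) set)"
  shows "\<exists>e>0. \<forall>u v. \<bar>u\<bar> < e \<longrightarrow> \<bar>v\<bar> < e \<longrightarrow> (u, v) \<in> U"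
proof -
  obtain e where e: "e > 0" "ball (0, 0) e \<subseteq> U" using assms open_contains_ball by blast
  have "(u, v) \<in> U" if "\<bar>u\<bar> < e / 2" "\<bar>v\<bar> < e / 2" for u v
  proof -
    have "norm (- u, - v) \<le> \<bar>u\<bar> + \<bar>v\<bar>" using norm_Pair_le[of "- u" "- v"] by simp
    then have "(u, v) \<in> ball (0, 0) e" using that by (simp add: dist_norm)
    then show ?thesis using e(2) by blast
  qed
  then show ?thesis using e(1) by (intro exI[of _ "e / 2"]) auto
qed

context mode_interaction
begin

text \<open>Two inversions are enough. The map \<open>(- f 1, - f 3)\<close> yields
  \<open>m\<close>. The decoupled map sending (u, v) to \<open>(- f 1 (u, 0), - f 3 (0, v))\<close>
  has a diagonal derivative, invertible because \<open>fu 1\<close> and \<open>fv 3\<close> do not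
  vanish at the origin, and the two components of its inverse \<open>g\<close> are \<open>p\<close>
  and \<open>h\<close>.\<close>

lemma branches_exist: "\<exists>\<eta> \<delta> p h m. mode_branches f fu fv S \<eta> \<delta> p h m"
proof -
  have j: "1 \<in> {1..4::nat}" "3 \<in> {1..4::nat}" "4 \<in> {1..4::nat}" by auto
  have d1: "((\<lambda>z. - f 1 z) has_derivative (\<lambda>(s, t). - fu 1 z * s + - fv 1 z * t)) (at z)" if "z \<in> S" for z
    using has_derivative_minus[OF der[OF j(1) that]] by (simp add: case_prod_unfold)
  have d3: "((\<lambda>z. - f 3 z) has_derivative (\<lambda>(s, t). - fu 3 z * s + - fv 3 z * t)) (at z)" if "z \<in> S" for z
    using has_derivative_minus[OF der[OF j(2) that]] by (simp add: case_prod_unfold)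
  obtain U V m where U: "open U" "(0, 0) \<in> U" "U \<subseteq> S" and V: "open V" "(0, 0) \<in> V"
    and inj: "inj_on (\<lambda>z. (- f 1 z, - f 3 z)) U"
    and m: "\<And>y. y \<in> V \<Longrightarrow> m y \<in> U" "\<And>y. y \<in> V \<Longrightarrow> - f 1 (m y) = fst y" "\<And>y. y \<in> V \<Longrightarrow> - f 3 (m y) = snd y"
    and dm: "\<And>y. y \<in> V \<Longrightarrow> (m has_derivative (\<lambda>(s, t). let e = - fu 1 (m y) * - fv 3 (m y) - - fv 1 (m y) * - fu 3 (m y) in
        ((- fv 3 (m y) * s - - fv 1 (m y) * t) / e, (- fu 1 (m y) * t - - fu 3 (m y) * s) / e))) (at y)"
  proof (rule plane_inverse[OF open_S zero_S d1 d3])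
    show "- fu 1 (0, 0) * - fv 3 (0, 0) - - fv 1 (0, 0) * - fu 3 (0, 0) \<noteq> 0"
      using nondeg by (simp add: mult.commute)
  qed (use f_zero in \<open>auto intro!: continuous_on_minus cont_fu cont_fv\<close>)
  have dm': "(m has_derivative inv_jac (m y)) (at y)" if "y \<in> V" for y
    using dm[OF that] by (simp add: inv_jac_def jac_def Let_def mult.commute)
  define S2 where "S2 = {z. (fst z, 0) \<in> S} \<inter> {z. (0, snd z) \<in> S}"
  have "open S2"
  proof -
    have "open ((\<lambda>z::real \<times> real. (fst z, 0::real)) -` S)" "open ((\<lambda>z::real \<times> real. (0::real, snd z)) -` S)"
      by (intro open_vimage open_S continuous_intros)+
    then show ?thesis unfolding S2_def vimage_def by (rule open_Int)
  qed
  have e1: "((\<lambda>z. - f 1 (fst z, 0)) has_derivative (\<lambda>(s, t). - fu 1 (fst z, 0) * s + 0 * t)) (at z)" if "z \<in> S2" for z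
  proof -
    have "(fst z, 0) \<in> S" using that by (simp add: S2_def)
    from has_derivative_compose[OF has_derivative_Pair[OF has_derivative_fst[OF has_derivative_ident] has_derivative_const]
        d1[OF this]] show ?thesis by (simp add: case_prod_unfold)
  qed
  have e3: "((\<lambda>z. - f 3 (0, snd z)) has_derivative (\<lambda>(s, t). 0 * s + - fv 3 (0, snd z) * t)) (at z)" if "z \<in> S2" for z
  proof -
    have "(0, snd z) \<in> S" using that by (simp add: S2_def)
    from has_derivative_compose[OF has_derivative_Pair[OF has_derivative_const has_derivative_snd[OF has_derivative_ident]]
        d3[OF this]] show ?thesis by (simp add: case_prod_unfold)
  qed
  have ca: "continuous_on S2 (\<lambda>z. - fu 1 (fst z, 0))"
    by (intro continuous_on_minus continuous_on_compose2[OF cont_fu[OF j(1)]] continuous_intros) (auto simp: S2_def)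
  have cd: "continuous_on S2 (\<lambda>z. - fv 3 (0, snd z))"
    by (intro continuous_on_minus continuous_on_compose2[OF cont_fv[OF j(2)]] continuous_intros) (auto simp: S2_def)
  obtain U2 V2 g where U2: "open U2" "(0, 0) \<in> U2" "U2 \<subseteq> S2" and V2: "open V2" "(0, 0) \<in> V2"
    and inj2: "inj_on (\<lambda>z. (- f 1 (fst z, 0), - f 3 (0, snd z))) U2"
    and g: "\<And>y. y \<in> V2 \<Longrightarrow> g y \<in> U2" "\<And>y. y \<in> V2 \<Longrightarrow> - f 1 (fst (g y), 0) = fst y"
      "\<And>y. y \<in> V2 \<Longrightarrow> - f 3 (0, snd (g y)) = snd y"
    and dg: "\<And>y. y \<in> V2 \<Longrightarrow> (g has_derivative (\<lambda>(s, t). let e = - fu 1 (fst (g y), 0) * - fv 3 (0, snd (g y)) - 0 * 0 in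
        ((- fv 3 (0, snd (g y)) * s - 0 * t) / e, (- fu 1 (fst (g y), 0) * t - 0 * s) / e))) (at y)"
  proof (rule plane_inverse[OF \<open>open S2\<close> _ e1 e3 ca _ _ cd])
    show "(0, 0) \<in> S2" using zero_S by (simp add: S2_def)
    show "- fu 1 (fst (0, 0), 0) * - fv 3 (0, snd (0, 0)) - 0 * 0 \<noteq> 0" using nondeg by simp
  qed (use f_zero in auto)
  \<comment> \<open>One open set for all requirements of the box: both maps are injective on it, and
    \<open>fu 1\<close>, \<open>fv 3\<close>, \<open>f 4 + 1\<close> and \<open>jac\<close> have the
    same signs as at the origin.\<close>
  define W where "W = U \<inter> U2 \<inter> {z \<in> S. fu 1 z * fu 1 (0, 0) > 0} \<inter> {z \<in> S. fv 3 z * fv 3 (0, 0) > 0}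
     \<inter> {z \<in> S. f 4 z + 1 > 0} \<inter> {z \<in> S. jac z * jac (0, 0) > 0}"
  have op: "open {z \<in> S. k z > 0}" if "continuous_on S k" for k :: "real \<times> real \<Rightarrow> real"
  proof -
    have "open (S \<inter> k -` {0<..})" using that open_S by (intro continuous_open_preimage) auto
    moreover have "S \<inter> k -` {0<..} = {z \<in> S. k z > 0}" by auto
    ultimately show ?thesis by simp
  qed
  have cf: "continuous_on S (f 4)"
    using der[OF j(3)] by (intro continuous_at_imp_continuous_on) (auto intro: has_derivative_continuous)
  have "open W"
    unfolding W_def jac_def
    by (intro open_Int U U2 op continuous_intros cont_fu cont_fv cf j)
  moreover have "(0, 0) \<in> W"
    using U(2) U2(2) zero_S nondeg f_zero[OF j(3)]
    by (auto simp: W_def jac_def zero_less_mult_iff linorder_neq_iff)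
  ultimately obtain \<eta> where \<eta>: "\<eta> > 0" "\<And>u v. \<bar>u\<bar> < \<eta> \<Longrightarrow> \<bar>v\<bar> < \<eta> \<Longrightarrow> (u, v) \<in> W"
    using open_contains_box[of W] by blast
  \<comment> \<open>The inverses are so far only known to take values in the domains of injectivity;
    that they fix the origin follows from injectivity.\<close>
  have m0: "m (0, 0) = (0, 0)"
    using inj_onD[OF inj, of "m (0, 0)" "(0, 0)"] m[OF V(2)] U(2) f_zero by auto
  have g0: "g (0, 0) = (0, 0)"
    using inj_onD[OF inj2, of "g (0, 0)" "(0, 0)"] g[OF V2(2)] U2(2) f_zero by auto
  \<comment> \<open>Restricting the parameters to the preimages of \<open>Q\<close> keeps the
    solutions in the box of radius \<open>\<eta>\<close>, where they are unique.\<close>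
  define Q where "Q = {z :: real \<times> real. \<bar>fst z\<bar> < \<eta> \<and> \<bar>snd z\<bar> < \<eta>}"
  have "open Q" unfolding Q_def by (intro open_Collect_conj open_Collect_less continuous_intros)
  have cm: "continuous_on V m" using dm' by (intro continuous_at_imp_continuous_on) (auto intro: has_derivative_continuous)
  have cg: "continuous_on V2 g" using dg by (intro continuous_at_imp_continuous_on) (blast intro: has_derivative_continuous)
  have "open ((V \<inter> m -` Q) \<inter> (V2 \<inter> g -` Q))"
    by (intro open_Int continuous_open_preimage cm cg V V2 \<open>open Q\<close>)
  moreover have "(0, 0) \<in> (V \<inter> m -` Q) \<inter> (V2 \<inter> g -` Q)"
    using V V2 m0 g0 \<eta>(1) by (auto simp: Q_def)
  ultimately obtain \<delta> where \<delta>: "\<delta> > 0"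
    "\<And>s t. \<bar>s\<bar> < \<delta> \<Longrightarrow> \<bar>t\<bar> < \<delta> \<Longrightarrow> (s, t) \<in> V \<and> m (s, t) \<in> Q \<and> (s, t) \<in> V2 \<and> g (s, t) \<in> Q"
    using open_contains_box[of "(V \<inter> m -` Q) \<inter> (V2 \<inter> g -` Q)"] by blast
  define p h where "p s = fst (g (s, 0))" and "h t = snd (g (0, t))" for s t
  have "mode_branches f fu fv S \<eta> \<delta> p h m"
  proof
    show "\<eta> > 0" "\<delta> > 0" by fact+
    fix u v :: real assume uv: "\<bar>u\<bar> < \<eta>" "\<bar>v\<bar> < \<eta>"
    then show "(u, v) \<in> S \<and> fu 1 (u, v) * fu 1 (0, 0) > 0 \<and>
      fv 3 (u, v) * fv 3 (0, 0) > 0 \<and> f 4 (u, v) > -1 \<and> jac (u, v) \<noteq> 0"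
      using \<eta>(2)[OF uv] by (auto simp: W_def)
    show "f 1 (u, 0) = f 1 (v, 0) \<Longrightarrow> u = v"
      using inj_onD[OF inj2, of "(u, 0)" "(v, 0)"] \<eta>(2)[OF uv(1), of 0] \<eta>(2)[OF uv(2), of 0] \<eta>(1) by (auto simp: W_def)
    show "f 3 (0, u) = f 3 (0, v) \<Longrightarrow> u = v"
      using inj_onD[OF inj2, of "(0, u)" "(0, v)"] \<eta>(2)[OF _ uv(1), of 0] \<eta>(2)[OF _ uv(2), of 0] \<eta>(1) by (auto simp: W_def)
    fix u' v' :: real assume uv': "\<bar>u'\<bar> < \<eta>" "\<bar>v'\<bar> < \<eta>"
    show "f 1 (u, v) = f 1 (u', v') \<Longrightarrow> f 3 (u, v) = f 3 (u', v') \<Longrightarrow> (u, v) = (u', v')"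
      using inj_onD[OF inj, of "(u, v)" "(u', v')"] \<eta>(2)[OF uv] \<eta>(2)[OF uv'] by (auto simp: W_def)
  next
    fix s t :: real assume s: "\<bar>s\<bar> < \<delta>"
    have s0: "(s, 0) \<in> V2" "g (s, 0) \<in> Q" and os: "(0, s) \<in> V2" "g (0, s) \<in> Q"
      using \<delta>(2)[OF s, of 0] \<delta>(2)[OF _ s, of 0] \<delta>(1) by auto
    show "\<bar>p s\<bar> < \<eta> \<and> f 1 (p s, 0) = - s" "\<bar>h s\<bar> < \<eta> \<and> f 3 (0, h s) = - s"
      using g[OF s0(1)] g[OF os(1)] s0(2) os(2) by (auto simp: p_def h_def Q_def)
    have nz: "fu 1 (u, v) \<noteq> 0" "fv 3 (u, v) \<noteq> 0" if "\<bar>u\<bar> < \<eta>" "\<bar>v\<bar> < \<eta>" for u v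
      using \<eta>(2)[OF that] by (auto simp: W_def)
    have "((\<lambda>s. fst (g (s, 0))) has_derivative (\<lambda>s. s * (- 1 / fu 1 (p s', 0)))) (at s')" if "s' = s" for s'
      using has_derivative_fst[OF has_derivative_compose[OF has_derivative_Pair[OF has_derivative_ident has_derivative_const] dg[OF s0(1)]]]
        nz[of 0 "snd (g (s, 0))"] nz[of "p s" 0] s0(2) \<eta>(1) that by (simp add: case_prod_unfold p_def Q_def)
    then show "(p has_real_derivative - 1 / fu 1 (p s, 0)) (at s)"
      unfolding has_field_derivative_def p_def[abs_def] by (simp only: mult_commute_abs)
    have "((\<lambda>s. snd (g (0, s))) has_derivative (\<lambda>s. s * (- 1 / fv 3 (0, h s')))) (at s')" if "s' = s" for s'
      using has_derivative_snd[OF has_derivative_compose[OF has_derivative_Pair[OF has_derivative_const has_derivative_ident] dg[OF os(1)]]]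
        nz[of "fst (g (0, s))" 0] nz[of 0 "h s"] os(2) \<eta>(1) that by (simp add: case_prod_unfold h_def Q_def)
    then show "(h has_real_derivative - 1 / fv 3 (0, h s)) (at s)"
      unfolding has_field_derivative_def h_def[abs_def] by (simp only: mult_commute_abs)
    assume t: "\<bar>t\<bar> < \<delta>"
    then have st: "(s, t) \<in> V" "m (s, t) \<in> Q" using \<delta>(2)[OF s t] by auto
    show "\<bar>fst (m (s, t))\<bar> < \<eta> \<and> \<bar>snd (m (s, t))\<bar> < \<eta> \<and> f 1 (m (s, t)) = - s \<and> f 3 (m (s, t)) = - t"
      using m[OF st(1)] st(2) by (auto simp: Q_def)
    show "(m has_derivative inv_jac (m (s, t))) (at (s, t))" using dm'[OF st(1)] .
  qed
  then show ?thesis by blast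
qed

end

context mode_branches
begin

lemma p_unique: "\<bar>\<alpha>\<bar> < \<delta> \<Longrightarrow> \<bar>u\<bar> < \<eta> \<Longrightarrow> \<alpha> + f 1 (u, 0) = 0 \<longleftrightarrow> u = p \<alpha>"
  using p[of \<alpha>] inj_p[of u "p \<alpha>"] by auto

lemma h_unique: "\<bar>\<alpha>\<bar> < \<delta> \<Longrightarrow> \<bar>v\<bar> < \<eta> \<Longrightarrow> \<alpha> + f 3 (0, v) = 0 \<longleftrightarrow> v = h \<alpha>"
  using h[of \<alpha>] inj_h[of v "h \<alpha>"] by auto

lemma m_unique:
  assumes "\<bar>\<alpha>1\<bar> < \<delta>" "\<bar>\<alpha>3\<bar> < \<delta>" "\<bar>u\<bar> < \<eta>" "\<bar>v\<bar> < \<eta>"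
  shows "\<alpha>1 + f 1 (u, v) = 0 \<and> \<alpha>3 + f 3 (u, v) = 0 \<longleftrightarrow> (u, v) = m (\<alpha>1, \<alpha>3)"
  using m[OF assms(1,2)] inj_m[OF assms(3,4), of "fst (m (\<alpha>1, \<alpha>3))" "snd (m (\<alpha>1, \<alpha>3))"] by (auto simp: prod_eq_iff)

lemma zero_values: "p 0 = 0" "h 0 = 0" "m (0, 0) = (0, 0)"
  using p_unique[of 0 0] h_unique[of 0 0] m_unique[of 0 0 0 0] eta_pos delta_pos f_zero by auto

lemma m_snd_zero: "\<bar>\<alpha>1\<bar> < \<delta> \<Longrightarrow> \<bar>\<alpha>3\<bar> < \<delta> \<Longrightarrow> snd (m (\<alpha>1, \<alpha>3)) = 0 \<Longrightarrow> fst (m (\<alpha>1, \<alpha>3)) = p \<alpha>1"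
  using m[of \<alpha>1 \<alpha>3] p_unique[of \<alpha>1 "fst (m (\<alpha>1, \<alpha>3))"] by (metis add.right_inverse prod.collapse)

lemma m_fst_zero: "\<bar>\<alpha>1\<bar> < \<delta> \<Longrightarrow> \<bar>\<alpha>3\<bar> < \<delta> \<Longrightarrow> fst (m (\<alpha>1, \<alpha>3)) = 0 \<Longrightarrow> snd (m (\<alpha>1, \<alpha>3)) = h \<alpha>3"
  using m[of \<alpha>1 \<alpha>3] h_unique[of \<alpha>3 "snd (m (\<alpha>1, \<alpha>3))"] by (metis add.right_inverse prod.collapse)

text \<open>\<open>c\<close> times \<open>F\<close> is strictly increasing, so \<open>u\<close> has
  the sign of \<open>c * F u\<close>, that is of \<open>- c * \<alpha>\<close>. Thus the full branch
  is real for exactly the same parameters as the truncated one, on the whole interval and not just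
  asymptotically.\<close>

lemma slice_sign:
  fixes F :: "real \<Rightarrow> real"
  assumes F: "\<And>u. \<bar>u\<bar> < \<eta> \<Longrightarrow> (F has_real_derivative F' u) (at u)" and s: "\<And>u. \<bar>u\<bar> < \<eta> \<Longrightarrow> F' u * c > 0"
    and "F 0 = 0" "\<bar>u\<bar> < \<eta>" "F u = - \<alpha>"
  shows "u > 0 \<longleftrightarrow> - \<alpha> / c > 0"
proof -
  have c: "c \<noteq> 0" using s[of 0] eta_pos by auto
  have mono: "c * F a < c * F b" if "a < b" "\<bar>a\<bar> < \<eta>" "\<bar>b\<bar> < \<eta>" for a b
  proof (rule DERIV_pos_imp_increasing[OF \<open>a < b\<close>])
    fix x assume "a \<le> x" "x \<le> b"
    then have "\<bar>x\<bar> < \<eta>" using that by auto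
    then show "\<exists>y. ((\<lambda>x. c * F x) has_real_derivative y) (at x) \<and> 0 < y"
      using DERIV_cmult[OF F, of x c] s[of x] by (auto simp: mult.commute)
  qed
  have "u > 0 \<longleftrightarrow> c * F u > 0"
    using mono[of 0 u] mono[of u 0] eta_pos assms(3,4) by (cases u "0::real" rule: linorder_cases) auto
  then show ?thesis
    using c assms(5) by (auto simp: divide_less_0_iff zero_less_mult_iff mult_less_0_iff)
qed

lemma p_pos: "\<bar>\<alpha>\<bar> < \<delta> \<Longrightarrow> p \<alpha> > 0 \<longleftrightarrow> - \<alpha> / fu 1 (0, 0) > 0"
  using slice_sign[of "\<lambda>u. f 1 (u, 0)" "\<lambda>u. fu 1 (u, 0)" "fu 1 (0, 0)" "p \<alpha>" \<alpha>] p[of \<alpha>] box[of _ 0] eta_pos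
    has_derivative_slice1[of 1 _ 0] f_zero[of 1] by auto

lemma h_pos: "\<bar>\<alpha>\<bar> < \<delta> \<Longrightarrow> h \<alpha> > 0 \<longleftrightarrow> - \<alpha> / fv 3 (0, 0) > 0"
  using slice_sign[of "\<lambda>u. f 3 (0, u)" "\<lambda>u. fv 3 (0, u)" "fv 3 (0, 0)" "h \<alpha>" \<alpha>] h[of \<alpha>] box[of 0] eta_pos
    has_derivative_slice2[of 3 0] f_zero[of 3] by auto

end

section \<open>Periodic orbits over steady states\<close>

lemma vector_4 [simp]:
  "(vector [a, b, c, d] :: 'a::zero^4) $ 1 = a" "(vector [a, b, c, d] :: 'a::zero^4) $ 2 = b"
  "(vector [a, b, c, d] :: 'a::zero^4) $ 3 = c" "(vector [a, b, c, d] :: 'a::zero^4) $ 4 = d"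
  unfolding vector_def by simp_all

lemma has_vector_derivative_vec_iff:
  fixes x :: "real \<Rightarrow> 'a::real_normed_vector^'n"
  shows "(x has_vector_derivative D) (at t) \<longleftrightarrow> (\<forall>i. ((\<lambda>s. x s $ i) has_vector_derivative D $ i) (at t))"
proof
  assume "(x has_vector_derivative D) (at t)"
  then show "\<forall>i. ((\<lambda>s. x s $ i) has_vector_derivative D $ i) (at t)"
    using bounded_linear.has_vector_derivative[OF bounded_linear_vec_nth] by blast
next
  assume *: "\<forall>i. ((\<lambda>s. x s $ i) has_vector_derivative D $ i) (at t)"
  show "(x has_vector_derivative D) (at t)"
    unfolding has_vector_derivative_def has_derivative_at
  proof (intro conjI)
    show "bounded_linear (\<lambda>s. s *\<^sub>R D)" by (rule bounded_linear_scaleR_left)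
    have "((\<lambda>h. norm (x (t + h) - x t - h *\<^sub>R D) / norm h) \<longlongrightarrow> 0) (at 0) \<longleftrightarrow>
      ((\<lambda>h. (x (t + h) - x t - h *\<^sub>R D) /\<^sub>R norm h) \<longlongrightarrow> 0) (at 0)"
      by (subst tendsto_norm_zero_iff[symmetric]) (simp add: divide_inverse mult.commute)
    also have "\<dots>"
    proof (rule vec_tendstoI)
      fix i
      have "((\<lambda>h. norm (x (t + h) $ i - x t $ i - h *\<^sub>R D $ i) / norm h) \<longlongrightarrow> 0) (at 0)"
        using *[rule_format, of i] by (simp add: has_vector_derivative_def has_derivative_at)
      then have "((\<lambda>h. (x (t + h) $ i - x t $ i - h *\<^sub>R D $ i) /\<^sub>R norm h) \<longlongrightarrow> 0) (at 0)"
        by (subst tendsto_norm_zero_iff[symmetric]) (simp add: divide_inverse mult.commute)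
      then show "((\<lambda>h. ((x (t + h) - x t - h *\<^sub>R D) /\<^sub>R norm h) $ i) \<longlongrightarrow> 0 $ i) (at 0)" by simp
    qed
    finally show "(\<lambda>h. norm (x (t + h) - x t - h *\<^sub>R D) / norm h) \<midarrow>0\<rightarrow> 0" .
  qed
qed

lemma nf_field_nth:
  fixes x :: "real^4"
  shows "nf_field f (\<alpha>1, \<alpha>2, \<alpha>3) x $ 1 = x$2"
  "nf_field f (\<alpha>1, \<alpha>2, \<alpha>3) x $ 2 = (\<alpha>1 + f 1 ((x$1)\<^sup>2, (x$3)\<^sup>2 + (x$4)\<^sup>2)) * x$1 + (\<alpha>2 + f 2 ((x$1)\<^sup>2, (x$3)\<^sup>2 + (x$4)\<^sup>2)) * x$2"
  "nf_field f (\<alpha>1, \<alpha>2, \<alpha>3) x $ 3 = (\<alpha>3 + f 3 ((x$1)\<^sup>2, (x$3)\<^sup>2 + (x$4)\<^sup>2)) * x$3 - (1 + f 4 ((x$1)\<^sup>2, (x$3)\<^sup>2 + (x$4)\<^sup>2)) * x$4"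
  "nf_field f (\<alpha>1, \<alpha>2, \<alpha>3) x $ 4 = (1 + f 4 ((x$1)\<^sup>2, (x$3)\<^sup>2 + (x$4)\<^sup>2)) * x$3 + (\<alpha>3 + f 3 ((x$1)\<^sup>2, (x$3)\<^sup>2 + (x$4)\<^sup>2)) * x$4"
  by (simp_all add: nf_field_def Let_def)

definition rad2 :: "real^4 \<Rightarrow> real" where
  "rad2 x = (x$3)\<^sup>2 + (x$4)\<^sup>2"

text \<open>Neighbourhoods described by y1, y2 and r^2 alone, so that a solution lies in one as soon
  as its reduced motion is close to the centre. For \<open>v0 = 0\<close> they are neighbourhoods of
  the equilibrium \<open>eq_pt x0\<close>.\<close>

definition tube :: "real \<Rightarrow> real \<Rightarrow> real \<Rightarrow> (real^4) set" where
  "tube \<rho> x0 v0 = {x. \<bar>x$1 - x0\<bar> < \<rho> \<and> \<bar>x$2\<bar> < \<rho> \<and> \<bar>rad2 x - v0\<bar> < \<rho>}"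

lemma solution_nf_field:
  fixes x :: "real \<Rightarrow> real^4"
  shows "solution (nf_field f (\<alpha>1, \<alpha>2, \<alpha>3)) x \<longleftrightarrow> (\<forall>t.
    ((\<lambda>t. x t $ 1) has_real_derivative x t $ 2) (at t) \<and>
    ((\<lambda>t. x t $ 2) has_real_derivative
      (\<alpha>1 + f 1 ((x t $ 1)\<^sup>2, rad2 (x t))) * x t $ 1 + (\<alpha>2 + f 2 ((x t $ 1)\<^sup>2, rad2 (x t))) * x t $ 2) (at t) \<and>
    ((\<lambda>t. x t $ 3) has_real_derivative
      (\<alpha>3 + f 3 ((x t $ 1)\<^sup>2, rad2 (x t))) * x t $ 3 - (1 + f 4 ((x t $ 1)\<^sup>2, rad2 (x t))) * x t $ 4) (at t) \<and>
    ((\<lambda>t. x t $ 4) has_real_derivative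
      (1 + f 4 ((x t $ 1)\<^sup>2, rad2 (x t))) * x t $ 3 + (\<alpha>3 + f 3 ((x t $ 1)\<^sup>2, rad2 (x t))) * x t $ 4) (at t))"
  unfolding solution_def
  by (subst has_vector_derivative_vec_iff)
    (simp only: forall_4 nf_field_nth rad2_def has_real_derivative_iff_has_vector_derivative)

lemma polar_angle:
  fixes a b r :: real
  assumes "a\<^sup>2 + b\<^sup>2 = r\<^sup>2"
  obtains \<theta> where "a = r * cos \<theta>" "b = r * sin \<theta>"
proof (cases "r = 0")
  case True
  then have "a = 0" "b = 0" using assms by (auto simp: add_nonneg_eq_0_iff)
  then show ?thesis using that[of 0] True by simp
next
  case False
  then have "(a / r)\<^sup>2 + (b / r)\<^sup>2 = 1" using assms by (simp add: power_divide flip: add_divide_distrib)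
  then obtain \<theta> where "a / r = cos \<theta>" "b / r = sin \<theta>" using sincos_total_2pi by metis
  then show ?thesis using that[of \<theta>] False by (simp add: field_simps)
qed

lemma rotating_nth [simp]:
  "rotating y1 r \<omega> t $ 1 = y1" "rotating y1 r \<omega> t $ 2 = 0"
  "rotating y1 r \<omega> t $ 3 = r * cos (\<omega> * t)" "rotating y1 r \<omega> t $ 4 = r * sin (\<omega> * t)"
  by (simp_all add: rotating_def)

lemma rad2_rotating [simp]: "rad2 (rotating y1 r \<omega> t) = r\<^sup>2"
proof -
  have "(r * cos a)\<^sup>2 + (r * sin a)\<^sup>2 = r\<^sup>2" for a
    by (simp add: power_mult_distrib flip: distrib_left)
  then show ?thesis by (simp add: rad2_def)
qed

lemma solution_rotating:
  fixes f :: "nat \<Rightarrow> real \<times> real \<Rightarrow> real"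
  assumes "(\<alpha>1 + f 1 (y1\<^sup>2, r\<^sup>2)) * y1 = 0" "\<alpha>3 + f 3 (y1\<^sup>2, r\<^sup>2) = 0" "\<omega> = 1 + f 4 (y1\<^sup>2, r\<^sup>2)"
  shows "solution (nf_field f (\<alpha>1, \<alpha>2, \<alpha>3)) (rotating y1 r \<omega>)"
  unfolding solution_nf_field using assms(1,2) assms(3)[symmetric]
  by (auto intro!: derivative_eq_intros)

lemma range_rotating:
  assumes "\<omega> \<noteq> 0"
  shows "range (rotating y1 r \<omega>) = circ y1 (r\<^sup>2)"
proof (intro equalityI subsetI)
  fix x assume "x \<in> range (rotating y1 r \<omega>)"
  then obtain t where x: "x = rotating y1 r \<omega> t" by blast
  show "x \<in> circ y1 (r\<^sup>2)" using rad2_rotating[of y1 r \<omega> t] by (simp add: circ_def x rad2_def)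
next
  fix x assume x: "x \<in> circ y1 (r\<^sup>2)"
  then obtain \<theta> where "x$3 = r * cos \<theta>" "x$4 = r * sin \<theta>"
    using polar_angle[of "x$3" "x$4" r] by (auto simp: circ_def)
  then have "x = rotating y1 r \<omega> (\<theta> / \<omega>)"
    using x assms by (simp add: vec_eq_iff forall_4 circ_def)
  then show "x \<in> range (rotating y1 r \<omega>)" by blast
qed

lemma periodic_orbit_circ:
  fixes f :: "nat \<Rightarrow> real \<times> real \<Rightarrow> real"
  assumes "(\<alpha>1 + f 1 (y1\<^sup>2, v)) * y1 = 0" "\<alpha>3 + f 3 (y1\<^sup>2, v) = 0" "f 4 (y1\<^sup>2, v) > -1" "v > 0"
  shows "periodic_orbit (nf_field f (\<alpha>1, \<alpha>2, \<alpha>3)) (circ y1 v)"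
proof -
  define \<omega> r where "\<omega> = 1 + f 4 (y1\<^sup>2, v)" and "r = sqrt v"
  have r: "r\<^sup>2 = v" "r > 0" and \<omega>: "\<omega> > 0" using assms by (simp_all add: r_def \<omega>_def)
  have sol: "solution (nf_field f (\<alpha>1, \<alpha>2, \<alpha>3)) (rotating y1 r \<omega>)"
    by (rule solution_rotating) (use assms r \<omega>_def in auto)
  have "rotating y1 r \<omega> (t + 2 * pi / \<omega>) = rotating y1 r \<omega> t" for t
  proof -
    have "\<omega> * (t + 2 * pi / \<omega>) = \<omega> * t + 2 * pi" using \<omega> by (simp add: field_simps)
    then show ?thesis by (simp add: rotating_def)
  qed
  moreover have "rotating y1 r \<omega> (pi / \<omega>) \<noteq> rotating y1 r \<omega> 0"
  proof
    assume "rotating y1 r \<omega> (pi / \<omega>) = rotating y1 r \<omega> 0"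
    then have "rotating y1 r \<omega> (pi / \<omega>) $ 3 = rotating y1 r \<omega> 0 $ 3" by simp
    then show False using r \<omega> by simp
  qed
  moreover have "circ y1 v = range (rotating y1 r \<omega>)" using range_rotating[of \<omega> y1 r] r \<omega> by simp
  ultimately show ?thesis
    unfolding periodic_orbit_def using sol \<omega>
    by (intro exI[of _ "rotating y1 r \<omega>"] exI[of _ "2 * pi / \<omega>"]) auto
qed

lemma circ_nonempty: "v \<ge> 0 \<Longrightarrow> \<exists>z. z \<in> circ y1 v"
  by (rule exI[of _ "vector [y1, 0, sqrt v, 0]"]) (simp add: circ_def)

lemma circ_subset_tube: "v \<ge> 0 \<Longrightarrow> \<rho> > 0 \<Longrightarrow> circ x v \<subseteq> tube \<rho> x0 v0 \<longleftrightarrow> \<bar>x - x0\<bar> < \<rho> \<and> \<bar>v - v0\<bar> < \<rho>"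
  using circ_nonempty[of v x] by (auto simp: circ_def tube_def rad2_def)

lemma circ_eq_iff: "v \<ge> 0 \<Longrightarrow> circ x v = circ x' v' \<longleftrightarrow> x = x' \<and> v = v'"
  using circ_nonempty[of v x] by (auto simp: circ_def)

section \<open>The (y1, y2, r^2) system and the periodic orbits over its steady states\<close>

context mode_interaction
begin

text \<open>The entries of the Jacobian matrix of the field \<open>velocity\<close> at (x, y, v), in
  the order in which \<open>vel_lin\<close> takes them.\<close>

definition coef :: "real \<times> real \<times> real \<Rightarrow> real \<times> real \<times> real \<Rightarrow> real \<times> real \<times> real \<times> real \<times> real" where
  "coef = (\<lambda>(\<alpha>1, \<alpha>2, \<alpha>3) (x, y, v). let z = (x\<^sup>2, v) in
    (\<alpha>1 + f 1 z + 2 * x * (x * fu 1 z + y * fu 2 z), \<alpha>2 + f 2 z, x * fv 1 z + y * fv 2 z,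
     4 * x * v * fu 3 z, 2 * (\<alpha>3 + f 3 z) + 2 * v * fv 3 z))"

definition velocity :: "real \<times> real \<times> real \<Rightarrow> real \<times> real \<times> real \<Rightarrow> real \<times> real \<times> real" where
  "velocity = (\<lambda>(\<alpha>1, \<alpha>2, \<alpha>3) (x, y, v).
    (y, (\<alpha>1 + f 1 (x\<^sup>2, v)) * x + (\<alpha>2 + f 2 (x\<^sup>2, v)) * y, 2 * (\<alpha>3 + f 3 (x\<^sup>2, v)) * v))"

definition reduced :: "real^4 \<Rightarrow> real \<times> real \<times> real" where
  "reduced x = (x$1, x$2, rad2 x)"

lemma cont_f: "j \<in> {1..4} \<Longrightarrow> continuous_on S (f j)"
  using der by (intro continuous_at_imp_continuous_on) (auto intro: has_derivative_continuous)

lemma continuous_coef: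
  "continuous_on {(\<alpha>, (x, y, v)). (x\<^sup>2, v) \<in> S} (\<lambda>(\<alpha>, X). coef \<alpha> X)"
proof -
  let ?T = "{p. ((fst (snd p))\<^sup>2, snd (snd (snd p))) \<in> S} :: ((real \<times> real \<times> real) \<times> (real \<times> real \<times> real)) set"
  have c: "continuous_on ?T (\<lambda>w. k ((fst (snd w))\<^sup>2, snd (snd (snd w))))" if "continuous_on S k" for k :: "real \<times> real \<Rightarrow> real"
    by (rule continuous_on_compose2[OF that]) (auto intro!: continuous_intros)
  have j: "1 \<in> {1..4::nat}" "2 \<in> {1..4::nat}" "3 \<in> {1..4::nat}" by auto
  show ?thesis
    unfolding coef_def case_prod_unfold Let_def
    by (intro continuous_intros c cont_f cont_fu cont_fv j)
qed

text \<open>Differentiating X' = velocity X along the solution gives the linear equation for W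
  exactly, for functions \<open>f j\<close> that are merely C^1. The phase speed cancels from the
  derivative of \<open>rad2\<close>, which is why the reduced motion satisfies a closed
  system.\<close>

lemma reduced_derivatives:
  fixes x :: "real \<Rightarrow> real^4"
  assumes sol: "solution (nf_field f (\<alpha>1, \<alpha>2, \<alpha>3)) x" and S: "\<And>t. ((x t $ 1)\<^sup>2, rad2 (x t)) \<in> S"
  defines "X \<equiv> (\<lambda>t. reduced (x t))" and "W \<equiv> (\<lambda>t. velocity (\<alpha>1, \<alpha>2, \<alpha>3) (reduced (x t)))"
    and "C \<equiv> (\<lambda>t. coef (\<alpha>1, \<alpha>2, \<alpha>3) (reduced (x t)))"
  shows "(X has_vector_derivative W t) (at t)" "(W has_vector_derivative vel_lin (C t) (W t)) (at t)"
    "continuous_on UNIV C"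
proof -
  define v where "v t = rad2 (x t)" for t
  define z where "z t = ((x t $ 1)\<^sup>2, v t)" for t
  have zS: "z t \<in> S" for t using S by (simp add: z_def v_def)
  have d1: "((\<lambda>t. x t $ 1) has_real_derivative x t $ 2) (at t)" for t
    using sol by (simp add: solution_nf_field)
  have d2: "((\<lambda>t. x t $ 2) has_real_derivative (\<alpha>1 + f 1 (z t)) * x t $ 1 + (\<alpha>2 + f 2 (z t)) * x t $ 2) (at t)" for t
    using sol by (simp add: solution_nf_field z_def v_def)
  have d3: "((\<lambda>t. x t $ 3) has_real_derivative (\<alpha>3 + f 3 (z t)) * x t $ 3 - (1 + f 4 (z t)) * x t $ 4) (at t)" for t
    using sol by (simp add: solution_nf_field z_def v_def)
  have d4: "((\<lambda>t. x t $ 4) has_real_derivative (1 + f 4 (z t)) * x t $ 3 + (\<alpha>3 + f 3 (z t)) * x t $ 4) (at t)" for t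
    using sol by (simp add: solution_nf_field z_def v_def)
  have dv: "(v has_real_derivative 2 * (\<alpha>3 + f 3 (z t)) * v t) (at t)" for t
    unfolding v_def[abs_def] rad2_def
    by (rule derivative_eq_intros d3 d4 refl)+ (simp add: algebra_simps power2_eq_square)
  have df: "((\<lambda>t. f j (z t)) has_real_derivative
      fu j (z t) * (2 * x t $ 1 * x t $ 2) + fv j (z t) * (2 * (\<alpha>3 + f 3 (z t)) * v t)) (at t)" if "j \<in> {1..4}" for j t
  proof -
    have "((\<lambda>t. (x t $ 1)\<^sup>2) has_real_derivative 2 * x t $ 1 * x t $ 2) (at t)"
      by (rule derivative_eq_intros d1 refl)+ simp
    then have "(z has_derivative (\<lambda>s. ((2 * x t $ 1 * x t $ 2) * s, (2 * (\<alpha>3 + f 3 (z t)) * v t) * s))) (at t)"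
      unfolding z_def[abs_def] has_field_derivative_def
      using has_derivative_Pair dv[of t, unfolded has_field_derivative_def] by (simp add: z_def)
    from has_derivative_compose[OF this der[OF that zS]]
    show ?thesis
      unfolding has_field_derivative_def
      by (rule has_derivative_eq_rhs) (simp add: fun_eq_iff algebra_simps)
  qed
  have X: "X = (\<lambda>t. (x t $ 1, x t $ 2, v t))" by (simp add: X_def reduced_def v_def)
  have W: "W = (\<lambda>t. (x t $ 2, (\<alpha>1 + f 1 (z t)) * x t $ 1 + (\<alpha>2 + f 2 (z t)) * x t $ 2, 2 * (\<alpha>3 + f 3 (z t)) * v t))"
    by (simp add: W_def velocity_def reduced_def v_def z_def)
  show XW: "(X has_vector_derivative W t) (at t)" for t
    unfolding X W using d1 d2 dv
    by (intro has_vector_derivative_Pair) (simp_all add: has_real_derivative_iff_has_vector_derivative)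
  have j: "1 \<in> {1..4::nat}" "2 \<in> {1..4::nat}" "3 \<in> {1..4::nat}" by auto
  have dy': "((\<lambda>t. (\<alpha>1 + f 1 (z t)) * x t $ 1 + (\<alpha>2 + f 2 (z t)) * x t $ 2) has_real_derivative
     fst (snd (vel_lin (C t) (W t)))) (at t)"
    by (rule derivative_eq_intros d1 d2 df[OF j(1)] df[OF j(2)] refl)+
      (simp add: C_def coef_def W reduced_def v_def z_def Let_def algebra_simps)
  have dv': "((\<lambda>t. 2 * (\<alpha>3 + f 3 (z t)) * v t) has_real_derivative snd (snd (vel_lin (C t) (W t)))) (at t)"
    by (rule derivative_eq_intros dv df[OF j(3)] refl)+
      (simp add: C_def coef_def W reduced_def v_def z_def Let_def algebra_simps)
  have "vel_lin (C t) (W t) = (fst (snd (W t)), fst (snd (vel_lin (C t) (W t))), snd (snd (vel_lin (C t) (W t))))"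
    by (cases "C t"; cases "W t") simp
  also have "fst (snd (W t)) = (\<alpha>1 + f 1 (z t)) * x t $ 1 + (\<alpha>2 + f 2 (z t)) * x t $ 2" by (simp add: W)
  finally have lin: "vel_lin (C t) (W t) = ((\<alpha>1 + f 1 (z t)) * x t $ 1 + (\<alpha>2 + f 2 (z t)) * x t $ 2,
      fst (snd (vel_lin (C t) (W t))), snd (snd (vel_lin (C t) (W t))))" .
  show "(W has_vector_derivative vel_lin (C t) (W t)) (at t)"
    by (subst lin, subst W, intro has_vector_derivative_Pair)
      (use d2 dy' dv' in \<open>simp_all add: has_real_derivative_iff_has_vector_derivative\<close>)
  have cX: "continuous_on UNIV X"
    using XW by (intro continuous_at_imp_continuous_on) (auto intro: has_vector_derivative_continuous)
  have "continuous_on UNIV (\<lambda>t. (\<lambda>(\<alpha>, X). coef \<alpha> X) ((\<alpha>1, \<alpha>2, \<alpha>3), X t))"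
  proof (rule continuous_on_compose2[OF continuous_coef])
    show "continuous_on UNIV (\<lambda>t. ((\<alpha>1, \<alpha>2, \<alpha>3), X t))" by (intro continuous_intros cX)
  qed (use zS in \<open>auto simp: X z_def\<close>)
  then show "continuous_on UNIV C" by (simp add: C_def X_def)
qed

text \<open>By uniqueness for its linear equation, a velocity that vanishes at one time vanishes at
  all times, and then the reduced motion stands still.\<close>

lemma reduced_constant:
  fixes x :: "real \<Rightarrow> real^4"
  assumes sol: "solution (nf_field f (\<alpha>1, \<alpha>2, \<alpha>3)) x" and S: "\<And>t. ((x t $ 1)\<^sup>2, rad2 (x t)) \<in> S"
    and z: "velocity (\<alpha>1, \<alpha>2, \<alpha>3) (reduced (x a)) = 0"
  shows "reduced (x t) = reduced (x 0)" "velocity (\<alpha>1, \<alpha>2, \<alpha>3) (reduced (x t)) = 0"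
proof -
  note d = reduced_derivatives[OF sol S]
  show 0: "velocity (\<alpha>1, \<alpha>2, \<alpha>3) (reduced (x t)) = 0" for t
    by (rule linear_ode_zero[OF d(2,3) z])
  have "((\<lambda>t. reduced (x t)) has_derivative (\<lambda>h. 0)) (at t within UNIV)" for t
    using d(1)[of t] by (simp add: 0 has_vector_derivative_def)
  then show "reduced (x t) = reduced (x 0)"
    using has_derivative_zero_constant[of UNIV "\<lambda>t. reduced (x t)"] by auto
qed

text \<open>Only the phase is left to move, at the constant speed \<open>1 + f 4\<close>. A
  nonconstant motion requires v > 0, and this allows v to be cancelled from the third component of
  the velocity.\<close>

lemma orbit_of_constant_reduced:
  fixes x :: "real \<Rightarrow> real^4"
  assumes sol: "solution (nf_field f (\<alpha>1, \<alpha>2, \<alpha>3)) x"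
    and const: "\<And>t. reduced (x t) = (c, y, v)" and vel: "velocity (\<alpha>1, \<alpha>2, \<alpha>3) (c, y, v) = 0"
    and nc: "\<exists>t. x t \<noteq> x 0" and w: "f 4 (c\<^sup>2, v) > -1"
  shows "range x = circ c v" "v > 0" "(\<alpha>1 + f 1 (c\<^sup>2, v)) * c = 0" "\<alpha>3 + f 3 (c\<^sup>2, v) = 0"
proof -
  have [simp]: "x t $ 1 = c" "x t $ 2 = 0" "rad2 (x t) = v" and "y = 0" for t
    using const[of t] vel by (auto simp: reduced_def velocity_def zero_prod_def)
  show v: "v > 0"
  proof (rule ccontr)
    assume "\<not> v > 0"
    then have "x t $ 3 = 0 \<and> x t $ 4 = 0" for t
      using \<open>rad2 (x t) = v\<close> sum_power2_le_zero_iff[of "x t $ 3" "x t $ 4"] by (auto simp: rad2_def)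
    then have "x t = x 0" for t by (simp add: vec_eq_iff forall_4)
    then show False using nc by blast
  qed
  with vel \<open>y = 0\<close> show "(\<alpha>1 + f 1 (c\<^sup>2, v)) * c = 0" and k: "\<alpha>3 + f 3 (c\<^sup>2, v) = 0"
    by (auto simp: velocity_def zero_prod_def)
  define \<omega> r where "\<omega> = 1 + f 4 (c\<^sup>2, v)" and "r = sqrt v"
  have r: "r\<^sup>2 = v" "r > 0" and \<omega>: "\<omega> > 0" using v w by (simp_all add: r_def \<omega>_def)
  have d3: "((\<lambda>t. x t $ 3) has_real_derivative - (\<omega> * x t $ 4)) (at t)"
    and d4: "((\<lambda>t. x t $ 4) has_real_derivative \<omega> * x t $ 3) (at t)" for t
    using sol k by (auto simp: solution_nf_field \<omega>_def)
  \<comment> \<open>This expression and the next one are the coordinates of z in the frame rotating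
    at speed \<open>\<omega>\<close>; both are constant in time.\<close>
  have "((\<lambda>t. x t $ 3 * cos (\<omega> * t) + x t $ 4 * sin (\<omega> * t)) has_real_derivative 0) (at t)" for t
    by (rule derivative_eq_intros d3 d4 refl)+ (simp add: algebra_simps)
  then have u: "x t $ 3 * cos (\<omega> * t) + x t $ 4 * sin (\<omega> * t) = x 0 $ 3" for t
    using DERIV_isconst_all[of "\<lambda>t. x t $ 3 * cos (\<omega> * t) + x t $ 4 * sin (\<omega> * t)" t 0] by simp
  have "((\<lambda>t. x t $ 4 * cos (\<omega> * t) - x t $ 3 * sin (\<omega> * t)) has_real_derivative 0) (at t)" for t
    by (rule derivative_eq_intros d3 d4 refl)+ (simp add: algebra_simps)
  then have w: "x t $ 4 * cos (\<omega> * t) - x t $ 3 * sin (\<omega> * t) = x 0 $ 4" for t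
    using DERIV_isconst_all[of "\<lambda>t. x t $ 4 * cos (\<omega> * t) - x t $ 3 * sin (\<omega> * t)" t 0] by simp
  have "(x 0 $ 3)\<^sup>2 + (x 0 $ 4)\<^sup>2 = r\<^sup>2" using \<open>rad2 (x 0) = v\<close> r by (simp add: rad2_def)
  then obtain \<theta> where \<theta>: "x 0 $ 3 = r * cos \<theta>" "x 0 $ 4 = r * sin \<theta>" using polar_angle by blast
  have cs: "(cos a)\<^sup>2 + (sin a)\<^sup>2 = 1" for a :: real by simp
  have x34: "x t $ 3 = r * cos (\<omega> * t + \<theta>) \<and> x t $ 4 = r * sin (\<omega> * t + \<theta>)" for t
    using u[of t] w[of t] cs[of "\<omega> * t"] unfolding \<theta> cos_add sin_add by algebra
  have "x t = rotating c r \<omega> (t + \<theta> / \<omega>)" for t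
    using x34[of t] \<omega> by (simp add: vec_eq_iff forall_4 distrib_left)
  then have "range x = range (\<lambda>t. rotating c r \<omega> (t + \<theta> / \<omega>))" by presburger
  also have "\<dots> = range (rotating c r \<omega>)"
  proof (intro equalityI subsetI)
    fix q assume "q \<in> range (rotating c r \<omega>)"
    then obtain s where "q = rotating c r \<omega> s" by blast
    then have "q = rotating c r \<omega> ((s - \<theta> / \<omega>) + \<theta> / \<omega>)" by simp
    then show "q \<in> range (\<lambda>t. rotating c r \<omega> (t + \<theta> / \<omega>))" by blast
  qed auto
  also have "\<dots> = circ c v" using range_rotating[of \<omega> c r] \<omega> r by simp
  finally show "range x = circ c v" .
qed

end

context mode_interaction
begin

lemma coef_close:
  assumes S: "(x0\<^sup>2, v0) \<in> S" and "f 4 (x0\<^sup>2, v0) > -1" and "\<epsilon> > 0"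
  shows "\<exists>\<rho>>0. \<forall>\<alpha>1 \<alpha>2 \<alpha>3 x y v. \<bar>\<alpha>1 - a1\<bar> < \<rho> \<longrightarrow> \<bar>\<alpha>2 - a2\<bar> < \<rho> \<longrightarrow> \<bar>\<alpha>3 - a3\<bar> < \<rho> \<longrightarrow>
    \<bar>x - x0\<bar> < \<rho> \<longrightarrow> \<bar>y\<bar> < \<rho> \<longrightarrow> \<bar>v - v0\<bar> < \<rho> \<longrightarrow>
    (x\<^sup>2, v) \<in> S \<and> f 4 (x\<^sup>2, v) > -1 \<and>
    dist (coef (\<alpha>1, \<alpha>2, \<alpha>3) (x, y, v)) (coef (a1, a2, a3) (x0, 0, v0)) < \<epsilon>"
proof -
  define T where "T = {p. ((fst (snd p))\<^sup>2, snd (snd (snd p))) \<in> S} \<inter> (UNIV :: ((real \<times> real \<times> real) \<times> (real \<times> real \<times> real)) set)"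
  define c0 where "c0 = coef (a1, a2, a3) (x0, 0, v0)"
  have "open ((\<lambda>p :: (real \<times> real \<times> real) \<times> (real \<times> real \<times> real). ((fst (snd p))\<^sup>2, snd (snd (snd p)))) -` S)"
    by (intro open_vimage open_S continuous_intros)
  then have "open T" by (simp add: T_def vimage_def)
  have cc: "continuous_on T (\<lambda>p. coef (fst p) (snd p))"
    using continuous_coef by (simp add: T_def case_prod_unfold)
  have c4: "continuous_on T (\<lambda>p. f 4 ((fst (snd p))\<^sup>2, snd (snd (snd p))))"
    by (rule continuous_on_compose2[OF cont_f[of 4]]) (auto intro!: continuous_intros simp: T_def)
  have "open (T \<inter> (\<lambda>p. (dist (coef (fst p) (snd p)) c0, f 4 ((fst (snd p))\<^sup>2, snd (snd (snd p))))) -` ({..<\<epsilon>} \<times> {-1<..}))"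
    by (intro continuous_open_preimage continuous_intros cc c4 \<open>open T\<close> open_Times)
  moreover have "((a1, a2, a3), (x0, 0, v0)) \<in> T \<inter> (\<lambda>p. (dist (coef (fst p) (snd p)) c0, f 4 ((fst (snd p))\<^sup>2, snd (snd (snd p))))) -` ({..<\<epsilon>} \<times> {-1<..})"
    using assms by (simp add: T_def c0_def)
  ultimately obtain d where d: "d > 0" "ball ((a1, a2, a3), (x0, 0, v0)) d \<subseteq> T \<inter> (\<lambda>p. (dist (coef (fst p) (snd p)) c0, f 4 ((fst (snd p))\<^sup>2, snd (snd (snd p))))) -` ({..<\<epsilon>} \<times> {-1<..})"
    using open_contains_ball by blast
  \<comment> \<open>With this subadditivity, six real coordinates that are each off by less than
    \<open>d / 6\<close> keep a point within the ball of radius \<open>d\<close>.\<close>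
  have tri: "dist (a, b) (a', b') \<le> dist a a' + dist b b'" for a a' :: "'x::metric_space" and b b' :: "'y::metric_space"
    using sqrt_sum_squares_le_sum[of "dist a a'" "dist b b'"] by (simp add: dist_Pair_Pair)
  have "(x\<^sup>2, v) \<in> S \<and> f 4 (x\<^sup>2, v) > -1 \<and> dist (coef (\<alpha>1, \<alpha>2, \<alpha>3) (x, y, v)) c0 < \<epsilon>"
    if "\<bar>\<alpha>1 - a1\<bar> < d / 6" "\<bar>\<alpha>2 - a2\<bar> < d / 6" "\<bar>\<alpha>3 - a3\<bar> < d / 6" "\<bar>x - x0\<bar> < d / 6" "\<bar>y\<bar> < d / 6" "\<bar>v - v0\<bar> < d / 6"
    for \<alpha>1 \<alpha>2 \<alpha>3 x y v
  proof -
    have "dist ((\<alpha>1, \<alpha>2, \<alpha>3), (x, y, v)) ((a1, a2, a3), (x0, 0, v0)) \<le>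
      (dist \<alpha>1 a1 + (dist \<alpha>2 a2 + dist \<alpha>3 a3)) + (dist x x0 + (dist y 0 + dist v v0))"
      by (intro order_trans[OF tri] add_mono order_refl)
    also have "\<dots> < d" using that by (simp add: dist_real_def)
    finally have "((\<alpha>1, \<alpha>2, \<alpha>3), (x, y, v)) \<in> ball ((a1, a2, a3), (x0, 0, v0)) d" by (simp add: dist_commute)
    from subsetD[OF d(2) this] show ?thesis by (simp add: T_def)
  qed
  then show ?thesis using d(1) unfolding c0_def by (intro exI[of _ "d / 6"]) auto
qed

lemma reduced_in_tube: "x \<in> tube \<rho> x0 v0 \<longleftrightarrow>
  \<bar>fst (reduced x) - x0\<bar> < \<rho> \<and> \<bar>fst (snd (reduced x))\<bar> < \<rho> \<and> \<bar>snd (snd (reduced x)) - v0\<bar> < \<rho>"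
  by (simp add: tube_def reduced_def)

text \<open>The last assumption says that at most one eigenvalue of the \<open>(y1, y2, r\<^sup>2)\<close> system at the
  steady state lies on the imaginary axis, and that it is then zero.\<close>

lemma periodic_orbits_near:
  assumes S: "(x0\<^sup>2, v0) \<in> S" and w: "f 4 (x0\<^sup>2, v0) > -1"
    and b: "a2 + f 2 (x0\<^sup>2, v0) < 0" and xv: "x0 = 0 \<or> v0 = 0"
    and pqs: "a1 + f 1 (x0\<^sup>2, v0) + 2 * x0\<^sup>2 * fu 1 (x0\<^sup>2, v0) \<noteq> 0 \<and> v0 = 0 \<and> a3 + f 3 (x0\<^sup>2, v0) = 0 \<or>
      x0 = 0 \<and> a3 + f 3 (x0\<^sup>2, v0) + v0 * fv 3 (x0\<^sup>2, v0) \<noteq> 0"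
  shows "\<exists>\<rho>0>0. \<forall>\<rho> \<alpha>1 \<alpha>2 \<alpha>3. 0 < \<rho> \<longrightarrow> \<rho> \<le> \<rho>0 \<longrightarrow>
    \<bar>\<alpha>1 - a1\<bar> < \<rho>0 \<longrightarrow> \<bar>\<alpha>2 - a2\<bar> < \<rho>0 \<longrightarrow> \<bar>\<alpha>3 - a3\<bar> < \<rho>0 \<longrightarrow>
    {D. periodic_orbit (nf_field f (\<alpha>1, \<alpha>2, \<alpha>3)) D \<and> D \<subseteq> tube \<rho> x0 v0} =
    {circ x v | x v. v > 0 \<and> \<bar>x - x0\<bar> < \<rho> \<and> \<bar>v - v0\<bar> < \<rho> \<and>
      (\<alpha>1 + f 1 (x\<^sup>2, v)) * x = 0 \<and> \<alpha>3 + f 3 (x\<^sup>2, v) = 0}"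
proof -
  define p q s where "p = a1 + f 1 (x0\<^sup>2, v0) + 2 * x0\<^sup>2 * fu 1 (x0\<^sup>2, v0)" and "q = x0 * fv 1 (x0\<^sup>2, v0)"
    and "s = 2 * (a3 + f 3 (x0\<^sup>2, v0)) + 2 * v0 * fv 3 (x0\<^sup>2, v0)"
  have c0: "coef (a1, a2, a3) (x0, 0, v0) = (p, a2 + f 2 (x0\<^sup>2, v0), q, 0, s)"
  proof -
    \<comment> \<open>The coupling from y1 into r^2 disappears at the centre, because
      \<open>x0\<close> or \<open>v0\<close> is zero.\<close>
    have "4 * x0 * v0 * fu 3 (x0\<^sup>2, v0) = 0" using xv by auto
    moreover have "2 * x0 * (x0 * k) = 2 * x0\<^sup>2 * k" for k by (simp add: power2_eq_square)
    ultimately show ?thesis by (simp add: coef_def Let_def p_def q_def s_def)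
  qed
  \<comment> \<open>In the first alternative of \<open>pqs\<close>, \<open>v0 = 0\<close> and the
    vanishing of \<open>a3 + f 3\<close> give \<open>s = 0\<close>; in the second,
    \<open>x0 = 0\<close> removes \<open>q\<close>.\<close>
  have "p \<noteq> 0 \<and> s = 0 \<or> q = 0 \<and> s \<noteq> 0"
    using pqs by (auto simp: p_def q_def s_def)
  from periodic_velocity_vanishes_3d[OF b this] obtain \<epsilon> where "\<epsilon> > 0" and
    \<epsilon>: "\<forall>c T X W. T > 0 \<longrightarrow> (\<forall>t. X (t + T) = X t) \<longrightarrow>
    (\<forall>t. (X has_vector_derivative W t) (at t)) \<longrightarrow>
    (\<forall>t. (W has_vector_derivative vel_lin (c t) (W t)) (at t)) \<longrightarrow>
    (\<forall>t. dist (c t) (p, a2 + f 2 (x0\<^sup>2, v0), q, 0, s) < \<epsilon>) \<longrightarrow> (\<exists>t. W t = 0)"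
    by (elim exE conjE) (rule that)
  from coef_close[OF S w \<open>\<epsilon> > 0\<close>, of a1 a2 a3] obtain \<rho>0 where "\<rho>0 > 0" and
    \<rho>0': "\<forall>\<alpha>1 \<alpha>2 \<alpha>3 x y v. \<bar>\<alpha>1 - a1\<bar> < \<rho>0 \<longrightarrow> \<bar>\<alpha>2 - a2\<bar> < \<rho>0 \<longrightarrow> \<bar>\<alpha>3 - a3\<bar> < \<rho>0 \<longrightarrow>
    \<bar>x - x0\<bar> < \<rho>0 \<longrightarrow> \<bar>y\<bar> < \<rho>0 \<longrightarrow> \<bar>v - v0\<bar> < \<rho>0 \<longrightarrow>
    (x\<^sup>2, v) \<in> S \<and> f 4 (x\<^sup>2, v) > -1 \<and>
    dist (coef (\<alpha>1, \<alpha>2, \<alpha>3) (x, y, v)) (coef (a1, a2, a3) (x0, 0, v0)) < \<epsilon>"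
    by (elim exE conjE) (rule that)
  note \<rho>0 = \<rho>0'[rule_format]
  have main: "{D. periodic_orbit (nf_field f (\<alpha>1, \<alpha>2, \<alpha>3)) D \<and> D \<subseteq> tube \<rho> x0 v0} =
    {circ x v | x v. v > 0 \<and> \<bar>x - x0\<bar> < \<rho> \<and> \<bar>v - v0\<bar> < \<rho> \<and>
      (\<alpha>1 + f 1 (x\<^sup>2, v)) * x = 0 \<and> \<alpha>3 + f 3 (x\<^sup>2, v) = 0}" (is "?L = ?R")
    if \<rho>: "0 < \<rho>" "\<rho> \<le> \<rho>0" and \<alpha>: "\<bar>\<alpha>1 - a1\<bar> < \<rho>0" "\<bar>\<alpha>2 - a2\<bar> < \<rho>0" "\<bar>\<alpha>3 - a3\<bar> < \<rho>0" for \<rho> \<alpha>1 \<alpha>2 \<alpha>3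
  proof (intro equalityI subsetI)
    fix D assume "D \<in> ?R"
    then obtain x v where D: "D = circ x v" and xv: "v > 0" "\<bar>x - x0\<bar> < \<rho>" "\<bar>v - v0\<bar> < \<rho>"
      "(\<alpha>1 + f 1 (x\<^sup>2, v)) * x = 0" "\<alpha>3 + f 3 (x\<^sup>2, v) = 0" by blast
    have "f 4 (x\<^sup>2, v) > -1" using \<rho>0[OF \<alpha>, of x 0 v] xv \<rho> by auto
    then have "periodic_orbit (nf_field f (\<alpha>1, \<alpha>2, \<alpha>3)) D"
      unfolding D using xv by (intro periodic_orbit_circ)
    then show "D \<in> ?L" using circ_subset_tube[of v \<rho> x x0 v0] xv \<rho> by (auto simp: D)
  next
    fix D assume "D \<in> ?L"
    then obtain x T where sol: "solution (nf_field f (\<alpha>1, \<alpha>2, \<alpha>3)) x" and T: "T > 0" "\<And>t. x (t + T) = x t"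
      and nc: "\<exists>t. x t \<noteq> x 0" and D: "D = range x" and "range x \<subseteq> tube \<rho> x0 v0"
      unfolding periodic_orbit_def by blast
    then have tube: "x t \<in> tube \<rho> x0 v0" for t by blast
    have near: "((x t $ 1)\<^sup>2, rad2 (x t)) \<in> S \<and> f 4 ((x t $ 1)\<^sup>2, rad2 (x t)) > -1 \<and>
      dist (coef (\<alpha>1, \<alpha>2, \<alpha>3) (reduced (x t))) (coef (a1, a2, a3) (x0, 0, v0)) < \<epsilon>" for t
      using \<rho>0[OF \<alpha>, of "x t $ 1" "x t $ 2" "rad2 (x t)"] tube[of t] \<rho> unfolding tube_def reduced_def by simp
    have inS: "((x t $ 1)\<^sup>2, rad2 (x t)) \<in> S" for t using near by blast
    note d = reduced_derivatives[OF sol inS]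
    have per: "reduced (x (t + T)) = reduced (x t)" for t using T(2) by simp
    obtain t1 where "velocity (\<alpha>1, \<alpha>2, \<alpha>3) (reduced (x t1)) = 0"
      using \<epsilon>[rule_format, OF T(1) per d(1) d(2)] near by (auto simp: c0)
    note c = reduced_constant[OF sol inS this]
    obtain cx cy cv where r0: "reduced (x 0) = (cx, cy, cv)" by (cases "reduced (x 0)") auto
    have const: "reduced (x t) = (cx, cy, cv)" for t using c(1)[of t] r0 by simp
    have "velocity (\<alpha>1, \<alpha>2, \<alpha>3) (cx, cy, cv) = 0" using c(2)[of 0] r0 by simp
    moreover have "f 4 (cx\<^sup>2, cv) > -1" using near[of 0] r0 by (auto simp: reduced_def)
    ultimately have "range x = circ cx cv" "cv > 0" "(\<alpha>1 + f 1 (cx\<^sup>2, cv)) * cx = 0" "\<alpha>3 + f 3 (cx\<^sup>2, cv) = 0"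
      using orbit_of_constant_reduced[OF sol const _ nc] by auto
    moreover have "\<bar>cx - x0\<bar> < \<rho>" "\<bar>cv - v0\<bar> < \<rho>" using tube[of 0] r0 by (auto simp: reduced_in_tube)
    ultimately show "D \<in> ?R" unfolding D by blast
  qed
  show ?thesis
    by (rule exI[of _ \<rho>0], intro conjI allI impI, rule \<open>\<rho>0 > 0\<close>, rule main) assumption+
qed

end

lemma open_tube: "open (tube \<rho> x0 v0)"
  unfolding tube_def rad2_def by (intro open_Collect_conj open_Collect_less continuous_intros)

text \<open>On the closed tube of radius one with \<open>V\<close> removed, which is compact, the
  sum \<open>d\<close> of the three deviations is positive and hence at least some
  \<open>e > 0\<close>; a bound of \<open>e / 3\<close> on each deviation avoids that set. So
  convergence in y1, y2 and r^2 suffices for convergence of the circles as sets.\<close>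

lemma tube_neighbourhood:
  assumes "open V" "circ x0 v0 \<subseteq> V"
  shows "\<exists>\<rho>>0. tube \<rho> x0 v0 \<subseteq> V"
proof -
  define K where "K = {x :: real^4. \<bar>x$1 - x0\<bar> \<le> 1 \<and> \<bar>x$2\<bar> \<le> 1 \<and> \<bar>rad2 x - v0\<bar> \<le> 1} - V"
  define d where "d x = \<bar>x$1 - x0\<bar> + \<bar>x$2\<bar> + \<bar>rad2 x - v0\<bar>" for x :: "real^4"
  have cd: "continuous_on A d" for A
    unfolding d_def rad2_def by (intro continuous_intros)
  have "closed {x :: real^4. \<bar>x$1 - x0\<bar> \<le> 1 \<and> \<bar>x$2\<bar> \<le> 1 \<and> \<bar>rad2 x - v0\<bar> \<le> 1}"
    unfolding rad2_def by (intro closed_Collect_conj closed_Collect_le continuous_intros)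
  then have "closed K" unfolding K_def using \<open>open V\<close> by (rule closed_Diff)
  moreover have "bounded K"
  proof -
    \<comment> \<open>Bounds the two coordinates of z by \<open>rad2\<close>, so that the unit tube
      is bounded.\<close>
    have sq: "\<bar>a\<bar> \<le> 1 + a\<^sup>2" for a :: real
    proof -
      have "0 \<le> (\<bar>a\<bar> - 1)\<^sup>2" by simp
      then have "2 * \<bar>a\<bar> \<le> a\<^sup>2 + 1" by (simp add: power2_diff)
      then show ?thesis using abs_ge_zero[of a] by linarith
    qed
    have "norm x \<le> 6 + \<bar>x0\<bar> + 2 * \<bar>v0\<bar>" if "x \<in> K" for x
    proof -
      have "norm x \<le> \<bar>x$1\<bar> + \<bar>x$2\<bar> + \<bar>x$3\<bar> + \<bar>x$4\<bar>"
        using norm_le_l1_cart[of x] by (simp add: sum_4)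
      moreover have "\<bar>x$1\<bar> \<le> 1 + \<bar>x0\<bar>" "\<bar>x$2\<bar> \<le> 1" "(x$3)\<^sup>2 + (x$4)\<^sup>2 \<le> 1 + \<bar>v0\<bar>"
        using that by (auto simp: K_def rad2_def)
      moreover have "\<bar>x$3\<bar> + \<bar>x$4\<bar> \<le> 2 + ((x$3)\<^sup>2 + (x$4)\<^sup>2)" using sq[of "x$3"] sq[of "x$4"] by linarith
      ultimately show ?thesis using abs_ge_zero[of v0] by linarith
    qed
    then show ?thesis by (auto simp: bounded_iff)
  qed
  ultimately have "compact K" by (simp add: compact_eq_bounded_closed)
  have dpos: "d x > 0" if "x \<in> K" for x
  proof (rule ccontr)
    assume "\<not> d x > 0"
    then have "x$1 = x0 \<and> x$2 = 0 \<and> rad2 x = v0" unfolding d_def by linarith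
    then have "x \<in> circ x0 v0" by (simp add: circ_def rad2_def)
    then show False using that assms(2) by (auto simp: K_def)
  qed
  obtain e where e: "e > 0" "\<And>x. x \<in> K \<Longrightarrow> e \<le> d x"
  proof (cases "K = {}")
    case True
    then show ?thesis using that[of 1] by simp
  next
    case False
    then obtain y where "y \<in> K" "\<And>x. x \<in> K \<Longrightarrow> d y \<le> d x"
      using continuous_attains_inf[OF \<open>compact K\<close> False cd] by blast
    then show ?thesis using that[of "d y"] dpos by blast
  qed
  have "tube (min 1 (e / 3)) x0 v0 \<subseteq> V"
  proof
    fix x assume x: "x \<in> tube (min 1 (e / 3)) x0 v0"
    show "x \<in> V"
    proof (rule ccontr)
      assume "x \<notin> V"
      with x have "x \<in> K" by (auto simp: K_def tube_def)
      from e(2)[OF this] x show False by (auto simp: d_def tube_def)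
    qed
  qed
  then show ?thesis using e(1) by (intro exI[of _ "min 1 (e / 3)"]) auto
qed

section \<open>Periodic orbits in the z-plane and the isolation of H1\<close>

context mode_branches
begin

text \<open>In the plane y1 = y2 = 0 the equation for \<open>rad2\<close> is scalar, so the maximum
  of \<open>rad2\<close> over a period is already a zero of the velocity. Closeness to a bifurcation
  point does not enter, and the region has the fixed size \<open>\<eta>\<close> for all \<alpha>1
  and \<alpha>2.\<close>

lemma periodic_orbits_plane:
  assumes \<alpha>3: "\<bar>\<alpha>3\<bar> < \<delta>"
  shows "{C. periodic_orbit (nf_field f (\<alpha>1, \<alpha>2, \<alpha>3)) C \<and> C \<subseteq> {x. x$1 = 0 \<and> x$2 = 0 \<and> (x$3)\<^sup>2 + (x$4)\<^sup>2 < \<eta>}} =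
    (if h \<alpha>3 > 0 then {circ 0 (h \<alpha>3)} else {})" (is "?L = ?R")
proof (intro equalityI subsetI)
  fix C assume "C \<in> ?R"
  then have h0: "h \<alpha>3 > 0" "C = circ 0 (h \<alpha>3)" by (auto split: if_splits)
  have "periodic_orbit (nf_field f (\<alpha>1, \<alpha>2, \<alpha>3)) C"
    unfolding h0(2) using h[OF \<alpha>3] box[of 0 "h \<alpha>3"] eta_pos h0(1) by (intro periodic_orbit_circ) auto
  moreover have "C \<subseteq> {x. x$1 = 0 \<and> x$2 = 0 \<and> (x$3)\<^sup>2 + (x$4)\<^sup>2 < \<eta>}"
    using h[OF \<alpha>3] by (auto simp: h0(2) circ_def)
  ultimately show "C \<in> ?L" by blast
next
  fix C assume "C \<in> ?L"
  then obtain x T where sol: "solution (nf_field f (\<alpha>1, \<alpha>2, \<alpha>3)) x" and T: "T > 0" "\<And>t. x (t + T) = x t"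
    and nc: "\<exists>t. x t \<noteq> x 0" and C: "C = range x"
    and sub: "range x \<subseteq> {x. x$1 = 0 \<and> x$2 = 0 \<and> (x$3)\<^sup>2 + (x$4)\<^sup>2 < \<eta>}"
    unfolding periodic_orbit_def by blast
  have x12: "x t $ 1 = 0" "x t $ 2 = 0" and v: "rad2 (x t) \<ge> 0" "rad2 (x t) < \<eta>" for t
    using sub by (auto simp: rad2_def)
  have inS: "((x t $ 1)\<^sup>2, rad2 (x t)) \<in> S" for t using box[of 0 "rad2 (x t)"] x12 v[of t] eta_pos by simp
  note d = reduced_derivatives[OF sol inS]
  have red: "reduced (x t) = (0, 0, rad2 (x t))" for t by (simp add: reduced_def x12)
  have dv: "((\<lambda>t. rad2 (x t)) has_real_derivative 2 * (\<alpha>3 + f 3 (0, rad2 (x t))) * rad2 (x t)) (at t)" for t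
    using bounded_linear.has_vector_derivative[OF bounded_linear_compose[OF bounded_linear_snd bounded_linear_snd] d(1)[of t]]
    by (simp add: red velocity_def has_real_derivative_iff_has_vector_derivative)
  obtain t1 where "2 * (\<alpha>3 + f 3 (0, rad2 (x t1))) * rad2 (x t1) = 0"
    using periodic_max[of T "\<lambda>t. rad2 (x t)", OF T(1) _ dv] T(2) by metis
  then have "velocity (\<alpha>1, \<alpha>2, \<alpha>3) (reduced (x t1)) = 0"
    by (simp add: red velocity_def zero_prod_def)
  note c = reduced_constant[OF sol inS this]
  have const: "reduced (x t) = (0, 0, rad2 (x 0))" for t using c(1)[of t] red by simp
  have "f 4 (0\<^sup>2, rad2 (x 0)) > -1" using box[of 0 "rad2 (x 0)"] v[of 0] eta_pos by simp
  then have "range x = circ 0 (rad2 (x 0))" "rad2 (x 0) > 0" "\<alpha>3 + f 3 (0\<^sup>2, rad2 (x 0)) = 0"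
    using orbit_of_constant_reduced[OF sol const _ nc] c(2)[of 0] red by auto
  moreover from this have "rad2 (x 0) = h \<alpha>3" using h_unique[OF \<alpha>3, of "rad2 (x 0)"] v[of 0] by auto
  ultimately show "C \<in> ?R" using C by auto
qed

text \<open>At the cycle the linear rate of r^2 is
  \<open>2 * h \<alpha>3 * fv 3 (0, h \<alpha>3)\<close>, which is nonzero, so
  \<open>periodic_orbits_near\<close> applies whatever the value of \<open>\<alpha>1 + f 1\<close>,
  even at the secondary bifurcation. It remains to keep the mixed-mode circles out of the isolating
  tube.\<close>

lemma limit_cycle_h:
  assumes \<alpha>1: "\<bar>\<alpha>1\<bar> < \<delta>" and \<alpha>3: "\<bar>\<alpha>3\<bar> < \<delta>" and b: "\<alpha>2 + f 2 (0, h \<alpha>3) < 0" and pos: "h \<alpha>3 > 0"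
  shows "limit_cycle (nf_field f (\<alpha>1, \<alpha>2, \<alpha>3)) (circ 0 (h \<alpha>3))"
proof -
  note h3 = h[OF \<alpha>3]
  have bx: "(0, h \<alpha>3) \<in> S" "f 4 (0, h \<alpha>3) > -1" "fv 3 (0, h \<alpha>3) \<noteq> 0"
    using box[of 0 "h \<alpha>3"] h3 eta_pos by auto
  obtain \<rho>0 where "\<rho>0 > 0" and \<rho>0: "\<And>\<rho>. 0 < \<rho> \<Longrightarrow> \<rho> \<le> \<rho>0 \<Longrightarrow>
    {D. periodic_orbit (nf_field f (\<alpha>1, \<alpha>2, \<alpha>3)) D \<and> D \<subseteq> tube \<rho> 0 (h \<alpha>3)} =
    {circ x v | x v. v > 0 \<and> \<bar>x - 0\<bar> < \<rho> \<and> \<bar>v - h \<alpha>3\<bar> < \<rho> \<and>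
      (\<alpha>1 + f 1 (x\<^sup>2, v)) * x = 0 \<and> \<alpha>3 + f 3 (x\<^sup>2, v) = 0}"
    using periodic_orbits_near[of 0 "h \<alpha>3" \<alpha>2 \<alpha>1 \<alpha>3] bx b pos h3 by auto
  \<comment> \<open>Mixed-mode circles, if there are any, have x^2 equal to
    \<open>fst (m (\<alpha>1, \<alpha>3))\<close>, and the bound \<open>sqrt \<mu>\<close> keeps
    them outside; otherwise there is nothing to avoid and 1 serves as a default. The bounds with
    \<open>\<eta>\<close> in \<open>\<rho>\<close> keep v and x^2 inside the box.\<close>
  define \<mu> where "\<mu> = (if fst (m (\<alpha>1, \<alpha>3)) > 0 then fst (m (\<alpha>1, \<alpha>3)) else 1)"
  define \<rho> where "\<rho> = Min {\<rho>0, \<eta> - \<bar>h \<alpha>3\<bar>, sqrt \<eta>, sqrt \<mu>}"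
  have \<rho>: "\<rho> > 0" "\<rho> \<le> \<rho>0" "\<rho> \<le> \<eta> - \<bar>h \<alpha>3\<bar>" "\<rho> \<le> sqrt \<eta>" "\<rho> \<le> sqrt \<mu>"
    using \<open>\<rho>0 > 0\<close> h3 eta_pos by (auto simp: \<rho>_def \<mu>_def)
  have "C' = circ 0 (h \<alpha>3)" if "periodic_orbit (nf_field f (\<alpha>1, \<alpha>2, \<alpha>3)) C'" "C' \<subseteq> tube \<rho> 0 (h \<alpha>3)" for C'
  proof -
    have "C' \<in> {D. periodic_orbit (nf_field f (\<alpha>1, \<alpha>2, \<alpha>3)) D \<and> D \<subseteq> tube \<rho> 0 (h \<alpha>3)}" using that by blast
    then obtain x v where C': "C' = circ x v" and xv: "v > 0" "\<bar>x\<bar> < \<rho>" "\<bar>v - h \<alpha>3\<bar> < \<rho>"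
      "(\<alpha>1 + f 1 (x\<^sup>2, v)) * x = 0" "\<alpha>3 + f 3 (x\<^sup>2, v) = 0"
      using \<rho>0[OF \<rho>(1,2)] by auto
    have "\<bar>v\<bar> < \<eta>" using xv \<rho>(3) by linarith
    have sq: "x\<^sup>2 < e" if "\<rho> \<le> sqrt e" "e > 0" for e
      using power_strict_mono[of "\<bar>x\<bar>" "sqrt e" 2] xv(2) that by simp
    have "\<mu> > 0" by (simp add: \<mu>_def)
    then have "x\<^sup>2 < \<eta>" "x\<^sup>2 < \<mu>" using sq \<rho>(4,5) eta_pos by auto
    then have x2: "\<bar>x\<^sup>2\<bar> < \<eta>" by simp
    have "x = 0"
    proof (rule ccontr)
      assume "x \<noteq> 0"
      then have "(x\<^sup>2, v) = m (\<alpha>1, \<alpha>3)" using m_unique[OF \<alpha>1 \<alpha>3 x2 \<open>\<bar>v\<bar> < \<eta>\<close>] xv by auto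
      then have "fst (m (\<alpha>1, \<alpha>3)) = x\<^sup>2" by (metis fst_conv)
      then show False using \<open>x \<noteq> 0\<close> \<open>x\<^sup>2 < \<mu>\<close> by (auto simp: \<mu>_def)
    qed
    then have "v = h \<alpha>3" using h_unique[OF \<alpha>3 \<open>\<bar>v\<bar> < \<eta>\<close>] xv by simp
    then show ?thesis using C' \<open>x = 0\<close> by simp
  qed
  then have unique: "\<forall>C'. periodic_orbit (nf_field f (\<alpha>1, \<alpha>2, \<alpha>3)) C' \<and> C' \<subseteq> tube \<rho> 0 (h \<alpha>3) \<longrightarrow> C' = circ 0 (h \<alpha>3)"
    by blast
  have sub: "circ 0 (h \<alpha>3) \<subseteq> tube \<rho> 0 (h \<alpha>3)"
    using circ_subset_tube[of "h \<alpha>3" \<rho> 0 0 "h \<alpha>3"] pos \<rho>(1) by simp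
  have "periodic_orbit (nf_field f (\<alpha>1, \<alpha>2, \<alpha>3)) (circ 0 (h \<alpha>3))"
    using h3 bx pos by (intro periodic_orbit_circ) auto
  then show ?thesis
    unfolding limit_cycle_def by (rule conjI) (rule exI conjI open_tube sub unique)+
qed

end

section \<open>Linearization and Floquet multipliers\<close>

text \<open>Polymorphic in the entries, because it appears both with real entries, for Jacobians and
  monodromy matrices, and with polynomial entries inside \<open>charpoly\<close>.\<close>

definition block4 :: "'a::zero \<Rightarrow> 'a \<Rightarrow> 'a \<Rightarrow> 'a \<Rightarrow> 'a \<Rightarrow> 'a \<Rightarrow> 'a \<Rightarrow> 'a \<Rightarrow> 'a^4^4" where
  "block4 a b c d a' b' c' d' = vector [vector [a, b, 0, 0], vector [c, d, 0, 0],
     vector [0, 0, a', b'], vector [0, 0, c', d']]"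

lemma block4_nth [simp]:
  "block4 a b c d a' b' c' d' $ 1 = vector [a, b, 0, 0]" "block4 a b c d a' b' c' d' $ 2 = vector [c, d, 0, 0]"
  "block4 a b c d a' b' c' d' $ 3 = vector [0, 0, a', b']" "block4 a b c d a' b' c' d' $ 4 = vector [0, 0, c', d']"
  by (simp_all add: block4_def)

lemma det_block4:
  "det (block4 a b c d a' b' c' d' :: 'a::comm_ring_1^4^4) = (a * d - b * c) * (a' * d' - b' * c')"
proof -
  have 1: "finite {2::4, 3, 4}" "1 \<notin> {2::4, 3, 4}" by auto
  have 2: "finite {3::4, 4}" "2 \<notin> {3::4, 4}" by auto
  have 3: "finite {4::4}" "3 \<notin> {4::4}" by auto
  show ?thesis
    unfolding det_def UNIV_4
    unfolding sum_over_permutations_insert[OF 1] sum_over_permutations_insert[OF 2] sum_over_permutations_insert[OF 3]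
    unfolding permutes_sing
    by (simp add: sign_swap_id permutation_swap_id permutation_compose sign_compose sign_id swap_id_eq algebra_simps)
qed

lemma block4_mult:
  "block4 a b c d a' b' c' d' ** block4 e f g h e' f' g' h' =
    block4 (a * e + b * g) (a * f + b * h) (c * e + d * g) (c * f + d * h)
      (a' * e' + b' * g') (a' * f' + b' * h') (c' * e' + d' * g') (c' * f' + d' * (h' :: real))"
  by (simp add: vec_eq_iff forall_4 matrix_matrix_mult_def sum_4)

lemma has_vector_derivative_block4:
  assumes "(a has_real_derivative a1) (at t)" "(b has_real_derivative b1) (at t)"
    "(c has_real_derivative c1) (at t)" "(d has_real_derivative d1) (at t)"
    "(a' has_real_derivative a1') (at t)" "(b' has_real_derivative b1') (at t)"
    "(c' has_real_derivative c1') (at t)" "(d' has_real_derivative d1') (at t)"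
  shows "((\<lambda>t. block4 (a t) (b t) (c t) (d t) (a' t) (b' t) (c' t) (d' t)) has_vector_derivative
    block4 a1 b1 c1 d1 a1' b1' c1' d1') (at t)"
  using assms unfolding has_vector_derivative_vec_iff
  by (simp add: has_vector_derivative_vec_iff forall_4 has_real_derivative_iff_has_vector_derivative)

text \<open>Each two by two block enters only through its trace and determinant, so any two complex
  numbers with the right sum and product serve as its eigenvalues; real pairs and conjugate pairs
  are treated alike.\<close>

lemma charpoly_block4:
  fixes s1 s2 s3 s4 :: complex
  assumes "complex_of_real (a + d) = s1 + s2" "complex_of_real (a * d - b * c) = s1 * s2"
    and "complex_of_real (a' + d') = s3 + s4" "complex_of_real (a' * d' - b' * c') = s3 * s4"
  shows "charpoly (block4 a b c d a' b' c' d') = ([:- s1, 1:] * [:- s2, 1:]) * ([:- s3, 1:] * [:- s4, 1:])"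
proof -
  let ?c = "\<lambda>x. [:complex_of_real x:]"
  have "(\<chi> i j. (if i = j then [:0, 1:] else 0) - ?c (block4 a b c d a' b' c' d' $ i $ j)) =
    block4 ([:0, 1:] - ?c a) (- ?c b) (- ?c c) ([:0, 1:] - ?c d) ([:0, 1:] - ?c a') (- ?c b') (- ?c c') ([:0, 1:] - ?c d')"
    by (simp add: vec_eq_iff forall_4)
  then have "charpoly (block4 a b c d a' b' c' d') =
    (([:0, 1:] - ?c a) * ([:0, 1:] - ?c d) - (- ?c b) * (- ?c c)) *
    (([:0, 1:] - ?c a') * ([:0, 1:] - ?c d') - (- ?c b') * (- ?c c'))"
    unfolding charpoly_def by (simp only: det_block4)
  moreover have "([:0, 1:] - ?c x) * ([:0, 1:] - ?c y) - (- ?c z) * (- ?c w) = [:- s, 1:] * [:- s', 1:]"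
    if "complex_of_real (x + y) = s + s'" "complex_of_real (x * y - z * w) = s * s'" for x y z w s s'
    using that by (simp add: algebra_simps)
  ultimately show ?thesis using assms by presburger
qed

lemma order_linear_factor: "order z [:- s, 1:] = (if z = (s::complex) then 1 else 0)"
  using order_power_n_n[of s 1] by (auto intro: order_0I)

lemma order_four_factors:
  "order z (([:- s1, 1:] * [:- s2, 1:]) * ([:- s3, 1:] * [:- s4, 1:])) =
    (if z = (s1::complex) then 1 else 0) + (if z = s2 then 1 else 0) + (if z = s3 then 1 else 0) + (if z = s4 then 1 else 0)"
proof -
  have nz: "[:- s1, 1:] * [:- s2, 1:] \<noteq> 0" "[:- s3, 1:] * [:- s4, 1:] \<noteq> 0"
    "([:- s1, 1:] * [:- s2, 1:]) * ([:- s3, 1:] * [:- s4, 1:]) \<noteq> 0"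
    unfolding mult_eq_0_iff by simp_all
  show ?thesis
    unfolding order_mult[OF nz(3)] order_mult[OF nz(1)] order_mult[OF nz(2)] order_linear_factor by simp
qed

lemma eigenvalue_block4:
  assumes "charpoly A = ([:- s1, 1:] * [:- s2, 1:]) * ([:- s3, 1:] * [:- s4, 1:])"
  shows "eigenvalue A z \<longleftrightarrow> z = s1 \<or> z = s2 \<or> z = s3 \<or> z = s4"
  unfolding eigenvalue_def assms poly_mult by auto

lemma quadratic_complex_roots:
  fixes b c :: real
  obtains s1 s2 :: complex where "complex_of_real b = s1 + s2" "complex_of_real (- c) = s1 * s2"
proof -
  define s1 s2 where "s1 = (of_real b + csqrt (of_real (b\<^sup>2 + 4 * c))) / 2"
    and "s2 = (of_real b - csqrt (of_real (b\<^sup>2 + 4 * c))) / 2"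
  have sum: "of_real b = s1 + s2" by (simp add: s1_def s2_def field_simps)
  have "s1 * s2 = ((of_real b)\<^sup>2 - (csqrt (of_real (b\<^sup>2 + 4 * c)))\<^sup>2) / 4"
    by (simp add: s1_def s2_def power2_eq_square algebra_simps)
  then have prod: "of_real (- c) = s1 * s2" by (simp add: power2_csqrt)
  show ?thesis by (rule that[OF sum prod])
qed

text \<open>If one root is i \<tau> with \<tau> real, the other is b - i \<tau>, and their product
  \<tau>^2 + i \<tau> b is real only for \<tau> = 0, as b is nonzero; but then the product is zero,
  contrary to \<open>c \<noteq> 0\<close>.\<close>

lemma quadratic_roots_off_axis:
  fixes b c :: real
  assumes "b \<noteq> 0" "c \<noteq> 0"
  obtains s1 s2 :: complex where "complex_of_real b = s1 + s2" "complex_of_real (- c) = s1 * s2" "Re s1 \<noteq> 0" "Re s2 \<noteq> 0"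
proof -
  obtain s1 s2 where sum: "complex_of_real b = s1 + s2" and prod: "complex_of_real (- c) = s1 * s2"
    by (rule quadratic_complex_roots)
  have off: "Re s \<noteq> 0" if "of_real b = s + s'" "of_real (- c) = s * s'" for s s'
  proof
    assume "Re s = 0"
    have "Re s' = b" "Im s' = - Im s" using that(1) \<open>Re s = 0\<close> by (auto simp: complex_eq_iff)
    moreover have "Im s * Re s' = 0" "Re (s * s') = - c"
      using that(2) \<open>Re s = 0\<close> by (auto simp: complex_eq_iff)
    ultimately show False using assms \<open>Re s = 0\<close> by simp
  qed
  show ?thesis using that[OF sum prod] off[OF sum prod] off[of s2 s1] sum prod by (simp add: add.commute mult.commute)
qed

lemma has_derivative_vec:
  fixes F :: "'a::real_normed_vector \<Rightarrow> real^'n"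
  assumes "\<And>i. ((\<lambda>x. F x $ i) has_derivative (\<lambda>d. D d $ i)) (at x)"
  shows "(F has_derivative D) (at x)"
  unfolding has_derivative_componentwise_within[of F D x UNIV]
  using assms by (auto simp: Basis_vec_def inner_axis)

lemma frechet_matrix_nth:
  assumes "(F has_derivative D) (at x)"
  shows "jacobian_at F x $ i $ j = D (axis j 1) $ i"
  using frechet_derivative_at[OF assms] by (simp add: jacobian_at_def matrix_def)

section \<open>Jacobians at the equilibria and along cycles in the z-plane\<close>

context mode_interaction
begin

definition nf_derivative :: "real \<times> real \<times> real \<Rightarrow> real^4 \<Rightarrow> real^4 \<Rightarrow> real^4" where
  "nf_derivative = (\<lambda>(\<alpha>1, \<alpha>2, \<alpha>3) x d.
    let z = ((x$1)\<^sup>2, rad2 x); du = 2 * x$1 * d$1; dv = 2 * x$3 * d$3 + 2 * x$4 * d$4;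
      D = (\<lambda>j. fu j z * du + fv j z * dv)
    in vector [d$2,
      (\<alpha>1 + f 1 z) * d$1 + D 1 * x$1 + ((\<alpha>2 + f 2 z) * d$2 + D 2 * x$2),
      (\<alpha>3 + f 3 z) * d$3 + D 3 * x$3 - ((1 + f 4 z) * d$4 + D 4 * x$4),
      (1 + f 4 z) * d$3 + D 4 * x$3 + ((\<alpha>3 + f 3 z) * d$4 + D 3 * x$4)])"

lemma nf_field_has_derivative:
  assumes S: "((x$1)\<^sup>2, rad2 x) \<in> S"
  shows "(nf_field f (\<alpha>1, \<alpha>2, \<alpha>3) has_derivative nf_derivative (\<alpha>1, \<alpha>2, \<alpha>3) x) (at x)"
proof -
  have nth: "((\<lambda>x::real^4. x $ i) has_derivative (\<lambda>d. d $ i)) (at x)" for i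
    by (rule bounded_linear_imp_has_derivative[OF bounded_linear_vec_nth])
  have z: "((\<lambda>x::real^4. ((x$1)\<^sup>2, (x$3)\<^sup>2 + (x$4)\<^sup>2)) has_derivative
      (\<lambda>d. (2 * x$1 * d$1, 2 * x$3 * d$3 + 2 * x$4 * d$4))) (at x)"
    by (rule derivative_eq_intros nth refl)+ (simp add: fun_eq_iff)
  have df: "((\<lambda>x::real^4. f j ((x$1)\<^sup>2, (x$3)\<^sup>2 + (x$4)\<^sup>2)) has_derivative
      (\<lambda>d. fu j ((x$1)\<^sup>2, (x$3)\<^sup>2 + (x$4)\<^sup>2) * (2 * x$1 * d$1) + fv j ((x$1)\<^sup>2, (x$3)\<^sup>2 + (x$4)\<^sup>2) * (2 * x$3 * d$3 + 2 * x$4 * d$4))) (at x)"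
    if "j \<in> {1..4}" for j
    using has_derivative_compose[OF z der[OF that S[unfolded rad2_def]]] by simp
  have j: "1 \<in> {1..4::nat}" "2 \<in> {1..4::nat}" "3 \<in> {1..4::nat}" "4 \<in> {1..4::nat}" by auto
  show ?thesis
  proof (rule has_derivative_vec)
    have c1: "((\<lambda>x. nf_field f (\<alpha>1, \<alpha>2, \<alpha>3) x $ 1) has_derivative (\<lambda>d. nf_derivative (\<alpha>1, \<alpha>2, \<alpha>3) x d $ 1)) (at x)"
      unfolding nf_field_nth by (simp add: nf_derivative_def Let_def nth)
    have c2: "((\<lambda>x. nf_field f (\<alpha>1, \<alpha>2, \<alpha>3) x $ 2) has_derivative (\<lambda>d. nf_derivative (\<alpha>1, \<alpha>2, \<alpha>3) x d $ 2)) (at x)"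
      unfolding nf_field_nth
      by (rule derivative_eq_intros nth df[OF j(1)] df[OF j(2)] refl)+ (simp add: nf_derivative_def Let_def rad2_def algebra_simps)
    have c3: "((\<lambda>x. nf_field f (\<alpha>1, \<alpha>2, \<alpha>3) x $ 3) has_derivative (\<lambda>d. nf_derivative (\<alpha>1, \<alpha>2, \<alpha>3) x d $ 3)) (at x)"
      unfolding nf_field_nth
      by (rule derivative_eq_intros nth df[OF j(3)] df[OF j(4)] refl)+ (simp add: nf_derivative_def Let_def rad2_def algebra_simps)
    have c4: "((\<lambda>x. nf_field f (\<alpha>1, \<alpha>2, \<alpha>3) x $ 4) has_derivative (\<lambda>d. nf_derivative (\<alpha>1, \<alpha>2, \<alpha>3) x d $ 4)) (at x)"
      unfolding nf_field_nth
      by (rule derivative_eq_intros nth df[OF j(3)] df[OF j(4)] refl)+ (simp add: nf_derivative_def Let_def rad2_def algebra_simps)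
    show "((\<lambda>x. nf_field f (\<alpha>1, \<alpha>2, \<alpha>3) x $ i) has_derivative (\<lambda>d. nf_derivative (\<alpha>1, \<alpha>2, \<alpha>3) x d $ i)) (at x)" for i :: 4
      using exhaust_4[of i] c1 c2 c3 c4 by auto
  qed
qed

lemma eq_pt_nth [simp]: "eq_pt y $ 1 = y" "eq_pt y $ 2 = 0" "eq_pt y $ 3 = 0" "eq_pt y $ 4 = 0"
  by (simp_all add: eq_pt_def)

text \<open>The functions depend on z only through r^2, whose derivative vanishes at z = 0, and the
  z equations carry a factor z; hence the off-diagonal blocks are zero. The term with
  \<open>fu 1\<close> comes from differentiating \<open>f 1\<close> through y1^2.\<close>

lemma jacobian_eq_pt:
  assumes "(y\<^sup>2, 0) \<in> S"
  shows "nf_field f (\<alpha>1, \<alpha>2, \<alpha>3) differentiable (at (eq_pt y))"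
    and "jacobian_at (nf_field f (\<alpha>1, \<alpha>2, \<alpha>3)) (eq_pt y) =
      block4 0 1 (\<alpha>1 + f 1 (y\<^sup>2, 0) + 2 * y\<^sup>2 * fu 1 (y\<^sup>2, 0)) (\<alpha>2 + f 2 (y\<^sup>2, 0))
        (\<alpha>3 + f 3 (y\<^sup>2, 0)) (- (1 + f 4 (y\<^sup>2, 0))) (1 + f 4 (y\<^sup>2, 0)) (\<alpha>3 + f 3 (y\<^sup>2, 0))"
proof -
  have d: "(nf_field f (\<alpha>1, \<alpha>2, \<alpha>3) has_derivative nf_derivative (\<alpha>1, \<alpha>2, \<alpha>3) (eq_pt y)) (at (eq_pt y))"
    by (rule nf_field_has_derivative) (use assms in \<open>simp add: rad2_def\<close>)
  then show "nf_field f (\<alpha>1, \<alpha>2, \<alpha>3) differentiable (at (eq_pt y))" by (auto simp: differentiable_def)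
  show "jacobian_at (nf_field f (\<alpha>1, \<alpha>2, \<alpha>3)) (eq_pt y) =
      block4 0 1 (\<alpha>1 + f 1 (y\<^sup>2, 0) + 2 * y\<^sup>2 * fu 1 (y\<^sup>2, 0)) (\<alpha>2 + f 2 (y\<^sup>2, 0))
        (\<alpha>3 + f 3 (y\<^sup>2, 0)) (- (1 + f 4 (y\<^sup>2, 0))) (1 + f 4 (y\<^sup>2, 0)) (\<alpha>3 + f 3 (y\<^sup>2, 0))"
    by (simp add: vec_eq_iff forall_4 frechet_matrix_nth[OF d] nf_derivative_def Let_def axis_def rad2_def power2_eq_square)
qed

text \<open>On y1 = y2 = 0 the derivative of y1^2 vanishes and the equation for y2 carries the
  factors y1 and y2, so the blocks decouple again. Only the z block varies along the cycle.\<close>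

lemma jacobian_circle:
  assumes "(0, v) \<in> S" and x: "x \<in> circ 0 v"
  shows "nf_field f (\<alpha>1, \<alpha>2, \<alpha>3) differentiable (at x)"
    and "jacobian_at (nf_field f (\<alpha>1, \<alpha>2, \<alpha>3)) x =
      block4 0 1 (\<alpha>1 + f 1 (0, v)) (\<alpha>2 + f 2 (0, v))
        (\<alpha>3 + f 3 (0, v) + 2 * x$3 * (fv 3 (0, v) * x$3 - fv 4 (0, v) * x$4))
        (- (1 + f 4 (0, v)) + 2 * x$4 * (fv 3 (0, v) * x$3 - fv 4 (0, v) * x$4))
        (1 + f 4 (0, v) + 2 * x$3 * (fv 4 (0, v) * x$3 + fv 3 (0, v) * x$4))
        (\<alpha>3 + f 3 (0, v) + 2 * x$4 * (fv 4 (0, v) * x$3 + fv 3 (0, v) * x$4))"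
proof -
  have x12: "x$1 = 0" "x$2 = 0" "rad2 x = v" using x by (auto simp: circ_def rad2_def)
  have d: "(nf_field f (\<alpha>1, \<alpha>2, \<alpha>3) has_derivative nf_derivative (\<alpha>1, \<alpha>2, \<alpha>3) x) (at x)"
    by (rule nf_field_has_derivative) (use assms x12 in simp)
  then show "nf_field f (\<alpha>1, \<alpha>2, \<alpha>3) differentiable (at x)" by (auto simp: differentiable_def)
  show "jacobian_at (nf_field f (\<alpha>1, \<alpha>2, \<alpha>3)) x =
      block4 0 1 (\<alpha>1 + f 1 (0, v)) (\<alpha>2 + f 2 (0, v))
        (\<alpha>3 + f 3 (0, v) + 2 * x$3 * (fv 3 (0, v) * x$3 - fv 4 (0, v) * x$4))
        (- (1 + f 4 (0, v)) + 2 * x$4 * (fv 3 (0, v) * x$3 - fv 4 (0, v) * x$4))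
        (1 + f 4 (0, v) + 2 * x$3 * (fv 4 (0, v) * x$3 + fv 3 (0, v) * x$4))
        (\<alpha>3 + f 3 (0, v) + 2 * x$4 * (fv 4 (0, v) * x$3 + fv 3 (0, v) * x$4))"
    by (simp add: vec_eq_iff forall_4 frechet_matrix_nth[OF d] nf_derivative_def Let_def axis_def x12 algebra_simps)
qed

text \<open>In the frame rotating with the cycle the variational equation is autonomous, which gives its
  fundamental solution explicitly; \<open>l1\<close> and \<open>l2\<close> are the eigenvalues of the \<open>y\<close> block.\<close>

lemma monodromy_circle:
  fixes l1 l2 :: real
  assumes S: "(0, v) \<in> S" and v: "v > 0" and k: "\<alpha>3 + f 3 (0, v) = 0" and w: "f 4 (0, v) > -1"
    and nz: "fv 3 (0, v) \<noteq> 0"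
    and l: "l1 \<noteq> l2" "l1 + l2 = \<alpha>2 + f 2 (0, v)" "l1 * l2 = - (\<alpha>1 + f 1 (0, v))"
  defines "T \<equiv> 2 * pi / (1 + f 4 (0, v))"
  shows "\<exists>M. monodromy (nf_field f (\<alpha>1, \<alpha>2, \<alpha>3)) (circ 0 v) M \<and>
    charpoly M = ([:- complex_of_real (exp (l1 * T)), 1:] * [:- complex_of_real (exp (l2 * T)), 1:]) *
      ([:- complex_of_real (exp (2 * v * fv 3 (0, v) * T)), 1:] * [:- 1, 1:])"
proof -
  define \<omega> r where "\<omega> = 1 + f 4 (0, v)" and "r = sqrt v"
  have r: "r\<^sup>2 = v" "r > 0" and \<omega>: "\<omega> > 0" using v w by (simp_all add: r_def \<omega>_def)
  define \<kappa> \<tau> where "\<kappa> = fv 3 (0, v)" and "\<tau> = fv 4 (0, v)"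
  define x where "x = rotating 0 r \<omega>"
  \<comment> \<open>\<open>e1\<close> and \<open>e2\<close> carry the denominator
    \<open>l1 - l2\<close> of Lagrange interpolation, which expresses the exponential of the
    companion matrix with eigenvalues \<open>l1\<close> and \<open>l2\<close>; \<open>e3\<close> is
    the growth factor of a radial perturbation.\<close>
  define e1 e2 e3 where "e1 t = exp (l1 * t) / (l1 - l2)" and "e2 t = exp (l2 * t) / (l1 - l2)" and "e3 t = exp (2 * v * \<kappa> * t)" for t
  define C s where "C t = cos (\<omega> * t)" and "s t = sin (\<omega> * t)" for t
  \<comment> \<open>The phase shift accumulated by a radial perturbation: the solution of \<sigma>'
    = 2 v \<tau> e3 that starts at 0.\<close>
  define \<sigma> where "\<sigma> t = \<tau> / \<kappa> * (e3 t - 1)" for t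
  \<comment> \<open>The z block is the rotation by the angle \<open>\<omega> * t\<close> times the
    matrix with rows (e3, 0) and (\<sigma>, 1), which is the fundamental solution in the rotating
    frame; its second column stays tangent to the cycle.\<close>
  define X where "X t = block4 (l1 * e2 t - l2 * e1 t) (e1 t - e2 t)
    (l1 * l2 * (e2 t - e1 t)) (l1 * e1 t - l2 * e2 t)
    (C t * e3 t - s t * \<sigma> t) (- s t) (s t * e3 t + C t * \<sigma> t) (C t)" for t
  have xc: "x t \<in> circ 0 v" for t
    using rad2_rotating[of 0 r \<omega> t] r by (simp add: circ_def x_def rad2_def)
  have T: "T > 0" "\<omega> * T = 2 * pi" using \<omega> by (simp_all add: T_def \<omega>_def)
  have sol: "solution (nf_field f (\<alpha>1, \<alpha>2, \<alpha>3)) x"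
    unfolding x_def by (rule solution_rotating) (use k r \<omega>_def in auto)
  have ran: "circ 0 v = range x" using range_rotating[of \<omega> 0 r] r \<omega> by (simp add: x_def)
  have per: "x T = x 0" by (simp add: x_def rotating_def T(2))
  have min: "x t \<noteq> x 0" if "0 < t" "t < T" for t
  proof
    assume eq: "x t = x 0"
    have "x t $ 3 = r" using eq by (simp add: x_def)
    then have "cos (\<omega> * t) = 1" using r by (simp add: x_def)
    then obtain n where n: "\<omega> * t = of_int n * 2 * pi" using cos_one_2pi_int by blast
    have "0 < \<omega> * t" "\<omega> * t < 2 * pi" using that \<omega> T(2) by (simp_all add: mult_strict_left_mono flip: T(2))
    then have "0 < of_int n * (2 * pi)" "of_int n * (2 * pi) < 1 * (2 * pi)" using n by simp_all
    then have "0 < n" "n < 1" by (simp_all add: zero_less_mult_iff)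
    then show False by simp
  qed
  have X0: "X 0 = mat 1"
    using l(1) by (simp add: X_def vec_eq_iff forall_4 mat_def e1_def e2_def e3_def C_def s_def \<sigma>_def
        diff_divide_distrib[symmetric])
  have dX: "(X has_vector_derivative (jacobian_at (nf_field f (\<alpha>1, \<alpha>2, \<alpha>3)) (x t) ** X t)) (at t)" for t
  proof -
    have de: "(e1 has_real_derivative l1 * e1 t) (at t)" "(e2 has_real_derivative l2 * e2 t) (at t)"
      "(e3 has_real_derivative 2 * v * \<kappa> * e3 t) (at t)" "(C has_real_derivative - \<omega> * s t) (at t)"
      "(s has_real_derivative \<omega> * C t) (at t)"
      unfolding e1_def[abs_def] e2_def[abs_def] e3_def[abs_def] C_def[abs_def] s_def[abs_def]
      using l(1) by (auto intro!: derivative_eq_intros)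
    have d\<sigma>: "(\<sigma> has_real_derivative 2 * v * \<tau> * e3 t) (at t)"
      unfolding \<sigma>_def[abs_def] using nz by (auto intro!: derivative_eq_intros de simp: \<kappa>_def)
    have x34: "x t $ 3 = r * C t" "x t $ 4 = r * s t" by (simp_all add: x_def C_def s_def)
    have cs: "(C t)\<^sup>2 + (s t)\<^sup>2 = 1" by (simp add: C_def s_def)
    have g: "\<alpha>1 + f 1 (0, v) = - (l1 * l2)" "\<alpha>2 + f 2 (0, v) = l1 + l2" using l by simp_all
    have J: "jacobian_at (nf_field f (\<alpha>1, \<alpha>2, \<alpha>3)) (x t) =
      block4 0 1 (- (l1 * l2)) (l1 + l2)
        (2 * v * C t * (\<kappa> * C t - \<tau> * s t)) (- \<omega> + 2 * v * s t * (\<kappa> * C t - \<tau> * s t))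
        (\<omega> + 2 * v * C t * (\<tau> * C t + \<kappa> * s t)) (2 * v * s t * (\<tau> * C t + \<kappa> * s t))"
      unfolding jacobian_circle(2)[OF S xc] g k x34 \<omega>_def[symmetric] \<kappa>_def[symmetric] \<tau>_def[symmetric]
      unfolding r(1)[symmetric]
      by (simp add: power2_eq_square algebra_simps)
    have nz12: "l1 - l2 \<noteq> 0" using l(1) by simp
    show ?thesis
      unfolding J X_def block4_mult
    proof (rule has_vector_derivative_block4)
      show "((\<lambda>t. l1 * e2 t - l2 * e1 t) has_real_derivative
          0 * (l1 * e2 t - l2 * e1 t) + 1 * (l1 * l2 * (e2 t - e1 t))) (at t)"
        by (rule derivative_eq_intros de refl)+ algebra
      show "((\<lambda>t. e1 t - e2 t) has_real_derivative
          0 * (e1 t - e2 t) + 1 * (l1 * e1 t - l2 * e2 t)) (at t)"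
        by (rule derivative_eq_intros de refl)+ algebra
      show "((\<lambda>t. l1 * l2 * (e2 t - e1 t)) has_real_derivative
          - (l1 * l2) * (l1 * e2 t - l2 * e1 t) + (l1 + l2) * (l1 * l2 * (e2 t - e1 t))) (at t)"
        by (rule derivative_eq_intros de refl)+ algebra
      show "((\<lambda>t. l1 * e1 t - l2 * e2 t) has_real_derivative
          - (l1 * l2) * (e1 t - e2 t) + (l1 + l2) * (l1 * e1 t - l2 * e2 t)) (at t)"
        by (rule derivative_eq_intros de refl)+ algebra
      show "((\<lambda>t. C t * e3 t - s t * \<sigma> t) has_real_derivative
          2 * v * C t * (\<kappa> * C t - \<tau> * s t) * (C t * e3 t - s t * \<sigma> t) +
          (- \<omega> + 2 * v * s t * (\<kappa> * C t - \<tau> * s t)) * (s t * e3 t + C t * \<sigma> t)) (at t)"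
        by (rule derivative_eq_intros de d\<sigma> refl)+ (use cs in algebra)
      show "((\<lambda>t. - s t) has_real_derivative
          2 * v * C t * (\<kappa> * C t - \<tau> * s t) * (- s t) +
          (- \<omega> + 2 * v * s t * (\<kappa> * C t - \<tau> * s t)) * C t) (at t)"
        by (rule derivative_eq_intros de d\<sigma> refl)+ algebra
      show "((\<lambda>t. s t * e3 t + C t * \<sigma> t) has_real_derivative
          (\<omega> + 2 * v * C t * (\<tau> * C t + \<kappa> * s t)) * (C t * e3 t - s t * \<sigma> t) +
          2 * v * s t * (\<tau> * C t + \<kappa> * s t) * (s t * e3 t + C t * \<sigma> t)) (at t)"
        by (rule derivative_eq_intros de d\<sigma> refl)+ (use cs in algebra)
      show "(C has_real_derivative
          (\<omega> + 2 * v * C t * (\<tau> * C t + \<kappa> * s t)) * (- s t) +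
          2 * v * s t * (\<tau> * C t + \<kappa> * s t) * C t) (at t)"
        by (rule DERIV_cong[OF de(4)]) algebra
    qed
  qed
  have "monodromy (nf_field f (\<alpha>1, \<alpha>2, \<alpha>3)) (circ 0 v) (X T)"
    unfolding monodromy_def
    using sol ran T(1) per min X0 dX jacobian_circle(1)[OF S xc]
    by (intro exI[of _ x] exI[of _ T] exI[of _ X]) auto
  moreover have "charpoly (X T) = ([:- complex_of_real (exp (l1 * T)), 1:] * [:- complex_of_real (exp (l2 * T)), 1:]) *
      ([:- complex_of_real (e3 T), 1:] * [:- 1, 1:])"
    unfolding X_def
  proof (rule charpoly_block4)
    have nz12: "l1 - l2 \<noteq> 0" using l(1) by simp
    have e: "exp (l1 * T) = e1 T * (l1 - l2)" "exp (l2 * T) = e2 T * (l1 - l2)" using nz12 by (simp_all add: e1_def e2_def)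
    have "l1 * e2 T - l2 * e1 T + (l1 * e1 T - l2 * e2 T) = exp (l1 * T) + exp (l2 * T)"
      unfolding e by algebra
    then show "complex_of_real (l1 * e2 T - l2 * e1 T + (l1 * e1 T - l2 * e2 T)) =
      complex_of_real (exp (l1 * T)) + complex_of_real (exp (l2 * T))" by (metis of_real_add)
    have "(l1 * e2 T - l2 * e1 T) * (l1 * e1 T - l2 * e2 T) - (e1 T - e2 T) * (l1 * l2 * (e2 T - e1 T)) =
      exp (l1 * T) * exp (l2 * T)"
      unfolding e by algebra
    then show "complex_of_real ((l1 * e2 T - l2 * e1 T) * (l1 * e1 T - l2 * e2 T) - (e1 T - e2 T) * (l1 * l2 * (e2 T - e1 T))) =
      complex_of_real (exp (l1 * T)) * complex_of_real (exp (l2 * T))"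
      by (metis of_real_mult)
    \<comment> \<open>After one period the rotation is the identity, so the z block is lower
      triangular with diagonal entries \<open>e3 T\<close> and 1. The second is the trivial
      multiplier.\<close>
    have "C T = 1" "s T = 0" using T(2) by (simp_all add: C_def s_def)
    then show "complex_of_real (C T * e3 T - s T * \<sigma> T + C T) = complex_of_real (e3 T) + 1"
      "complex_of_real ((C T * e3 T - s T * \<sigma> T) * C T - - s T * (s T * e3 T + C T * \<sigma> T)) = complex_of_real (e3 T) * 1"
      by simp_all
  qed
  ultimately show ?thesis unfolding e3_def \<kappa>_def by blast
qed

end

section \<open>Local bifurcations\<close>

lemma isCont_eventually_close:
  fixes a :: "real \<Rightarrow> real"
  assumes "isCont a \<mu>" "\<rho> > 0"
  shows "\<forall>\<^sub>F s in nhds \<mu>. \<bar>a s - a \<mu>\<bar> < \<rho>"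
proof -
  have "(a \<longlongrightarrow> a \<mu>) (nhds \<mu>)" using assms(1) by (simp add: isCont_def tendsto_at_iff_tendsto_nhds)
  from tendstoD[OF this assms(2)] show ?thesis by (simp add: dist_real_def)
qed

lemma isCont_eventually_less:
  fixes a b :: "real \<Rightarrow> real"
  assumes "isCont a \<mu>" "isCont b \<mu>" "a \<mu> < b \<mu>"
  shows "\<forall>\<^sub>F s in nhds \<mu>. a s < b s"
  using isCont_eventually_close[of \<mu> "\<lambda>s. b s - a s" "b \<mu> - a \<mu>"] assms
  by (auto elim!: eventually_mono)

text \<open>The difference quotient tends to \<open>d \<noteq> 0\<close>, so near
  \<open>\<mu>\<close> the function has the sign of \<open>d * (s - \<mu>)\<close>; at
  \<open>\<mu>\<close> itself both sides of the equivalence are false. The factor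
  \<open>sgn d\<close> is the side \<sigma> required by the bifurcation definitions.\<close>

lemma transversal_sign:
  fixes g :: "real \<Rightarrow> real"
  assumes "(g has_real_derivative d) (at \<mu>)" "g \<mu> = 0" "d \<noteq> 0"
  shows "\<forall>\<^sub>F s in nhds \<mu>. g s > 0 \<longleftrightarrow> sgn d * (s - \<mu>) > 0"
proof -
  have "((\<lambda>s. (g s - g \<mu>) / (s - \<mu>)) \<longlongrightarrow> d) (at \<mu>)"
    using assms(1) by (simp add: has_field_derivative_iff)
  then have "((\<lambda>s. d * (g s / (s - \<mu>))) \<longlongrightarrow> d * d) (at \<mu>)"
    by (intro tendsto_mult tendsto_const) (simp add: assms(2))
  moreover have "0 < d * d" using \<open>d \<noteq> 0\<close> by (metis not_real_square_gt_zero)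
  ultimately have "\<forall>\<^sub>F s in at \<mu>. d * (g s / (s - \<mu>)) > 0" by (rule order_tendstoD(1))
  then have "\<forall>\<^sub>F s in nhds \<mu>. s \<noteq> \<mu> \<longrightarrow> d * (g s / (s - \<mu>)) > 0" by (simp add: eventually_at_filter)
  then show ?thesis
  proof eventually_elim
    case (elim s)
    show ?case
    proof (cases "s = \<mu>")
      case False
      with elim show ?thesis
        by (auto simp: zero_less_mult_iff mult_less_0_iff zero_less_divide_iff divide_less_0_iff sgn_if split: if_splits)
    qed (simp add: assms(2))
  qed
qed

lemma linear_y_flip: "linear y_flip"
  by (rule linearI) (simp_all add: y_flip_def vec_eq_iff forall_4)

lemma y_flip_nth [simp]: "y_flip x $ 1 = - x$1" "y_flip x $ 2 = - x$2" "y_flip x $ 3 = x$3" "y_flip x $ 4 = x$4"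
  by (simp_all add: y_flip_def)

lemma symmetry_of_y_flip: "symmetry_of (\<lambda>s. nf_field f (a1 s, a2 s, a3 s)) y_flip"
  unfolding symmetry_of_def
  by (auto simp: linear_y_flip fun_eq_iff vec_eq_iff forall_4 nf_field_nth algebra_simps)

lemma y_flip_circ: "y_flip ` circ x v = circ (- x) v"
proof (intro equalityI subsetI)
  fix z assume z: "z \<in> circ (- x) v"
  then have "y_flip z \<in> circ x v" by (simp add: circ_def)
  moreover have "z = y_flip (y_flip z)" by (simp add: vec_eq_iff forall_4)
  ultimately show "z \<in> y_flip ` circ x v" by blast
qed (auto simp: circ_def)

lemma circ_zero: "circ x 0 = {eq_pt x}"
  by (auto simp: circ_def vec_eq_iff forall_4 eq_pt_def sum_power2_eq_zero_iff)

lemma eq_pt_zero [simp]: "eq_pt 0 = 0"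
  by (simp add: vec_eq_iff forall_4 eq_pt_def)

lemma Complex_conj_pair: "complex_of_real (k + k) = Complex k w + Complex k (- w)"
  "complex_of_real (k * k - - w * w) = Complex k w * Complex k (- w)"
  by (simp_all add: complex_eq_iff)

context mode_interaction
begin

lemma charpoly_eq_pt:
  assumes "(y\<^sup>2, 0) \<in> S"
    and "complex_of_real (\<alpha>2 + f 2 (y\<^sup>2, 0)) = s1 + s2"
    and "complex_of_real (- (\<alpha>1 + f 1 (y\<^sup>2, 0) + 2 * y\<^sup>2 * fu 1 (y\<^sup>2, 0))) = s1 * s2"
  shows "charpoly (jacobian_at (nf_field f (\<alpha>1, \<alpha>2, \<alpha>3)) (eq_pt y)) =
    ([:- s1, 1:] * [:- s2, 1:]) * ([:- Complex (\<alpha>3 + f 3 (y\<^sup>2, 0)) (1 + f 4 (y\<^sup>2, 0)), 1:] *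
      [:- Complex (\<alpha>3 + f 3 (y\<^sup>2, 0)) (- (1 + f 4 (y\<^sup>2, 0))), 1:])"
  unfolding jacobian_eq_pt(2)[OF assms(1)]
  by (rule charpoly_block4) (use assms(2,3) in \<open>simp_all only: Complex_conj_pair\<close>, simp_all)

end

text \<open>\<open>l s\<close> and \<open>b s - l s\<close> are the roots of z^2 - b z - g; the plus
  sign selects the root through zero, because the square root of b^2 is - b for b < 0. The lemma
  serves both for an eigenvalue at the origin and for a Floquet exponent of H1. A positive
  discriminant keeps the roots distinct, as the explicit monodromy matrix requires.\<close>

lemma quadratic_root_through_zero:
  fixes b g :: "real \<Rightarrow> real"
  assumes b: "(b has_real_derivative b') (at \<mu>)" and g: "(g has_real_derivative g') (at \<mu>)"
    and "b \<mu> < 0" "g \<mu> = 0"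
  defines "l \<equiv> \<lambda>s. (b s + sqrt ((b s)\<^sup>2 + 4 * g s)) / 2"
  shows "l \<mu> = 0" "(l has_real_derivative - g' / b \<mu>) (at \<mu>)"
    "\<forall>\<^sub>F s in nhds \<mu>. (b s)\<^sup>2 + 4 * g s > 0"
    "(b s)\<^sup>2 + 4 * g s > 0 \<Longrightarrow> l s \<noteq> b s - l s \<and> l s * (b s - l s) = - g s"
proof -
  have sq: "sqrt ((b \<mu>)\<^sup>2 + 4 * g \<mu>) = - b \<mu>" using assms(3,4) by simp
  then show "l \<mu> = 0" by (simp add: l_def)
  have pos: "(b \<mu>)\<^sup>2 + 4 * g \<mu> > 0" using assms(3,4) by simp
  show "(l has_real_derivative - g' / b \<mu>) (at \<mu>)"
  proof -
    have "((\<lambda>s. (b s)\<^sup>2 + 4 * g s) has_real_derivative 2 * b \<mu> * b' + 4 * g') (at \<mu>)"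
      by (rule derivative_eq_intros b g refl)+ simp
    from DERIV_chain2[OF DERIV_real_sqrt[OF pos] this]
    have "((\<lambda>s. (b s + sqrt ((b s)\<^sup>2 + 4 * g s)) / 2) has_real_derivative
        (b' + inverse (sqrt ((b \<mu>)\<^sup>2 + 4 * g \<mu>)) / 2 * (2 * b \<mu> * b' + 4 * g')) / 2) (at \<mu>)"
      by (intro DERIV_cdivide DERIV_add b)
    moreover have "(b' + inverse (sqrt ((b \<mu>)\<^sup>2 + 4 * g \<mu>)) / 2 * (2 * b \<mu> * b' + 4 * g')) / 2 = - g' / b \<mu>"
      unfolding sq using assms(3) by (simp add: field_simps)
    ultimately show ?thesis unfolding l_def by simp
  qed
  have "isCont b \<mu>" "isCont g \<mu>" using b g DERIV_isCont by blast+
  then have "isCont (\<lambda>s. (b s)\<^sup>2 + 4 * g s) \<mu>" by (intro continuous_intros)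
  from isCont_eventually_less[OF continuous_const this pos] show "\<forall>\<^sub>F s in nhds \<mu>. (b s)\<^sup>2 + 4 * g s > 0" .
  assume p: "(b s)\<^sup>2 + 4 * g s > 0"
  have "(sqrt ((b s)\<^sup>2 + 4 * g s))\<^sup>2 = (b s)\<^sup>2 + 4 * g s" using p by simp
  then have "l s * (b s - l s) = - g s"
    by (simp add: l_def field_simps power2_eq_square)
  moreover have "b s - l s \<noteq> l s" using p by (simp add: l_def field_simps)
  ultimately show "l s \<noteq> b s - l s \<and> l s * (b s - l s) = - g s" by metis
qed

section \<open>The equilibria, the primary pitchfork, and a common form of the Hopf
  bifurcations\<close>

context mode_branches
begin

text \<open>The positive phase speed \<open>w\<close> forbids equilibria with nonzero z, since the z
  equations give (a^2 + w^2) |z|^2 = 0. For z = 0 and y1 nonzero the remaining equation determines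
  y1^2 as \<open>p \<alpha>1\<close>.\<close>

lemma equilibria:
  assumes \<alpha>1: "\<bar>\<alpha>1\<bar> < \<delta>"
  shows "{x. nf_field f (\<alpha>1, \<alpha>2, \<alpha>3) x = 0 \<and> (x$1)\<^sup>2 < \<eta> \<and> (x$3)\<^sup>2 + (x$4)\<^sup>2 < \<eta>} =
    (if p \<alpha>1 > 0 then {0, eq_pt (sqrt (p \<alpha>1)), eq_pt (- sqrt (p \<alpha>1))} else {0})" (is "?L = ?R")
proof (intro equalityI subsetI)
  fix x assume "x \<in> ?R"
  then have "x = 0 \<or> p \<alpha>1 > 0 \<and> (x = eq_pt (sqrt (p \<alpha>1)) \<or> x = eq_pt (- sqrt (p \<alpha>1)))"
    by (auto split: if_splits)
  then show "x \<in> ?L"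
    using p[OF \<alpha>1] eta_pos by (auto simp: vec_eq_iff forall_4 nf_field_nth)
next
  fix x assume x: "x \<in> ?L"
  define a w where "a = \<alpha>3 + f 3 ((x$1)\<^sup>2, (x$3)\<^sup>2 + (x$4)\<^sup>2)" and "w = 1 + f 4 ((x$1)\<^sup>2, (x$3)\<^sup>2 + (x$4)\<^sup>2)"
  have x2: "x$2 = 0" and e1: "(\<alpha>1 + f 1 ((x$1)\<^sup>2, (x$3)\<^sup>2 + (x$4)\<^sup>2)) * x$1 = 0"
    and e3: "a * x$3 - w * x$4 = 0" and e4: "w * x$3 + a * x$4 = 0"
    using x by (auto simp: vec_eq_iff forall_4 nf_field_nth a_def w_def)
  have "w > 0" using box[of "(x$1)\<^sup>2" "(x$3)\<^sup>2 + (x$4)\<^sup>2"] x by (simp add: w_def)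
  then have "a\<^sup>2 + w\<^sup>2 > 0" by (simp add: add_nonneg_pos)
  moreover have "(a\<^sup>2 + w\<^sup>2) * ((x$3)\<^sup>2 + (x$4)\<^sup>2) = 0" using e3 e4 by algebra
  ultimately have x34: "x$3 = 0" "x$4 = 0" by (auto simp: sum_power2_eq_zero_iff)
  show "x \<in> ?R"
  proof (cases "x$1 = 0")
    case True
    then have "x = 0" using x2 x34 by (simp add: vec_eq_iff forall_4)
    then show ?thesis by auto
  next
    case False
    then have pe: "(x$1)\<^sup>2 = p \<alpha>1" using e1 x p_unique[OF \<alpha>1, of "(x$1)\<^sup>2"] by (simp add: x34)
    then have "p \<alpha>1 > 0" using False by (metis zero_less_power2)
    moreover have "x$1 = sqrt (p \<alpha>1) \<or> x$1 = - sqrt (p \<alpha>1)"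
      using pe by (metis real_sqrt_abs abs_if minus_minus)
    then have "x = eq_pt (sqrt (p \<alpha>1)) \<or> x = eq_pt (- sqrt (p \<alpha>1))"
      using x2 x34 by (auto simp: vec_eq_iff forall_4)
    ultimately show ?thesis by auto
  qed
qed

text \<open>The y block at the origin has trace \<open>a2\<close> and determinant
  \<open>- a1\<close>, and the other pair \<open>a3\<close> plus or minus i is off the axis at
  \<open>\<mu>\<close>. So \<open>quadratic_root_through_zero\<close> gives the crossing, and the
  sign change of \<open>p\<close> gives the new equilibria. The factors \<open>1 *\<close> and
  \<open>- 1 *\<close> fit the family \<open>P\<close> of the theorem, which takes the sign as an
  argument.\<close>

lemma pitchfork_at_origin:
  assumes a1: "(a1 has_real_derivative d1) (at \<mu>)" and a2: "(a2 has_real_derivative d2) (at \<mu>)"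
    and \<mu>: "a1 \<mu> = 0" "d1 \<noteq> 0" "a3 \<mu> \<noteq> 0" "a2 \<mu> < 0"
  shows "pitchfork_of_equilibria (\<lambda>s. nf_field f (a1 s, a2 s, a3 s)) y_flip \<mu> (\<lambda>_. 0)
    (\<lambda>s. eq_pt (1 * sqrt (p (a1 s)))) (\<lambda>s. eq_pt (- 1 * sqrt (p (a1 s))))"
proof -
  define F where "F s = nf_field f (a1 s, a2 s, a3 s)" for s
  have j: "1 \<in> {1..4::nat}" "2 \<in> {1..4::nat}" "3 \<in> {1..4::nat}" "4 \<in> {1..4::nat}" by auto
  have S0: "((0::real)\<^sup>2, 0) \<in> S" using zero_S by simp
  have small: "\<forall>\<^sub>F s in nhds \<mu>. \<bar>a1 s\<bar> < \<delta>"
    using isCont_eventually_close[OF DERIV_isCont[OF a1] delta_pos] \<mu>(1) by simp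
  note root = quadratic_root_through_zero[OF a2 a1 \<mu>(4,1)]
  define l where "l s = (a2 s + sqrt ((a2 s)\<^sup>2 + 4 * a1 s)) / 2" for s
  note root = root[folded l_def]
  have cp: "charpoly (jacobian_at (F s) 0) = ([:- s1, 1:] * [:- s2, 1:]) * ([:- Complex (a3 s) 1, 1:] * [:- Complex (a3 s) (- 1), 1:])"
    if "complex_of_real (a2 s) = s1 + s2" "complex_of_real (- a1 s) = s1 * s2" for s s1 s2
    using charpoly_eq_pt[OF S0, of "a2 s" s1 s2 "a1 s" "a3 s"] that f_zero[OF j(1)] f_zero[OF j(2)] f_zero[OF j(3)] f_zero[OF j(4)]
    by (simp add: F_def)
  have ev: "\<forall>\<^sub>F s in nhds \<mu>. eigenvalue (jacobian_at (F s) 0) (complex_of_real (l s))"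
    using root(3)
  proof eventually_elim
    case (elim s)
    have "charpoly (jacobian_at (F s) 0) = ([:- of_real (l s), 1:] * [:- of_real (a2 s - l s), 1:]) * ([:- Complex (a3 s) 1, 1:] * [:- Complex (a3 s) (- 1), 1:])"
    proof (rule cp)
      show "complex_of_real (- a1 s) = complex_of_real (l s) * complex_of_real (a2 s - l s)"
        using root(4)[OF elim] by (simp only: of_real_mult[symmetric])
    qed simp
    from eigenvalue_block4[OF this] show ?case by simp
  qed
  have cp0: "charpoly (jacobian_at (F \<mu>) 0) = ([:- 0, 1:] * [:- of_real (a2 \<mu>), 1:]) * ([:- Complex (a3 \<mu>) 1, 1:] * [:- Complex (a3 \<mu>) (- 1), 1:])"
    by (rule cp) (simp_all add: \<mu>)
  have ord: "order 0 (charpoly (jacobian_at (F \<mu>) 0)) = 1"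
    unfolding cp0 order_four_factors using \<mu> by (simp add: complex_eq_iff)
  have hyp: "z = 0" if "eigenvalue (jacobian_at (F \<mu>) 0) z" "Re z = 0" for z
    using that \<mu> unfolding eigenvalue_block4[OF cp0] by auto
  have diff: "F s differentiable (at 0)" "F s 0 = 0" for s
    using jacobian_eq_pt(1)[OF S0] by (simp_all add: F_def vec_eq_iff forall_4 nf_field_nth)
  define d where "d = - d1 / fu 1 (0, 0)"
  have dnz: "d \<noteq> 0" using \<mu>(2) nondeg(2) by (simp add: d_def)
  have "((\<lambda>s. - a1 s / fu 1 (0, 0)) has_real_derivative d) (at \<mu>)"
    unfolding d_def by (intro DERIV_cdivide DERIV_minus a1)
  from transversal_sign[OF this _ dnz] have "\<forall>\<^sub>F s in nhds \<mu>. - a1 s / fu 1 (0, 0) > 0 \<longleftrightarrow> sgn d * (s - \<mu>) > 0"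
    using \<mu>(1) by simp
  with small have sign: "\<forall>\<^sub>F s in nhds \<mu>. p (a1 s) > 0 \<longleftrightarrow> sgn d * (s - \<mu>) > 0"
    by eventually_elim (simp add: p_pos)
  have cpa: "isCont (\<lambda>s. sqrt (p (a1 s))) \<mu>"
    using DERIV_isCont[OF a1] DERIV_isCont[OF p_deriv[of "a1 \<mu>"]] \<mu>(1) delta_pos
    by (intro continuous_intros isCont_o2[of \<mu> a1 p]) auto
  have sub: "\<forall>\<^sub>F s in nhds \<mu>. sgn d * (s - \<mu>) > 0 \<longrightarrow> eq_pt (sqrt (p (a1 s))) \<in> V \<and> eq_pt (- sqrt (p (a1 s))) \<in> V"
    if "open V" "0 \<in> V" for V
  proof -
    have "circ 0 0 \<subseteq> V" using that(2) by (simp add: circ_zero)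
    from tube_neighbourhood[OF that(1) this] obtain \<rho> where "\<rho> > 0" and \<rho>: "tube \<rho> 0 0 \<subseteq> V" by blast
    show ?thesis using isCont_eventually_close[OF cpa \<open>\<rho> > 0\<close>] sign
    proof eventually_elim
      case (elim s)
      then have "eq_pt (sqrt (p (a1 s))) \<in> tube \<rho> 0 0" "eq_pt (- sqrt (p (a1 s))) \<in> tube \<rho> 0 0"
        using \<mu>(1) zero_values \<open>\<rho> > 0\<close> by (auto simp: tube_def rad2_def)
      then show ?case using \<rho> by blast
    qed
  qed
  define U where "U = {x :: real^4. (x$1)\<^sup>2 < \<eta> \<and> (x$3)\<^sup>2 + (x$4)\<^sup>2 < \<eta>}"
  have "open U" unfolding U_def by (intro open_Collect_conj open_Collect_less continuous_intros)
  have eqs: "\<forall>\<^sub>F s in nhds \<mu>. {x \<in> U. F s x = 0} =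
      (if sgn d * (s - \<mu>) > 0 then {0, eq_pt (sqrt (p (a1 s))), eq_pt (- sqrt (p (a1 s)))} else {0})"
    using small sign
  proof eventually_elim
    case (elim s)
    have "{x \<in> U. F s x = 0} = {x. F s x = 0 \<and> (x$1)\<^sup>2 < \<eta> \<and> (x$3)\<^sup>2 + (x$4)\<^sup>2 < \<eta>}" by (auto simp: U_def)
    then show ?case using equilibria[OF elim(1), of "a2 s" "a3 s"] elim(2) by (simp add: F_def)
  qed
  have dist: "\<forall>\<^sub>F s in nhds \<mu>. sgn d * (s - \<mu>) > 0 \<longrightarrow>
      eq_pt (sqrt (p (a1 s))) \<noteq> 0 \<and> eq_pt (- sqrt (p (a1 s))) \<noteq> 0 \<and> eq_pt (sqrt (p (a1 s))) \<noteq> eq_pt (- sqrt (p (a1 s))) \<and>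
      y_flip (eq_pt (sqrt (p (a1 s)))) = eq_pt (- sqrt (p (a1 s)))"
    using sign by eventually_elim (auto simp: vec_eq_iff forall_4)
  have \<sigma>: "sgn d \<in> {-1, 1}" using dnz by (auto simp: sgn_if)
  have flip0: "y_flip 0 = 0" by (simp add: vec_eq_iff forall_4)
  have crossing: "\<exists>l d. l \<mu> = 0 \<and> (l has_real_derivative d) (at \<mu>) \<and> d \<noteq> 0 \<and>
      (\<forall>\<^sub>F s in nhds \<mu>. eigenvalue (jacobian_at (F s) 0) (complex_of_real (l s)))"
    using root(1,2) ev \<mu> by (intro exI[of _ l] exI[of _ "- d1 / a2 \<mu>"]) simp
  have "0 \<in> U" using eta_pos by (simp add: U_def)
  show ?thesis
    unfolding pitchfork_of_equilibria_def F_def[symmetric] mult_1 mult_minus1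
  proof (intro conjI)
    show "symmetry_of F y_flip" unfolding F_def[abs_def] by (rule symmetry_of_y_flip)
    show "\<exists>\<sigma>\<in>{-1, 1}.
      (\<exists>U. open U \<and> 0 \<in> U \<and> (\<forall>\<^sub>F \<mu>' in nhds \<mu>. {x \<in> U. F \<mu>' x = 0} =
          (if \<sigma> * (\<mu>' - \<mu>) > 0 then {0, eq_pt (sqrt (p (a1 \<mu>'))), eq_pt (- sqrt (p (a1 \<mu>')))} else {0}))) \<and>
      (\<forall>\<^sub>F \<mu>' in nhds \<mu>. \<sigma> * (\<mu>' - \<mu>) > 0 \<longrightarrow>
          eq_pt (sqrt (p (a1 \<mu>'))) \<noteq> 0 \<and> eq_pt (- sqrt (p (a1 \<mu>'))) \<noteq> 0 \<and> eq_pt (sqrt (p (a1 \<mu>'))) \<noteq> eq_pt (- sqrt (p (a1 \<mu>'))) \<and>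
          y_flip (eq_pt (sqrt (p (a1 \<mu>')))) = eq_pt (- sqrt (p (a1 \<mu>')))) \<and>
      (\<forall>V. open V \<and> 0 \<in> V \<longrightarrow>
        (\<forall>\<^sub>F \<mu>' in nhds \<mu>. \<sigma> * (\<mu>' - \<mu>) > 0 \<longrightarrow> eq_pt (sqrt (p (a1 \<mu>'))) \<in> V \<and> eq_pt (- sqrt (p (a1 \<mu>'))) \<in> V))"
      by (rule bexI[OF _ \<sigma>], intro conjI exI[of _ U] \<open>open U\<close> \<open>0 \<in> U\<close> eqs dist allI impI) (use sub in blast)
  qed (use crossing ord hyp diff flip0 in auto)
qed

text \<open>Serves both the primary Hopf bifurcation, with y = 0, and the one on P. The real part
  \<open>a3 + f 3\<close> of the critical pair crosses zero with speed \<open>\<kappa>\<close>,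
  while \<open>b\<close> and \<open>c\<close> keep the y block off the axis. The hypothesis
  \<open>steady\<close> locates the only circles of steady states at \<open>(x', v')\<close>, and
  \<open>periodic_orbits_near\<close> turns this into a list of all periodic orbits. As
  \<open>y\<close> enters the spectrum only through its square, differentiability is asked of the
  square.\<close>

lemma andronov_hopf_generic:
  fixes a1 a2 a3 y x' v' :: "real \<Rightarrow> real"
  assumes cont: "isCont a1 \<mu>" "isCont a2 \<mu>" "isCont a3 \<mu>" and y: "isCont y \<mu>"
    and y2: "((\<lambda>s. (y s)\<^sup>2) has_real_derivative u') (at \<mu>)" and y\<eta>: "(y \<mu>)\<^sup>2 < \<eta>"
    and eq: "\<forall>\<^sub>F s in nhds \<mu>. (a1 s + f 1 ((y s)\<^sup>2, 0)) * y s = 0"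
    and k: "((\<lambda>s. a3 s + f 3 ((y s)\<^sup>2, 0)) has_real_derivative \<kappa>) (at \<mu>)" "\<kappa> \<noteq> 0" "a3 \<mu> + f 3 ((y \<mu>)\<^sup>2, 0) = 0"
    and b: "a2 \<mu> + f 2 ((y \<mu>)\<^sup>2, 0) < 0"
    and c: "a1 \<mu> + f 1 ((y \<mu>)\<^sup>2, 0) + 2 * (y \<mu>)\<^sup>2 * fu 1 ((y \<mu>)\<^sup>2, 0) \<noteq> 0"
    and "\<rho>1 > 0" and steady: "\<forall>\<^sub>F s in nhds \<mu>. \<forall>x v. v > 0 \<longrightarrow> \<bar>x - y \<mu>\<bar> < \<rho>1 \<longrightarrow> v < \<rho>1 \<longrightarrow>
      ((a1 s + f 1 (x\<^sup>2, v)) * x = 0 \<and> a3 s + f 3 (x\<^sup>2, v) = 0 \<longleftrightarrow> x = x' s \<and> v = v' s)"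
    and x': "isCont x' \<mu>" "x' \<mu> = y \<mu>" and v': "isCont v' \<mu>" "v' \<mu> = 0"
    and sign: "\<sigma> \<in> {-1, 1}" "\<forall>\<^sub>F s in nhds \<mu>. v' s > 0 \<longleftrightarrow> \<sigma> * (s - \<mu>) > 0"
  shows "andronov_hopf (\<lambda>s. nf_field f (a1 s, a2 s, a3 s)) \<mu> (\<lambda>s. eq_pt (y s)) (\<lambda>s. circ (x' s) (v' s))"
proof -
  define F where "F s = nf_field f (a1 s, a2 s, a3 s)" for s
  have bx: "((y \<mu>)\<^sup>2, 0) \<in> S" "f 4 ((y \<mu>)\<^sup>2, 0) > -1" using box[of "(y \<mu>)\<^sup>2" 0] y\<eta> eta_pos by auto
  have y\<eta>': "\<forall>\<^sub>F s in nhds \<mu>. (y s)\<^sup>2 < \<eta>"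
    using isCont_eventually_less[of \<mu> "\<lambda>s. (y s)\<^sup>2" "\<lambda>_. \<eta>"] y y\<eta> by simp
  then have inS: "\<forall>\<^sub>F s in nhds \<mu>. ((y s)\<^sup>2, 0) \<in> S"
    by eventually_elim (use box[of _ 0] eta_pos in auto)
  define l where "l s = Complex (a3 s + f 3 ((y s)\<^sup>2, 0)) (1 + f 4 ((y s)\<^sup>2, 0))" for s
  have "((\<lambda>s. f 4 ((y s)\<^sup>2, 0)) has_real_derivative fu 4 ((y \<mu>)\<^sup>2, 0) * u') (at \<mu>)"
    using DERIV_chain2[OF has_derivative_slice1[of 4 "(y \<mu>)\<^sup>2" 0] y2] bx(1) by simp
  then have "((\<lambda>s. 1 + f 4 ((y s)\<^sup>2, 0)) has_real_derivative fu 4 ((y \<mu>)\<^sup>2, 0) * u') (at \<mu>)"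
    by (auto intro!: derivative_eq_intros)
  then have dl: "(l has_vector_derivative Complex \<kappa> (fu 4 ((y \<mu>)\<^sup>2, 0) * u')) (at \<mu>)"
    unfolding l_def[abs_def] Complex_eq
    using k(1) by (intro has_vector_derivative_add has_vector_derivative_mult_right has_vector_derivative_of_real)
      (simp_all only: has_real_derivative_iff_has_vector_derivative)
  have ev: "\<forall>\<^sub>F s in nhds \<mu>. eigenvalue (jacobian_at (F s) (eq_pt (y s))) (l s)"
    using inS
  proof eventually_elim
    case (elim s)
    obtain s1 s2 where "complex_of_real (a2 s + f 2 ((y s)\<^sup>2, 0)) = s1 + s2"
      "complex_of_real (- (a1 s + f 1 ((y s)\<^sup>2, 0) + 2 * (y s)\<^sup>2 * fu 1 ((y s)\<^sup>2, 0))) = s1 * s2"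
      by (rule quadratic_complex_roots)
    from eigenvalue_block4[OF charpoly_eq_pt[OF elim this]] show ?case by (simp add: F_def l_def)
  qed
  obtain s1 s2 where s12: "complex_of_real (a2 \<mu> + f 2 ((y \<mu>)\<^sup>2, 0)) = s1 + s2"
      "complex_of_real (- (a1 \<mu> + f 1 ((y \<mu>)\<^sup>2, 0) + 2 * (y \<mu>)\<^sup>2 * fu 1 ((y \<mu>)\<^sup>2, 0))) = s1 * s2"
      "Re s1 \<noteq> 0" "Re s2 \<noteq> 0"
    by (rule quadratic_roots_off_axis[OF less_imp_neq[OF b] c])
  define \<omega> where "\<omega> = 1 + f 4 ((y \<mu>)\<^sup>2, 0)"
  have \<omega>: "\<omega> > 0" using bx(2) by (simp add: \<omega>_def)
  have l\<mu>: "l \<mu> = \<i> * complex_of_real \<omega>" by (simp add: l_def k(3) \<omega>_def complex_eq_iff)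
  have cp: "charpoly (jacobian_at (F \<mu>) (eq_pt (y \<mu>))) = ([:- s1, 1:] * [:- s2, 1:]) * ([:- l \<mu>, 1:] * [:- cnj (l \<mu>), 1:])"
    using charpoly_eq_pt[OF bx(1) s12(1,2), of "a3 \<mu>"] by (simp add: F_def l_def complex_cnj)
  have ord: "order (l \<mu>) (charpoly (jacobian_at (F \<mu>) (eq_pt (y \<mu>)))) = 1"
    unfolding cp order_four_factors using s12(3,4) \<omega> by (auto simp: l\<mu> complex_eq_iff)
  have hyp: "z = l \<mu> \<or> z = cnj (l \<mu>)" if "eigenvalue (jacobian_at (F \<mu>) (eq_pt (y \<mu>))) z" "Re z = 0" for z
    using that s12(3,4) unfolding eigenvalue_block4[OF cp] by auto
  have F0: "\<forall>\<^sub>F s in nhds \<mu>. F s (eq_pt (y s)) = 0 \<and> F s differentiable (at (eq_pt (y s)))"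
    using inS eq
  proof eventually_elim
    case (elim s)
    then show ?case using jacobian_eq_pt(1)[OF elim(1)] by (simp add: F_def vec_eq_iff forall_4 nf_field_nth)
  qed
  have ce: "isCont (\<lambda>s. eq_pt (y s)) \<mu>"
  proof -
    have "((\<lambda>s. eq_pt (y s)) \<longlongrightarrow> eq_pt (y \<mu>)) (at \<mu>)"
    proof (rule vec_tendstoI)
      show "((\<lambda>s. eq_pt (y s) $ i) \<longlongrightarrow> eq_pt (y \<mu>) $ i) (at \<mu>)" for i :: 4
        using exhaust_4[of i] y by (auto simp: isCont_def)
    qed
    then show ?thesis by (simp add: isCont_def)
  qed
  have pqs: "a1 \<mu> + f 1 ((y \<mu>)\<^sup>2, 0) + 2 * (y \<mu>)\<^sup>2 * fu 1 ((y \<mu>)\<^sup>2, 0) \<noteq> 0 \<and> (0::real) = 0 \<and> a3 \<mu> + f 3 ((y \<mu>)\<^sup>2, 0) = 0 \<or>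
      y \<mu> = 0 \<and> a3 \<mu> + f 3 ((y \<mu>)\<^sup>2, 0) + 0 * fv 3 ((y \<mu>)\<^sup>2, 0) \<noteq> 0"
    using c k(3) by simp
  have y0: "y \<mu> = 0 \<or> (0::real) = 0" by simp
  from periodic_orbits_near[OF bx b y0 pqs] obtain \<rho>0 where "\<rho>0 > 0" and
    \<rho>0: "\<forall>\<rho> \<alpha>1 \<alpha>2 \<alpha>3. 0 < \<rho> \<longrightarrow> \<rho> \<le> \<rho>0 \<longrightarrow>
    \<bar>\<alpha>1 - a1 \<mu>\<bar> < \<rho>0 \<longrightarrow> \<bar>\<alpha>2 - a2 \<mu>\<bar> < \<rho>0 \<longrightarrow> \<bar>\<alpha>3 - a3 \<mu>\<bar> < \<rho>0 \<longrightarrow>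
    {D. periodic_orbit (nf_field f (\<alpha>1, \<alpha>2, \<alpha>3)) D \<and> D \<subseteq> tube \<rho> (y \<mu>) 0} =
    {circ x v | x v. v > 0 \<and> \<bar>x - y \<mu>\<bar> < \<rho> \<and> \<bar>v - 0\<bar> < \<rho> \<and>
      (\<alpha>1 + f 1 (x\<^sup>2, v)) * x = 0 \<and> \<alpha>3 + f 3 (x\<^sup>2, v) = 0}"
    by (elim exE conjE) (rule that)
  define \<rho> where "\<rho> = min \<rho>0 \<rho>1"
  have \<rho>: "\<rho> > 0" "\<rho> \<le> \<rho>0" "\<rho> \<le> \<rho>1" using \<open>\<rho>0 > 0\<close> \<open>\<rho>1 > 0\<close> by (auto simp: \<rho>_def)
  have orbits: "\<forall>\<^sub>F s in nhds \<mu>. {D. periodic_orbit (F s) D \<and> D \<subseteq> tube \<rho> (y \<mu>) 0} =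
    (if \<sigma> * (s - \<mu>) > 0 then {circ (x' s) (v' s)} else {})"
    using isCont_eventually_close[OF cont(1) \<open>\<rho>0 > 0\<close>] isCont_eventually_close[OF cont(2) \<open>\<rho>0 > 0\<close>]
      isCont_eventually_close[OF cont(3) \<open>\<rho>0 > 0\<close>] isCont_eventually_close[OF x'(1) \<rho>(1)]
      isCont_eventually_close[OF v'(1) \<rho>(1)] steady sign(2)
  proof eventually_elim
    case (elim s)
    have st: "(a1 s + f 1 (x\<^sup>2, v)) * x = 0 \<and> a3 s + f 3 (x\<^sup>2, v) = 0 \<longleftrightarrow> x = x' s \<and> v = v' s"
      if "v > 0" "\<bar>x - y \<mu>\<bar> < \<rho>" "\<bar>v - 0\<bar> < \<rho>" for x v
      using elim(6) that \<rho>(3) by auto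
    have "{circ x v | x v. v > 0 \<and> \<bar>x - y \<mu>\<bar> < \<rho> \<and> \<bar>v - 0\<bar> < \<rho> \<and>
      (a1 s + f 1 (x\<^sup>2, v)) * x = 0 \<and> a3 s + f 3 (x\<^sup>2, v) = 0} =
      {circ x v | x v. v > 0 \<and> \<bar>x - y \<mu>\<bar> < \<rho> \<and> \<bar>v - 0\<bar> < \<rho> \<and> x = x' s \<and> v = v' s}"
      using st by blast
    also have "\<dots> = (if \<sigma> * (s - \<mu>) > 0 then {circ (x' s) (v' s)} else {})"
      using elim(4,5,7) x'(2) v'(2) by auto
    finally show ?case
      unfolding F_def \<rho>0[rule_format, OF \<rho>(1,2) elim(1-3)] .
  qed
  have sub: "\<forall>\<^sub>F s in nhds \<mu>. \<sigma> * (s - \<mu>) > 0 \<longrightarrow> circ (x' s) (v' s) \<subseteq> V" if "open V" "eq_pt (y \<mu>) \<in> V" for V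
  proof -
    have "circ (y \<mu>) 0 \<subseteq> V" using that(2) by (simp add: circ_zero)
    from tube_neighbourhood[OF that(1) this] obtain r where "r > 0" and r: "tube r (y \<mu>) 0 \<subseteq> V" by blast
    show ?thesis
      using isCont_eventually_close[OF x'(1) \<open>r > 0\<close>] isCont_eventually_close[OF v'(1) \<open>r > 0\<close>] sign(2)
    proof eventually_elim
      case (elim s)
      show ?case
      proof
        assume "\<sigma> * (s - \<mu>) > 0"
        then have "circ (x' s) (v' s) \<subseteq> tube r (y \<mu>) 0"
          using circ_subset_tube[of "v' s" r "x' s" "y \<mu>" 0] elim \<open>r > 0\<close> x'(2) v'(2) by simp
        then show "circ (x' s) (v' s) \<subseteq> V" using r by (rule subset_trans)
      qed
    qed
  qed
  have tin: "eq_pt (y \<mu>) \<in> tube \<rho> (y \<mu>) 0" using \<rho>(1) by (simp add: tube_def rad2_def)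
  have crossing: "\<exists>\<omega> l d. \<omega> > 0 \<and> l \<mu> = \<i> * complex_of_real \<omega> \<and>
      (l has_vector_derivative d) (at \<mu>) \<and> Re d \<noteq> 0 \<and>
      (\<forall>\<^sub>F s in nhds \<mu>. eigenvalue (jacobian_at (F s) (eq_pt (y s))) (l s)) \<and>
      order (l \<mu>) (charpoly (jacobian_at (F \<mu>) (eq_pt (y \<mu>)))) = 1 \<and>
      (\<forall>z. eigenvalue (jacobian_at (F \<mu>) (eq_pt (y \<mu>))) z \<and> Re z = 0 \<longrightarrow> z = l \<mu> \<or> z = cnj (l \<mu>))"
    by (rule exI[of _ \<omega>], rule exI[of _ l], rule exI[of _ "Complex \<kappa> (fu 4 ((y \<mu>)\<^sup>2, 0) * u')"],
        intro conjI \<omega> l\<mu> dl ev ord) (use k(2) hyp in auto)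
  show ?thesis
    unfolding andronov_hopf_def F_def[symmetric]
    by (intro conjI ce F0 crossing bexI[OF _ sign(1)] exI[of _ "tube \<rho> (y \<mu>) 0"] open_tube tin orbits allI impI)
      (use sub in blast)
qed

end

section \<open>The primary Hopf bifurcation and the two secondary bifurcations\<close>

context mode_branches
begin

lemma f_small:
  assumes "j \<in> {1..4}" "\<epsilon> > 0"
  shows "\<exists>e>0. \<forall>u v. \<bar>u\<bar> < e \<longrightarrow> \<bar>v\<bar> < e \<longrightarrow> \<bar>f j (u, v)\<bar> < \<epsilon>"
proof -
  have "open (S \<inter> f j -` {-\<epsilon><..<\<epsilon>})" using cont_f[OF assms(1)] open_S by (intro continuous_open_preimage) auto
  moreover have "(0, 0) \<in> S \<inter> f j -` {-\<epsilon><..<\<epsilon>}" using zero_S f_zero[OF assms(1)] assms(2) by simp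
  ultimately obtain e where "e > 0" "\<And>u v. \<bar>u\<bar> < e \<Longrightarrow> \<bar>v\<bar> < e \<Longrightarrow> (u, v) \<in> S \<inter> f j -` {-\<epsilon><..<\<epsilon>}"
    using open_contains_box by metis
  moreover have "\<bar>r\<bar> < \<epsilon>" if "r \<in> {-\<epsilon><..<\<epsilon>}" for r using that by auto
  ultimately show ?thesis by (metis IntD2 vimageD)
qed

lemma m_path:
  assumes a: "(a1 has_real_derivative d1) (at \<mu>)" "(a3 has_real_derivative d3) (at \<mu>)"
    and \<mu>: "\<bar>a1 \<mu>\<bar> < \<delta>" "\<bar>a3 \<mu>\<bar> < \<delta>"
  defines "z \<equiv> m (a1 \<mu>, a3 \<mu>)"
  shows "((\<lambda>s. fst (m (a1 s, a3 s))) has_real_derivative (d3 * fv 1 z - d1 * fv 3 z) / jac z) (at \<mu>)"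
    "((\<lambda>s. snd (m (a1 s, a3 s))) has_real_derivative (d1 * fu 3 z - d3 * fu 1 z) / jac z) (at \<mu>)"
proof -
  have "((\<lambda>s. (a1 s, a3 s)) has_derivative (\<lambda>t. (d1 * t, d3 * t))) (at \<mu>)"
    using a unfolding has_field_derivative_def by (rule has_derivative_Pair)
  from has_derivative_compose[OF this m_deriv[OF \<mu>]]
  have D: "((\<lambda>s. m (a1 s, a3 s)) has_derivative (\<lambda>t. inv_jac z (d1 * t, d3 * t))) (at \<mu>)" by (simp add: z_def)
  show "((\<lambda>s. fst (m (a1 s, a3 s))) has_real_derivative (d3 * fv 1 z - d1 * fv 3 z) / jac z) (at \<mu>)"
    unfolding has_field_derivative_def
    by (rule has_derivative_eq_rhs[OF has_derivative_fst[OF D]]) (simp add: inv_jac_def fun_eq_iff algebra_simps)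
  show "((\<lambda>s. snd (m (a1 s, a3 s))) has_real_derivative (d1 * fu 3 z - d3 * fu 1 z) / jac z) (at \<mu>)"
    unfolding has_field_derivative_def
    by (rule has_derivative_eq_rhs[OF has_derivative_snd[OF D]]) (simp add: inv_jac_def fun_eq_iff algebra_simps)
qed

lemma eventually_param:
  fixes a :: "real \<Rightarrow> real"
  assumes "isCont a \<mu>" "\<bar>a \<mu>\<bar> < \<delta>"
  shows "\<forall>\<^sub>F s in nhds \<mu>. \<bar>a s\<bar> < \<delta>"
  using isCont_eventually_less[of \<mu> "\<lambda>s. \<bar>a s\<bar>" "\<lambda>_. \<delta>"] assms by simp

text \<open>Near the origin \<open>a1 \<mu> \<noteq> 0\<close> dominates \<open>f 1\<close>, so a
  steady circle must have x = 0, and then its v is given by \<open>h\<close>. The cycle exists on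
  the side where \<open>h\<close> is positive.\<close>

lemma hopf_at_origin:
  assumes a1: "(a1 has_real_derivative d1) (at \<mu>)" and a2: "(a2 has_real_derivative d2) (at \<mu>)"
    and a3: "(a3 has_real_derivative d3) (at \<mu>)"
    and \<mu>: "a3 \<mu> = 0" "d3 \<noteq> 0" "a1 \<mu> \<noteq> 0" "a2 \<mu> < 0"
  shows "andronov_hopf (\<lambda>s. nf_field f (a1 s, a2 s, a3 s)) \<mu> (\<lambda>_. 0) (\<lambda>s. circ 0 (h (a3 s)))"
proof -
  have j: "1 \<in> {1..4::nat}" "2 \<in> {1..4::nat}" "3 \<in> {1..4::nat}" by auto
  have c: "isCont a1 \<mu>" "isCont a2 \<mu>" "isCont a3 \<mu>" using a1 a2 a3 DERIV_isCont by blast+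
  obtain e where e: "e > 0" "\<And>u v. \<bar>u\<bar> < e \<Longrightarrow> \<bar>v\<bar> < e \<Longrightarrow> \<bar>f 1 (u, v)\<bar> < \<bar>a1 \<mu>\<bar> / 2"
    using f_small[OF j(1), of "\<bar>a1 \<mu>\<bar> / 2"] \<mu>(3) by auto
  \<comment> \<open>The bound 1 gives x^2 \<le> |x|, so that \<open>e\<close> controls both
    arguments of \<open>f 1\<close>; the bound \<open>\<eta>\<close> keeps v where \<open>h\<close>
    is the unique solution.\<close>
  define \<rho>1 where "\<rho>1 = Min {1, e, \<eta>}"
  have \<rho>1: "\<rho>1 > 0" "\<rho>1 \<le> 1" "\<rho>1 \<le> e" "\<rho>1 \<le> \<eta>" using e(1) eta_pos by (auto simp: \<rho>1_def)
  have small3: "\<forall>\<^sub>F s in nhds \<mu>. \<bar>a3 s\<bar> < \<delta>" by (rule eventually_param[OF c(3)]) (use \<mu> delta_pos in simp)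
  have near1: "\<forall>\<^sub>F s in nhds \<mu>. \<bar>a1 s - a1 \<mu>\<bar> < \<bar>a1 \<mu>\<bar> / 2" using isCont_eventually_close[OF c(1), of "\<bar>a1 \<mu>\<bar> / 2"] \<mu>(3) by simp
  have steady: "\<forall>\<^sub>F s in nhds \<mu>. \<forall>x v. v > 0 \<longrightarrow> \<bar>x - 0\<bar> < \<rho>1 \<longrightarrow> v < \<rho>1 \<longrightarrow>
      ((a1 s + f 1 (x\<^sup>2, v)) * x = 0 \<and> a3 s + f 3 (x\<^sup>2, v) = 0 \<longleftrightarrow> x = 0 \<and> v = h (a3 s))"
    using small3 near1
  proof eventually_elim
    case (elim s)
    show ?case
    proof (intro allI impI)
      fix x v :: real assume v: "v > 0" "\<bar>x - 0\<bar> < \<rho>1" "v < \<rho>1"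
      have "x\<^sup>2 \<le> \<bar>x\<bar>" using v \<rho>1(2) power_decreasing[of 1 2 "\<bar>x\<bar>"] by simp
      then have "\<bar>x\<^sup>2\<bar> < e" "\<bar>v\<bar> < e" using v \<rho>1(3) by auto
      from e(2)[OF this] have "a1 s + f 1 (x\<^sup>2, v) \<noteq> 0" using elim(2) by linarith
      then show "(a1 s + f 1 (x\<^sup>2, v)) * x = 0 \<and> a3 s + f 3 (x\<^sup>2, v) = 0 \<longleftrightarrow> x = 0 \<and> v = h (a3 s)"
        using h_unique[OF elim(1), of v] v \<rho>1(4) by auto
    qed
  qed
  have hc: "isCont (\<lambda>s. h (a3 s)) \<mu>"
    using DERIV_isCont[OF h_deriv[of "a3 \<mu>"]] \<mu>(1) delta_pos c(3) by (intro isCont_o2[of \<mu> a3 h]) auto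
  define d where "d = - d3 / fv 3 (0, 0)"
  have dnz: "d \<noteq> 0" using \<mu>(2) nondeg(2) by (simp add: d_def)
  have "((\<lambda>s. - a3 s / fv 3 (0, 0)) has_real_derivative d) (at \<mu>)"
    unfolding d_def by (intro DERIV_cdivide DERIV_minus a3)
  from transversal_sign[OF this _ dnz] have "\<forall>\<^sub>F s in nhds \<mu>. - a3 s / fv 3 (0, 0) > 0 \<longleftrightarrow> sgn d * (s - \<mu>) > 0"
    using \<mu>(1) by simp
  with small3 have sign: "\<forall>\<^sub>F s in nhds \<mu>. h (a3 s) > 0 \<longleftrightarrow> sgn d * (s - \<mu>) > 0"
    by eventually_elim (simp add: h_pos)
  have "andronov_hopf (\<lambda>s. nf_field f (a1 s, a2 s, a3 s)) \<mu> (\<lambda>s. eq_pt 0) (\<lambda>s. circ 0 (h (a3 s)))"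
  proof (rule andronov_hopf_generic[OF c _ _ _ _ _ \<mu>(2) _ _ _ \<rho>1(1) steady _ _ hc _ _ sign])
    show "((\<lambda>s. 0\<^sup>2) has_real_derivative 0) (at \<mu>)" by simp
    show "((\<lambda>s. a3 s + f 3 (0\<^sup>2, 0)) has_real_derivative d3) (at \<mu>)"
      using a3 f_zero[OF j(3)] by simp
    show "sgn d \<in> {-1, 1}" using dnz by (auto simp: sgn_if)
  qed (use \<mu> eta_pos f_zero[OF j(1)] f_zero[OF j(2)] f_zero[OF j(3)] zero_values in auto)
  then show ?thesis by simp
qed

text \<open>The speed of the critical pair along P and the derivative of the component r^2 of the
  mixed mode are nonzero multiples of each other, so transversality in parameter space is the
  eigenvalue condition. Because \<open>a1 + f 1\<close> vanishes on P, the determinant of the y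
  block is \<open>- 2 * q * fu 1 (q, 0)\<close>, which is nonzero.\<close>

lemma hopf_at_P:
  assumes a1: "(a1 has_real_derivative d1) (at \<mu>)" and a2: "(a2 has_real_derivative d2) (at \<mu>)"
    and a3: "(a3 has_real_derivative d3) (at \<mu>)"
    and \<mu>: "\<bar>a1 \<mu>\<bar> < \<delta>" "\<bar>a3 \<mu>\<bar> < \<delta>" and b: "a2 \<mu> + f 2 (p (a1 \<mu>), 0) < 0"
    and m\<mu>: "fst (m (a1 \<mu>, a3 \<mu>)) > 0" "snd (m (a1 \<mu>, a3 \<mu>)) = 0"
    and d: "((\<lambda>s. snd (m (a1 s, a3 s))) has_real_derivative d) (at \<mu>)" "d \<noteq> 0"
    and \<tau>: "\<tau> \<in> {-1, 1}"
  shows "andronov_hopf (\<lambda>s. nf_field f (a1 s, a2 s, a3 s)) \<mu> (\<lambda>s. eq_pt (\<tau> * sqrt (p (a1 s))))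
    (\<lambda>s. circ (\<tau> * sqrt (fst (m (a1 s, a3 s)))) (snd (m (a1 s, a3 s))))"
proof -
  have j: "1 \<in> {1..4::nat}" "2 \<in> {1..4::nat}" "3 \<in> {1..4::nat}" by auto
  have c: "isCont a1 \<mu>" "isCont a2 \<mu>" "isCont a3 \<mu>" using a1 a2 a3 DERIV_isCont by blast+
  define q where "q = p (a1 \<mu>)"
  have mq: "fst (m (a1 \<mu>, a3 \<mu>)) = q" using m_snd_zero[OF \<mu> m\<mu>(2)] by (simp add: q_def)
  have meq: "m (a1 \<mu>, a3 \<mu>) = (q, 0)" using mq m\<mu>(2) by (metis prod.collapse)
  have q: "q > 0" "q < \<eta>" using mq m\<mu>(1) p[OF \<mu>(1)] by (auto simp: q_def)
  have bx: "(q, 0) \<in> S" "fu 1 (q, 0) \<noteq> 0" "jac (q, 0) \<noteq> 0" using box[of q 0] q eta_pos by auto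
  have \<tau>2: "\<tau> * \<tau> = 1" "\<bar>\<tau>\<bar> = 1" using \<tau> by auto
  define y where "y s = \<tau> * sqrt (p (a1 s))" for s
  define x' where "x' s = \<tau> * sqrt (fst (m (a1 s, a3 s)))" for s
  define v' where "v' s = snd (m (a1 s, a3 s))" for s
  have y\<mu>: "(y \<mu>)\<^sup>2 = q" "\<bar>y \<mu>\<bar> = sqrt q" using q \<tau> by (auto simp: y_def q_def power_mult_distrib abs_mult)
  have dp: "((\<lambda>s. p (a1 s)) has_real_derivative - 1 / fu 1 (q, 0) * d1) (at \<mu>)"
    using DERIV_chain2[OF p_deriv[OF \<mu>(1)] a1] by (simp add: q_def)
  have cp: "isCont (\<lambda>s. p (a1 s)) \<mu>" using DERIV_isCont[OF dp] .
  have p_pos_ev: "\<forall>\<^sub>F s in nhds \<mu>. p (a1 s) > 0"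
    using isCont_eventually_less[of \<mu> "\<lambda>_. 0" "\<lambda>s. p (a1 s)"] cp q(1) by (simp add: q_def)
  have small: "\<forall>\<^sub>F s in nhds \<mu>. \<bar>a1 s\<bar> < \<delta>" "\<forall>\<^sub>F s in nhds \<mu>. \<bar>a3 s\<bar> < \<delta>"
    using eventually_param c \<mu> by blast+
  have y2_ev: "\<forall>\<^sub>F s in nhds \<mu>. (y s)\<^sup>2 = p (a1 s)"
    using p_pos_ev by eventually_elim (use \<tau> in \<open>auto simp: y_def power_mult_distrib\<close>)
  have y2: "((\<lambda>s. (y s)\<^sup>2) has_real_derivative - 1 / fu 1 (q, 0) * d1) (at \<mu>)"
    using dp DERIV_cong_ev[OF refl y2_ev refl] by blast
  define \<kappa> where "\<kappa> = d3 + fu 3 (q, 0) * (- 1 / fu 1 (q, 0) * d1)"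
  have k: "((\<lambda>s. a3 s + f 3 ((y s)\<^sup>2, 0)) has_real_derivative \<kappa>) (at \<mu>)"
    unfolding \<kappa>_def using DERIV_chain2[OF has_derivative_slice1[OF j(3)] y2, of 0] bx(1) y\<mu>(1)
    by (intro DERIV_add a3) simp
  \<comment> \<open>Comparing with the chain rule for \<open>m\<close> identifies
    \<open>d * jac (q, 0)\<close> as \<open>- \<kappa> * fu 1 (q, 0)\<close>.\<close>
  have "d = (d1 * fu 3 (q, 0) - d3 * fu 1 (q, 0)) / jac (q, 0)"
    using DERIV_unique[OF d(1) m_path(2)[OF a1 a3 \<mu>]] by (simp add: meq)
  also have "d1 * fu 3 (q, 0) - d3 * fu 1 (q, 0) = - \<kappa> * fu 1 (q, 0)" using bx(2) by (simp add: \<kappa>_def algebra_simps)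
  finally have \<kappa>: "\<kappa> \<noteq> 0" using d(2) by auto
  \<comment> \<open>\<open>sqrt q\<close> keeps x on the side of zero selected by
    \<open>\<tau>\<close>, \<open>sqrt \<eta> - sqrt q\<close> keeps x^2 below
    \<open>\<eta>\<close>, and \<open>\<eta>\<close> bounds v.\<close>
  define \<rho>1 where "\<rho>1 = Min {sqrt q, sqrt \<eta> - sqrt q, \<eta>}"
  have \<rho>1: "\<rho>1 > 0" "\<rho>1 \<le> sqrt q" "\<rho>1 \<le> sqrt \<eta> - sqrt q" "\<rho>1 \<le> \<eta>" using q eta_pos by (auto simp: \<rho>1_def)
  have cm: "isCont (\<lambda>s. fst (m (a1 s, a3 s))) \<mu>" "isCont v' \<mu>"
    using DERIV_isCont[OF m_path(1)[OF a1 a3 \<mu>]] DERIV_isCont[OF m_path(2)[OF a1 a3 \<mu>]] by (simp_all add: v'_def[abs_def])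
  have m_pos: "\<forall>\<^sub>F s in nhds \<mu>. fst (m (a1 s, a3 s)) > 0"
    using isCont_eventually_less[of \<mu> "\<lambda>_. 0" "\<lambda>s. fst (m (a1 s, a3 s))"] cm(1) m\<mu>(1) by simp
  have steady: "\<forall>\<^sub>F s in nhds \<mu>. \<forall>x v. v > 0 \<longrightarrow> \<bar>x - y \<mu>\<bar> < \<rho>1 \<longrightarrow> v < \<rho>1 \<longrightarrow>
      ((a1 s + f 1 (x\<^sup>2, v)) * x = 0 \<and> a3 s + f 3 (x\<^sup>2, v) = 0 \<longleftrightarrow> x = x' s \<and> v = v' s)"
    using small m_pos
  proof eventually_elim
    case (elim s)
    show ?case
    proof (intro allI impI)
      fix x v :: real assume v: "v > 0" "\<bar>x - y \<mu>\<bar> < \<rho>1" "v < \<rho>1"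
      have "\<bar>\<tau> * x - \<tau> * y \<mu>\<bar> = \<bar>x - y \<mu>\<bar>" using \<tau> by auto
      moreover have "\<tau> * y \<mu> = sqrt q" using \<tau>2(1) by (simp add: y_def q_def flip: mult.assoc)
      ultimately have \<tau>x: "\<tau> * x > 0" using v(2) \<rho>1(2) by linarith
      have "\<bar>x\<bar> < sqrt \<eta>" using v(2) \<rho>1(3) y\<mu>(2) by linarith
      then have "\<bar>x\<bar>\<^sup>2 < (sqrt \<eta>)\<^sup>2" by (intro power_strict_mono) auto
      then have x2: "\<bar>x\<^sup>2\<bar> < \<eta>" using eta_pos by simp
      have "x \<noteq> 0" using \<tau>x by auto
      then have "(a1 s + f 1 (x\<^sup>2, v)) * x = 0 \<and> a3 s + f 3 (x\<^sup>2, v) = 0 \<longleftrightarrow> (x\<^sup>2, v) = m (a1 s, a3 s)"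
        using m_unique[OF elim(1,2) x2, of v] v \<rho>1(4) by auto
      also have "\<dots> \<longleftrightarrow> x\<^sup>2 = fst (m (a1 s, a3 s)) \<and> v = v' s" by (auto simp: v'_def prod_eq_iff)
      also have "x\<^sup>2 = fst (m (a1 s, a3 s)) \<longleftrightarrow> x = x' s"
      proof
        assume e: "x\<^sup>2 = fst (m (a1 s, a3 s))"
        have "x' s = \<tau> * \<bar>x\<bar>" by (simp add: x'_def flip: e)
        then show "x = x' s" using \<tau>x \<tau> by auto
      next
        assume "x = x' s"
        then show "x\<^sup>2 = fst (m (a1 s, a3 s))" using elim(3) \<tau> by (auto simp: x'_def power_mult_distrib)
      qed
      finally show "(a1 s + f 1 (x\<^sup>2, v)) * x = 0 \<and> a3 s + f 3 (x\<^sup>2, v) = 0 \<longleftrightarrow> x = x' s \<and> v = v' s" .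
    qed
  qed
  have dv: "(v' has_real_derivative d) (at \<mu>)" using d(1) by (simp add: v'_def[abs_def])
  have v\<mu>: "v' \<mu> = 0" using m\<mu>(2) by (simp add: v'_def)
  have "andronov_hopf (\<lambda>s. nf_field f (a1 s, a2 s, a3 s)) \<mu> (\<lambda>s. eq_pt (y s)) (\<lambda>s. circ (x' s) (v' s))"
  proof (rule andronov_hopf_generic[OF c _ y2 _ _ k \<kappa> _ _ _ \<rho>1(1) steady _ _ cm(2) v\<mu> _ transversal_sign[OF dv v\<mu> d(2)]])
    show "isCont y \<mu>" unfolding y_def by (intro continuous_intros cp)
    show "(y \<mu>)\<^sup>2 < \<eta>" using y\<mu> q by simp
    show "\<forall>\<^sub>F s in nhds \<mu>. (a1 s + f 1 ((y s)\<^sup>2, 0)) * y s = 0"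
      using small(1) y2_ev by eventually_elim (use p in auto)
    show "a3 \<mu> + f 3 ((y \<mu>)\<^sup>2, 0) = 0" using m[OF \<mu>] by (simp add: meq y\<mu>)
    show "a2 \<mu> + f 2 ((y \<mu>)\<^sup>2, 0) < 0" using b y\<mu> by (simp add: q_def)
    show "a1 \<mu> + f 1 ((y \<mu>)\<^sup>2, 0) + 2 * (y \<mu>)\<^sup>2 * fu 1 ((y \<mu>)\<^sup>2, 0) \<noteq> 0"
      using p[OF \<mu>(1)] q bx(2) by (simp add: y\<mu> flip: q_def)
    show "isCont x' \<mu>" unfolding x'_def by (intro continuous_intros cm(1))
    show "x' \<mu> = y \<mu>" using mq by (simp add: x'_def y_def q_def)
    show "sgn d \<in> {-1, 1}" using d(2) by (auto simp: sgn_if)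
  qed
  then show ?thesis by (simp add: y_def[abs_def] x'_def[abs_def] v'_def[abs_def])
qed

text \<open>The Floquet exponents of H1 in the y directions are the roots for trace
  \<open>b'\<close> and determinant \<open>- g\<close>. At \<open>\<mu>\<close> the multiplier 1
  occurs twice, once from the phase and once from the root that passes through zero; the other two
  multipliers are positive and different from 1, by the damping and by \<open>fv 3\<close>
  respectively. The new cycles have y1 equal to plus or minus the square root of the first
  mixed-mode component and are exchanged by the reflection.\<close>

lemma pitchfork_of_H:
  assumes a1: "(a1 has_real_derivative d1) (at \<mu>)" and a2: "(a2 has_real_derivative d2) (at \<mu>)"
    and a3: "(a3 has_real_derivative d3) (at \<mu>)"
    and \<mu>: "\<bar>a1 \<mu>\<bar> < \<delta>" "\<bar>a3 \<mu>\<bar> < \<delta>" and b: "a2 \<mu> + f 2 (0, h (a3 \<mu>)) < 0"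
    and m\<mu>: "fst (m (a1 \<mu>, a3 \<mu>)) = 0" "snd (m (a1 \<mu>, a3 \<mu>)) > 0"
    and d: "((\<lambda>s. fst (m (a1 s, a3 s))) has_real_derivative d) (at \<mu>)" "d \<noteq> 0"
  shows "pitchfork_of_cycles (\<lambda>s. nf_field f (a1 s, a2 s, a3 s)) y_flip \<mu> (\<lambda>s. circ 0 (h (a3 s)))
    (\<lambda>s. circ (1 * sqrt (fst (m (a1 s, a3 s)))) (snd (m (a1 s, a3 s))))
    (\<lambda>s. circ (- 1 * sqrt (fst (m (a1 s, a3 s)))) (snd (m (a1 s, a3 s))))"
proof -
  have j: "1 \<in> {1..4::nat}" "2 \<in> {1..4::nat}" "3 \<in> {1..4::nat}" "4 \<in> {1..4::nat}" by auto
  have c: "isCont a1 \<mu>" "isCont a2 \<mu>" "isCont a3 \<mu>" using a1 a2 a3 DERIV_isCont by blast+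
  define F where "F s = nf_field f (a1 s, a2 s, a3 s)" for s
  define H where "H s = h (a3 s)" for s
  define q where "q = H \<mu>"
  have mq: "snd (m (a1 \<mu>, a3 \<mu>)) = q" using m_fst_zero[OF \<mu> m\<mu>(1)] by (simp add: q_def H_def)
  have meq: "m (a1 \<mu>, a3 \<mu>) = (0, q)" using mq m\<mu>(1) by (metis prod.collapse)
  have q: "q > 0" "q < \<eta>" using mq m\<mu>(2) h[OF \<mu>(2)] by (auto simp: q_def H_def)
  have bx: "(0, q) \<in> S" "fv 3 (0, q) \<noteq> 0" "jac (0, q) \<noteq> 0" "f 4 (0, q) > -1" using box[of 0 q] q eta_pos by auto
  have small: "\<forall>\<^sub>F s in nhds \<mu>. \<bar>a1 s\<bar> < \<delta>" "\<forall>\<^sub>F s in nhds \<mu>. \<bar>a3 s\<bar> < \<delta>"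
    using eventually_param c \<mu> by blast+
  have dH: "(H has_real_derivative - 1 / fv 3 (0, q) * d3) (at \<mu>)"
    using DERIV_chain2[OF h_deriv[OF \<mu>(2)] a3] by (simp add: q_def H_def[abs_def])
  have cH: "isCont H \<mu>" using DERIV_isCont[OF dH] .
  have H_pos: "\<forall>\<^sub>F s in nhds \<mu>. H s > 0"
    using isCont_eventually_less[of \<mu> "\<lambda>_. 0" H] cH q(1) by (simp add: q_def)
  have Hs: "(0, H s) \<in> S \<and> f 4 (0, H s) > -1 \<and> fv 3 (0, H s) \<noteq> 0 \<and> a3 s + f 3 (0, H s) = 0" if "\<bar>a3 s\<bar> < \<delta>" for s
    using h[OF that] box[of 0 "H s"] eta_pos by (auto simp: H_def)
  have df: "((\<lambda>s. f i (0, H s)) has_real_derivative fv i (0, q) * (- 1 / fv 3 (0, q) * d3)) (at \<mu>)" if "i \<in> {1..4}" for i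
    using DERIV_chain2[OF has_derivative_slice2[OF that] dH, of 0] bx(1) by (simp add: q_def)
  define g b' T where "g s = a1 s + f 1 (0, H s)" and "b' s = a2 s + f 2 (0, H s)" and "T s = 2 * pi / (1 + f 4 (0, H s))" for s
  define g' where "g' = d1 + fv 1 (0, q) * (- 1 / fv 3 (0, q) * d3)"
  have dg: "(g has_real_derivative g') (at \<mu>)"
    unfolding g_def[abs_def] g'_def by (intro DERIV_add a1 df j)
  have db: "(b' has_real_derivative d2 + fv 2 (0, q) * (- 1 / fv 3 (0, q) * d3)) (at \<mu>)"
    unfolding b'_def[abs_def] by (intro DERIV_add a2 df j)
  have g\<mu>: "g \<mu> = 0" using m[OF \<mu>] by (simp add: g_def meq flip: q_def)
  have b\<mu>: "b' \<mu> < 0" using b by (simp add: b'_def H_def)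
  \<comment> \<open>As on P, the transversality of the mixed mode is a nonzero crossing speed:
    \<open>d * jac (0, q)\<close> equals \<open>- g' * fv 3 (0, q)\<close>.\<close>
  have "d = (d3 * fv 1 (0, q) - d1 * fv 3 (0, q)) / jac (0, q)"
    using DERIV_unique[OF d(1) m_path(1)[OF a1 a3 \<mu>]] by (simp add: meq)
  also have "d3 * fv 1 (0, q) - d1 * fv 3 (0, q) = - g' * fv 3 (0, q)" using bx(2) by (simp add: g'_def algebra_simps)
  finally have g': "g' \<noteq> 0" using d(2) by auto
  note root = quadratic_root_through_zero[OF db dg b\<mu> g\<mu>]
  define l where "l s = (b' s + sqrt ((b' s)\<^sup>2 + 4 * g s)) / 2" for s
  note root = root[folded l_def]
  have mono: "\<exists>M. monodromy (F s) (circ 0 (H s)) M \<and>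
    charpoly M = ([:- complex_of_real (exp (l s * T s)), 1:] * [:- complex_of_real (exp ((b' s - l s) * T s)), 1:]) *
      ([:- complex_of_real (exp (2 * H s * fv 3 (0, H s) * T s)), 1:] * [:- 1, 1:])"
    if "\<bar>a3 s\<bar> < \<delta>" "H s > 0" "(b' s)\<^sup>2 + 4 * g s > 0" for s
    using monodromy_circle[of "H s" "a3 s" "l s" "b' s - l s" "a2 s" "a1 s"] Hs[OF that(1)] that(2) root(4)[OF that(3)]
    by (simp add: F_def T_def g_def b'_def)
  have ev: "\<forall>\<^sub>F s in nhds \<mu>. \<exists>M. monodromy (F s) (circ 0 (H s)) M \<and> eigenvalue M (complex_of_real (exp (l s * T s)))"
    using small(2) H_pos root(3)
  proof eventually_elim
    case (elim s)
    from mono[OF this] eigenvalue_block4 show ?case by metis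
  qed
  have T\<mu>: "T \<mu> > 0" using bx(4) by (simp add: T_def flip: q_def)
  have dT: "(T has_real_derivative - (2 * pi * (fv 4 (0, q) * (- 1 / fv 3 (0, q) * d3))) / (1 + f 4 (0, q))\<^sup>2) (at \<mu>)"
    unfolding T_def[abs_def] using bx(4)
    by (auto intro!: derivative_eq_intros df[OF j(4)] simp: power2_eq_square simp flip: q_def)
  \<comment> \<open>As \<open>l \<mu> = 0\<close>, the variation of the period drops out of the
    product rule and only the speed of \<open>l\<close> remains.\<close>
  have dm: "((\<lambda>s. exp (l s * T s)) has_real_derivative - g' / b' \<mu> * T \<mu>) (at \<mu>)"
    by (rule DERIV_cong[OF DERIV_fun_exp[OF DERIV_mult[OF root(2) dT]]]) (simp add: root(1))
  have crossing: "\<exists>k d. k \<mu> = 1 \<and> (k has_real_derivative d) (at \<mu>) \<and> d \<noteq> 0 \<and>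
      (\<forall>\<^sub>F s in nhds \<mu>. \<exists>M. monodromy (F s) (circ 0 (H s)) M \<and> eigenvalue M (complex_of_real (k s)))"
    by (rule exI[of _ "\<lambda>s. exp (l s * T s)"], rule exI[of _ "- g' / b' \<mu> * T \<mu>"], intro conjI dm ev)
      (use root(1) g' b\<mu> T\<mu> in auto)
  have crit: "\<exists>M. monodromy (F \<mu>) (circ 0 (H \<mu>)) M \<and> order 1 (charpoly M) = 2 \<and>
      (\<forall>z. eigenvalue M z \<and> cmod z = 1 \<longrightarrow> z = 1)"
  proof -
    obtain M where M: "monodromy (F \<mu>) (circ 0 (H \<mu>)) M"
      "charpoly M = ([:- complex_of_real (exp (l \<mu> * T \<mu>)), 1:] * [:- complex_of_real (exp ((b' \<mu> - l \<mu>) * T \<mu>)), 1:]) *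
      ([:- complex_of_real (exp (2 * H \<mu> * fv 3 (0, H \<mu>) * T \<mu>)), 1:] * [:- 1, 1:])"
      using mono[of \<mu>] \<mu>(2) q(1) b\<mu> g\<mu> by (auto simp: q_def)
    have ne: "(b' \<mu> - l \<mu>) * T \<mu> \<noteq> 0" "2 * H \<mu> * fv 3 (0, H \<mu>) * T \<mu> \<noteq> 0"
      using b\<mu> T\<mu> root(1) bx(2) q(1) by (auto simp: q_def)
    have ord: "order 1 (charpoly M) = 2"
      unfolding M(2) order_four_factors using ne root(1) by (simp flip: of_real_exp)
    have one: "z = 1" if "eigenvalue M z" "cmod z = 1" for z
    proof -
      \<comment> \<open>All multipliers are positive real numbers, so one of modulus 1 equals
        1.\<close>
      have pos: "cmod (complex_of_real (exp r)) = exp r" for r using norm_of_real[of "exp r"] by (simp del: of_real_exp)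
      show ?thesis using that(1) that(2) ne root(1) unfolding eigenvalue_block4[OF M(2)]
        by (elim disjE) (simp_all only: pos exp_eq_one_iff, simp_all)
    qed
    show ?thesis using M(1) ord one by blast
  qed
  define M1 M2 where "M1 s = fst (m (a1 s, a3 s))" and "M2 s = snd (m (a1 s, a3 s))" for s
  have dM1: "(M1 has_real_derivative d) (at \<mu>)" using d(1) by (simp add: M1_def[abs_def])
  have M\<mu>: "M1 \<mu> = 0" "M2 \<mu> = q" using m\<mu> mq by (simp_all add: M1_def M2_def)
  have cM: "isCont (\<lambda>s. sqrt (M1 s)) \<mu>" "isCont M2 \<mu>"
    using DERIV_isCont[OF dM1] DERIV_isCont[OF m_path(2)[OF a1 a3 \<mu>]]
    by (auto intro!: continuous_intros simp: M2_def[abs_def])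
  define \<sigma> where "\<sigma> = sgn d"
  have \<sigma>: "\<sigma> \<in> {-1, 1}" using d(2) by (auto simp: \<sigma>_def sgn_if)
  have sign: "\<forall>\<^sub>F s in nhds \<mu>. M1 s > 0 \<longleftrightarrow> \<sigma> * (s - \<mu>) > 0"
    unfolding \<sigma>_def by (rule transversal_sign[OF dM1 M\<mu>(1) d(2)])
  have M2_pos: "\<forall>\<^sub>F s in nhds \<mu>. M2 s > 0"
    using isCont_eventually_less[of \<mu> "\<lambda>_. 0" M2] cM(2) q(1) M\<mu>(2) by simp
  have k\<mu>: "a3 \<mu> + f 3 (0, q) = 0" using Hs[OF \<mu>(2)] by (simp add: q_def)
  have w0: "f 4 (0\<^sup>2, q) > -1" "(0\<^sup>2, q) \<in> S" "a2 \<mu> + f 2 (0\<^sup>2, q) < 0" using bx b by (simp_all add: q_def H_def)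
  have pqs: "a1 \<mu> + f 1 (0\<^sup>2, q) + 2 * 0\<^sup>2 * fu 1 (0\<^sup>2, q) \<noteq> 0 \<and> q = 0 \<and> a3 \<mu> + f 3 (0\<^sup>2, q) = 0 \<or>
      (0::real) = 0 \<and> a3 \<mu> + f 3 (0\<^sup>2, q) + q * fv 3 (0\<^sup>2, q) \<noteq> 0"
    using k\<mu> bx(2) q(1) by simp
  have x0: "(0::real) = 0 \<or> q = 0" by simp
  from periodic_orbits_near[OF w0(2,1,3) x0 pqs] obtain \<rho>0 where "\<rho>0 > 0" and
    \<rho>0: "\<forall>\<rho> \<alpha>1 \<alpha>2 \<alpha>3. 0 < \<rho> \<longrightarrow> \<rho> \<le> \<rho>0 \<longrightarrow>
    \<bar>\<alpha>1 - a1 \<mu>\<bar> < \<rho>0 \<longrightarrow> \<bar>\<alpha>2 - a2 \<mu>\<bar> < \<rho>0 \<longrightarrow> \<bar>\<alpha>3 - a3 \<mu>\<bar> < \<rho>0 \<longrightarrow>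
    {D. periodic_orbit (nf_field f (\<alpha>1, \<alpha>2, \<alpha>3)) D \<and> D \<subseteq> tube \<rho> 0 q} =
    {circ x v | x v. v > 0 \<and> \<bar>x - 0\<bar> < \<rho> \<and> \<bar>v - q\<bar> < \<rho> \<and>
      (\<alpha>1 + f 1 (x\<^sup>2, v)) * x = 0 \<and> \<alpha>3 + f 3 (x\<^sup>2, v) = 0}"
    by (elim exE conjE) (rule that)
  \<comment> \<open>\<open>\<rho>0\<close> makes the description of the periodic orbits valid,
    \<open>sqrt \<eta>\<close> keeps x^2 in the box, and \<open>\<eta> - q\<close> does the same for
    v.\<close>
  define \<rho> where "\<rho> = Min {\<rho>0, sqrt \<eta>, \<eta> - q}"
  have \<rho>: "\<rho> > 0" "\<rho> \<le> \<rho>0" "\<rho> \<le> sqrt \<eta>" "\<rho> \<le> \<eta> - q" using \<open>\<rho>0 > 0\<close> eta_pos q by (auto simp: \<rho>_def)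
  have orbits: "\<forall>\<^sub>F s in nhds \<mu>. {D. periodic_orbit (F s) D \<and> D \<subseteq> tube \<rho> 0 q} =
    (if \<sigma> * (s - \<mu>) > 0 then {circ 0 (H s), circ (sqrt (M1 s)) (M2 s), circ (- sqrt (M1 s)) (M2 s)} else {circ 0 (H s)})"
    using isCont_eventually_close[OF c(1) \<open>\<rho>0 > 0\<close>] isCont_eventually_close[OF c(2) \<open>\<rho>0 > 0\<close>]
      isCont_eventually_close[OF c(3) \<open>\<rho>0 > 0\<close>] isCont_eventually_close[OF cM(1) \<rho>(1)]
      isCont_eventually_close[OF cM(2) \<rho>(1)] isCont_eventually_close[OF cH \<rho>(1)] small H_pos M2_pos sign
  proof eventually_elim
    case (elim s)
    have st: "(a1 s + f 1 (x\<^sup>2, v)) * x = 0 \<and> a3 s + f 3 (x\<^sup>2, v) = 0 \<longleftrightarrow>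
       x = 0 \<and> v = H s \<or> M1 s > 0 \<and> (x = sqrt (M1 s) \<or> x = - sqrt (M1 s)) \<and> v = M2 s"
      if v: "v > 0" "\<bar>x - 0\<bar> < \<rho>" "\<bar>v - q\<bar> < \<rho>" for x v
    proof -
      have "\<bar>x\<bar> < sqrt \<eta>" using v(2) \<rho>(3) by linarith
      then have "\<bar>x\<bar>\<^sup>2 < (sqrt \<eta>)\<^sup>2" by (intro power_strict_mono) auto
      then have x2: "\<bar>x\<^sup>2\<bar> < \<eta>" using eta_pos by simp
      have v\<eta>: "\<bar>v\<bar> < \<eta>" using v \<rho>(4) by linarith
      show ?thesis
      proof (cases "x = 0")
        case True
        then show ?thesis using h_unique[OF elim(8) v\<eta>] by (auto simp: H_def)
      next
        case False
        then have "(a1 s + f 1 (x\<^sup>2, v)) * x = 0 \<and> a3 s + f 3 (x\<^sup>2, v) = 0 \<longleftrightarrow> (x\<^sup>2, v) = m (a1 s, a3 s)"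
          using m_unique[OF elim(7,8) x2 v\<eta>] by auto
        also have "\<dots> \<longleftrightarrow> x\<^sup>2 = M1 s \<and> v = M2 s" by (auto simp: M1_def M2_def prod_eq_iff)
        also have "x\<^sup>2 = M1 s \<longleftrightarrow> M1 s > 0 \<and> (x = sqrt (M1 s) \<or> x = - sqrt (M1 s))"
        proof
          assume e: "x\<^sup>2 = M1 s"
          then have "M1 s > 0" using False by (metis zero_less_power2)
          moreover have "sqrt (M1 s) = \<bar>x\<bar>" by (simp flip: e)
          ultimately show "M1 s > 0 \<and> (x = sqrt (M1 s) \<or> x = - sqrt (M1 s))" by auto
        qed auto
        finally show ?thesis using False by auto
      qed
    qed
    define L where "L = {circ x v | x v. v > 0 \<and> \<bar>x - 0\<bar> < \<rho> \<and> \<bar>v - q\<bar> < \<rho> \<and>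
        (x = 0 \<and> v = H s \<or> M1 s > 0 \<and> (x = sqrt (M1 s) \<or> x = - sqrt (M1 s)) \<and> v = M2 s)}"
    have near: "\<bar>sqrt (M1 s)\<bar> < \<rho>" "\<bar>M2 s - q\<bar> < \<rho>" "\<bar>H s - q\<bar> < \<rho>"
      using elim(4,5,6) M\<mu> by (simp_all add: q_def)
    have "circ 0 (H s) \<in> L"
      using near elim(9) \<rho>(1) unfolding L_def by (intro CollectI exI[of _ 0] exI[of _ "H s"]) auto
    moreover have "circ (sqrt (M1 s)) (M2 s) \<in> L" if "M1 s > 0"
      using near elim(10) that unfolding L_def by (intro CollectI exI[of _ "sqrt (M1 s)"] exI[of _ "M2 s"]) auto
    moreover have "circ (- sqrt (M1 s)) (M2 s) \<in> L" if "M1 s > 0"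
      using near elim(10) that unfolding L_def by (intro CollectI exI[of _ "- sqrt (M1 s)"] exI[of _ "M2 s"]) auto
    ultimately have L: "L = (if M1 s > 0 then {circ 0 (H s), circ (sqrt (M1 s)) (M2 s), circ (- sqrt (M1 s)) (M2 s)} else {circ 0 (H s)})"
    proof (intro equalityI)
      show "L \<subseteq> (if M1 s > 0 then {circ 0 (H s), circ (sqrt (M1 s)) (M2 s), circ (- sqrt (M1 s)) (M2 s)} else {circ 0 (H s)})"
      proof
        fix D assume "D \<in> L"
        then obtain x v where "D = circ x v"
          "x = 0 \<and> v = H s \<or> M1 s > 0 \<and> (x = sqrt (M1 s) \<or> x = - sqrt (M1 s)) \<and> v = M2 s"
          unfolding L_def by blast
        then show "D \<in> (if M1 s > 0 then {circ 0 (H s), circ (sqrt (M1 s)) (M2 s), circ (- sqrt (M1 s)) (M2 s)} else {circ 0 (H s)})"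
          by auto
      qed
    qed simp
    have "{circ x v | x v. v > 0 \<and> \<bar>x - 0\<bar> < \<rho> \<and> \<bar>v - q\<bar> < \<rho> \<and>
      (a1 s + f 1 (x\<^sup>2, v)) * x = 0 \<and> a3 s + f 3 (x\<^sup>2, v) = 0} = L"
      unfolding L_def using st by blast
    also have "\<dots> = (if \<sigma> * (s - \<mu>) > 0 then {circ 0 (H s), circ (sqrt (M1 s)) (M2 s), circ (- sqrt (M1 s)) (M2 s)} else {circ 0 (H s)})"
      unfolding L elim(11) ..
    finally show ?case
      unfolding F_def \<rho>0[rule_format, OF \<rho>(1,2) elim(1-3)] .
  qed
  have sub: "\<forall>\<^sub>F s in nhds \<mu>. circ 0 (H s) \<subseteq> V \<and>
      (\<sigma> * (s - \<mu>) > 0 \<longrightarrow> circ (sqrt (M1 s)) (M2 s) \<subseteq> V \<and> circ (- sqrt (M1 s)) (M2 s) \<subseteq> V)"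
    if "open V" "circ 0 (H \<mu>) \<subseteq> V" for V
  proof -
    from tube_neighbourhood[OF that] obtain r where "r > 0" and r: "tube r 0 q \<subseteq> V" unfolding q_def by blast
    show ?thesis
      using isCont_eventually_close[OF cM(1) \<open>r > 0\<close>] isCont_eventually_close[OF cM(2) \<open>r > 0\<close>]
        isCont_eventually_close[OF cH \<open>r > 0\<close>] H_pos M2_pos
    proof eventually_elim
      case (elim s)
      have "circ 0 (H s) \<subseteq> tube r 0 q" "circ (sqrt (M1 s)) (M2 s) \<subseteq> tube r 0 q" "circ (- sqrt (M1 s)) (M2 s) \<subseteq> tube r 0 q"
        using elim M\<mu> \<open>r > 0\<close> circ_subset_tube[of "M2 s" r _ 0 q] circ_subset_tube[of "H s" r 0 0 q]
        by (simp_all flip: q_def)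
      then show ?case using subset_trans[OF _ r] by blast
    qed
  qed
  have orb: "\<forall>\<^sub>F s in nhds \<mu>. periodic_orbit (F s) (circ 0 (H s)) \<and> (\<forall>x\<in>circ 0 (H s). y_flip x = x)"
    using small(2) H_pos
  proof eventually_elim
    case (elim s)
    have "periodic_orbit (F s) (circ 0 (H s))"
      unfolding F_def using Hs[OF elim(1)] elim(2) by (intro periodic_orbit_circ) auto
    then show ?case by (auto simp: circ_def vec_eq_iff forall_4)
  qed
  have dist: "\<forall>\<^sub>F s in nhds \<mu>. \<sigma> * (s - \<mu>) > 0 \<longrightarrow>
      circ (sqrt (M1 s)) (M2 s) \<noteq> circ 0 (H s) \<and> circ (- sqrt (M1 s)) (M2 s) \<noteq> circ 0 (H s) \<and>
      circ (sqrt (M1 s)) (M2 s) \<noteq> circ (- sqrt (M1 s)) (M2 s) \<and> y_flip ` circ (sqrt (M1 s)) (M2 s) = circ (- sqrt (M1 s)) (M2 s)"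
    using sign M2_pos
  proof eventually_elim
    case (elim s)
    then show ?case using circ_eq_iff[of "M2 s"] by (auto simp: y_flip_circ)
  qed
  have sym: "symmetry_of F y_flip" unfolding F_def[abs_def] by (rule symmetry_of_y_flip)
  have tin: "circ 0 (H \<mu>) \<subseteq> tube \<rho> 0 q" using circ_subset_tube[of q \<rho> 0 0 q] q(1) \<rho>(1) by (simp flip: q_def)
  show ?thesis
    unfolding pitchfork_of_cycles_def F_def[symmetric] H_def[symmetric] M1_def[symmetric] M2_def[symmetric] mult_1 mult_minus1
    by (intro conjI sym orb crossing crit bexI[OF _ \<sigma>] exI[of _ "tube \<rho> 0 q"] open_tube tin orbits dist allI impI)
      (use sub in blast)
qed

end

section \<open>Loops around the axis\<close>

text \<open>At distance at least \<open>\<zeta>\<close> from its zeros the model wave is at least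
  \<open>K * sin \<zeta> \<ge> \<kappa>\<close> in modulus and fixes the sign of \<open>M\<close>;
  within \<open>\<zeta>\<close> of \<open>c\<close> its derivative is at least
  \<open>K * cos \<zeta> \<ge> \<kappa>\<close> and makes \<open>M\<close> strictly increasing. This
  leaves exactly one zero in the window, and a simple one.\<close>

lemma sine_like_zero:
  fixes M M' :: "real \<Rightarrow> real"
  assumes M: "\<And>t. (M has_real_derivative M' t) (at t)"
    and close: "\<And>t. \<bar>M t - K * sin (t - c)\<bar> < \<kappa>" "\<And>t. \<bar>M' t - K * cos (t - c)\<bar> < \<kappa>"
    and K: "K > 0" and \<zeta>: "0 < \<zeta>" "\<zeta> < pi / 2" and \<kappa>: "\<kappa> \<le> K * sin \<zeta>" "\<kappa> \<le> K * cos \<zeta>"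
  obtains z where "\<bar>z - c\<bar> < \<zeta>" "M z = 0" "M' z > 0"
    "\<And>t. z < t \<Longrightarrow> t \<le> c + pi - \<zeta> \<Longrightarrow> M t > 0" "\<And>t. c - pi + \<zeta> \<le> t \<Longrightarrow> t < z \<Longrightarrow> M t < 0"
proof -
  have sin_ge: "sin \<zeta> \<le> sin u" if "\<zeta> \<le> u" "u \<le> pi - \<zeta>" for u
  proof (cases "u \<le> pi / 2")
    case True
    then show ?thesis using that \<zeta> by (intro sin_monotone_2pi_le) auto
  next
    case False
    then have "sin \<zeta> \<le> sin (pi - u)" using that \<zeta> by (intro sin_monotone_2pi_le) auto
    then show ?thesis by simp
  qed
  have right: "M t > 0" if "c + \<zeta> \<le> t" "t \<le> c + pi - \<zeta>" for t
  proof -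
    have "K * sin \<zeta> \<le> K * sin (t - c)" using that K by (intro mult_left_mono sin_ge) auto
    then show ?thesis using close(1)[of t] \<kappa>(1) by linarith
  qed
  have left: "M t < 0" if "c - pi + \<zeta> \<le> t" "t \<le> c - \<zeta>" for t
  proof -
    have "K * sin \<zeta> \<le> K * sin (c - t)" using that K by (intro mult_left_mono sin_ge) auto
    moreover have "sin (t - c) = - sin (c - t)" using sin_minus[of "c - t"] by simp
    ultimately show ?thesis using close(1)[of t] \<kappa>(1) by simp
  qed
  have pos: "M' t > 0" if "\<bar>t - c\<bar> \<le> \<zeta>" for t
  proof -
    have "cos \<zeta> \<le> cos \<bar>t - c\<bar>" using that \<zeta> by (intro cos_monotone_0_pi_le) auto
    then have "K * cos \<zeta> \<le> K * cos (t - c)" using K by (simp add: mult_left_mono)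
    then show ?thesis using close(2)[of t] \<kappa>(2) by linarith
  qed
  have inc: "M s < M t" if "s < t" "c - \<zeta> \<le> s" "t \<le> c + \<zeta>" for s t
    using that M pos by (intro DERIV_pos_imp_increasing[OF \<open>s < t\<close>]) (auto intro!: exI)
  have ends: "M (c - \<zeta>) < 0" "M (c + \<zeta>) > 0" using left[of "c - \<zeta>"] right[of "c + \<zeta>"] \<zeta> by auto
  have "\<exists>z\<ge>c - \<zeta>. z \<le> c + \<zeta> \<and> M z = 0"
    using ends \<zeta> by (intro IVT') (auto intro!: continuous_at_imp_continuous_on DERIV_isCont[OF M])
  then obtain z where z: "c - \<zeta> \<le> z" "z \<le> c + \<zeta>" "M z = 0" by blast
  then have z': "c - \<zeta> < z" "z < c + \<zeta>" using ends by (auto simp: less_le)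
  show ?thesis
  proof (rule that)
    show "\<bar>z - c\<bar> < \<zeta>" using z' by auto
    show "M' z > 0" using pos[of z] z' by auto
    show "M t > 0" if "z < t" "t \<le> c + pi - \<zeta>" for t
      using inc[of z t] right[of t] that z z' by (cases "t \<le> c + \<zeta>") auto
    show "M t < 0" if "c - pi + \<zeta> \<le> t" "t < z" for t
      using inc[of t z] left[of t] that z z' by (cases "c - \<zeta> \<le> t") auto
  qed (fact z(3))
qed

lemma periodic_int:
  fixes M :: "real \<Rightarrow> 'a"
  assumes "\<And>t. M (t + 2 * pi) = M t"
  shows "M (t + 2 * pi * of_int k) = M t"
proof -
  have nat: "M (u + 2 * pi * real n) = M u" for n u
    by (induction n arbitrary: u) (use assms in \<open>simp_all add: distrib_left add.assoc[symmetric]\<close>)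
  show ?thesis
  proof (cases "k \<ge> 0")
    case True then show ?thesis using nat[of t "nat k"] by simp
  next
    case False then show ?thesis using nat[of "t + 2 * pi * of_int k" "nat (- k)"] by simp
  qed
qed

lemma window_shift:
  fixes t a :: real
  obtains k :: int where "a \<le> t + 2 * pi * of_int k" "t + 2 * pi * of_int k < a + 2 * pi"
proof -
  define k where "k = - \<lfloor>(t - a) / (2 * pi)\<rfloor>"
  have "of_int (- k) \<le> (t - a) / (2 * pi)" "(t - a) / (2 * pi) < of_int (- k) + 1"
    unfolding k_def by linarith+
  then have "of_int (- k) * (2 * pi) \<le> t - a" "t - a < (of_int (- k) + 1) * (2 * pi)"
    by (simp_all add: pos_le_divide_eq pos_divide_less_eq)
  then show ?thesis using that[of k] by (simp add: algebra_simps)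
qed

text \<open>Derivatives are included because the zeros of the perturbed functions must stay simple:
  their slopes are the transversality required by the secondary bifurcations.\<close>

definition C1_close_loop :: "real \<Rightarrow> (real \<Rightarrow> real) \<Rightarrow> (real \<Rightarrow> real) \<Rightarrow> (real \<Rightarrow> real) \<Rightarrow> (real \<Rightarrow> real) \<Rightarrow>
    (real \<Rightarrow> real) \<Rightarrow> (real \<Rightarrow> real) \<Rightarrow> (real \<Rightarrow> real) \<Rightarrow> (real \<Rightarrow> real) \<Rightarrow> bool" where
  "C1_close_loop \<kappa> A1 A1' A2 A2' M1 M1' M2 M2' \<longleftrightarrow>
    (\<forall>t. M1 (t + 2 * pi) = M1 t \<and> M2 (t + 2 * pi) = M2 t \<and>
      (M1 has_real_derivative M1' t) (at t) \<and> (M2 has_real_derivative M2' t) (at t) \<and>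
      \<bar>M1 t - A1 t\<bar> < \<kappa> \<and> \<bar>M1' t - A1' t\<bar> < \<kappa> \<and> \<bar>M2 t - A2 t\<bar> < \<kappa> \<and> \<bar>M2' t - A2' t\<bar> < \<kappa>)"

text \<open>The part of \<open>mixed_mode_joins\<close> that concerns the mixed mode alone. The open
  segment makes it independent of orientation, so \<open>tP\<close> may lie on either side of
  \<open>tH\<close>.\<close>

definition positive_arc :: "(real \<Rightarrow> real) \<Rightarrow> (real \<Rightarrow> real) \<Rightarrow> real \<Rightarrow> real \<Rightarrow> bool" where
  "positive_arc M1 M2 tP tH \<longleftrightarrow> tP \<noteq> tH \<and> \<bar>tP - tH\<bar> < pi \<and>
    (\<forall>t. M1 t > 0 \<and> M2 t > 0 \<longleftrightarrow> (\<exists>k::int. t + 2 * pi * of_int k \<in> open_segment tP tH)) \<and>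
    M1 tP > 0 \<and> M2 tP = 0 \<and> M1 tH = 0 \<and> M2 tH > 0"

text \<open>Modulo 2 pi, the first model wave is positive on the half period ending at
  \<open>H\<close> and the second on the half period starting at \<open>P\<close>. As 0 < H - P <
  pi, both are positive exactly between \<open>P\<close> and \<open>H\<close>, and a small
  perturbation moves the two zeros without changing their order.\<close>

lemma oriented_loop:
  fixes P H K1 K2 :: real
  assumes PH: "0 < H - P" "H - P < pi" and K: "K1 > 0" "K2 > 0"
  obtains \<kappa> where "\<kappa> > 0" "\<And>M1 M1' M2 M2'.
    C1_close_loop \<kappa> (\<lambda>t. K1 * sin (H - t)) (\<lambda>t. - K1 * cos (H - t))
      (\<lambda>t. K2 * sin (t - P)) (\<lambda>t. K2 * cos (t - P)) M1 M1' M2 M2' \<Longrightarrow>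
    \<exists>tP tH. tP < tH \<and> tH < tP + pi \<and>
      (\<forall>t. M1 t > 0 \<and> M2 t > 0 \<longleftrightarrow> (\<exists>k::int. tP < t + 2 * pi * of_int k \<and> t + 2 * pi * of_int k < tH)) \<and>
      M1 tP > 0 \<and> M2 tP = 0 \<and> M1 tH = 0 \<and> M2 tH > 0 \<and> M2' tP \<noteq> 0 \<and> M1' tH \<noteq> 0"
proof -
  \<comment> \<open>A third of the smaller gap, so that the intervals of radius
    \<open>\<zeta>\<close> around \<open>P\<close>, \<open>H\<close> and \<open>P + pi\<close> are
    disjoint with room left between them.\<close>
  define \<zeta> where "\<zeta> = min (H - P) (pi - (H - P)) / 3"
  have \<zeta>3: "\<zeta> > 0" "3 * \<zeta> \<le> H - P" "3 * \<zeta> \<le> pi - (H - P)" using PH by (auto simp: \<zeta>_def)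
  then have "\<zeta> < pi / 2" by linarith
  note \<zeta> = \<zeta>3(1) this \<zeta>3(2,3)
  have sc: "sin \<zeta> > 0" "cos \<zeta> > 0" using \<zeta> by (auto intro!: sin_gt_zero cos_gt_zero)
  define \<kappa> where "\<kappa> = Min {K1 * sin \<zeta>, K1 * cos \<zeta>, K2 * sin \<zeta>, K2 * cos \<zeta>}"
  have \<kappa>: "\<kappa> > 0" "\<kappa> \<le> K1 * sin \<zeta>" "\<kappa> \<le> K1 * cos \<zeta>" "\<kappa> \<le> K2 * sin \<zeta>" "\<kappa> \<le> K2 * cos \<zeta>"
    using K sc by (auto simp: \<kappa>_def)
  have "\<exists>tP tH. tP < tH \<and> tH < tP + pi \<and>
      (\<forall>t. M1 t > 0 \<and> M2 t > 0 \<longleftrightarrow> (\<exists>k::int. tP < t + 2 * pi * of_int k \<and> t + 2 * pi * of_int k < tH)) \<and>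
      M1 tP > 0 \<and> M2 tP = 0 \<and> M1 tH = 0 \<and> M2 tH > 0 \<and> M2' tP \<noteq> 0 \<and> M1' tH \<noteq> 0"
    if close: "C1_close_loop \<kappa> (\<lambda>t. K1 * sin (H - t)) (\<lambda>t. - K1 * cos (H - t))
      (\<lambda>t. K2 * sin (t - P)) (\<lambda>t. K2 * cos (t - P)) M1 M1' M2 M2'" for M1 M1' M2 M2'
  proof -
    note M = close[unfolded C1_close_loop_def]
    have per: "M1 (t + 2 * pi * of_int k) = M1 t" "M2 (t + 2 * pi * of_int k) = M2 t" for t k
      using M by (auto intro!: periodic_int)
    have sw: "sin (t - H) = - sin (H - t)" "cos (t - H) = cos (H - t)" for t
      using sin_minus[of "H - t"] cos_minus[of "H - t"] by simp_all
    have d1: "((\<lambda>t. - M1 t) has_real_derivative - M1' t) (at t)" for t using M by (intro DERIV_minus) blast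
    have c1: "\<bar>- M1 t - K1 * sin (t - H)\<bar> < \<kappa>" "\<bar>- M1' t - K1 * cos (t - H)\<bar> < \<kappa>" for t
    proof -
      have "\<bar>M1 t - K1 * sin (H - t)\<bar> < \<kappa>" "\<bar>M1' t - - K1 * cos (H - t)\<bar> < \<kappa>" using M by blast+
      then show "\<bar>- M1 t - K1 * sin (t - H)\<bar> < \<kappa>" "\<bar>- M1' t - K1 * cos (t - H)\<bar> < \<kappa>"
        unfolding sw by (simp_all add: abs_minus_commute)
    qed
    obtain tH where tH: "\<bar>tH - H\<bar> < \<zeta>" "- M1 tH = 0" "- M1' tH > 0"
      "\<And>t. tH < t \<Longrightarrow> t \<le> H + pi - \<zeta> \<Longrightarrow> - M1 t > 0" "\<And>t. H - pi + \<zeta> \<le> t \<Longrightarrow> t < tH \<Longrightarrow> - M1 t < 0"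
      using sine_like_zero[OF d1 c1 K(1) \<zeta>(1,2) \<kappa>(2,3)] by blast
    have d2: "(M2 has_real_derivative M2' t) (at t)" for t using M by blast
    have c2: "\<bar>M2 t - K2 * sin (t - P)\<bar> < \<kappa>" "\<bar>M2' t - K2 * cos (t - P)\<bar> < \<kappa>" for t using M by blast+
    obtain tP where tP: "\<bar>tP - P\<bar> < \<zeta>" "M2 tP = 0" "M2' tP > 0"
      "\<And>t. tP < t \<Longrightarrow> t \<le> P + pi - \<zeta> \<Longrightarrow> M2 t > 0" "\<And>t. P - pi + \<zeta> \<le> t \<Longrightarrow> t < tP \<Longrightarrow> M2 t < 0"
      using sine_like_zero[OF d2 c2 K(2) \<zeta>(1,2) \<kappa>(4,5)] by blast
    have P: "tP > P - \<zeta>" "tP < P + \<zeta>" and H: "tH > H - \<zeta>" "tH < H + \<zeta>" using tP(1) tH(1) by linarith+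
    have order: "tP < tH" "tH < tP + pi" using P H \<zeta> by linarith+
    have in_seg: "M1 t > 0 \<and> M2 t > 0" if "tP < t" "t < tH" for t
      using tH(5)[of t] tP(4)[of t] that P H \<zeta> by force
    \<comment> \<open>One full period, starting shortly after \<open>P - pi\<close>. To the left of
      \<open>tP\<close> the second function is negative; to the right of \<open>tH\<close> the first
      one is, because the window ends no later than \<open>H + pi - \<zeta>\<close>.\<close>
    have out: "tP < t \<and> t < tH" if "P - pi + \<zeta> \<le> t" "t < P - pi + \<zeta> + 2 * pi" "M1 t > 0" "M2 t > 0" for t
    proof -
      have "t \<noteq> tP" "\<not> t < tP" using tP(2) tP(5)[of t] that by auto
      moreover have "t \<noteq> tH" "\<not> tH < t" using tH(2) tH(4)[of t] that \<zeta> by auto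
      ultimately show ?thesis by linarith
    qed
    have iff: "M1 t > 0 \<and> M2 t > 0 \<longleftrightarrow> (\<exists>k::int. tP < t + 2 * pi * of_int k \<and> t + 2 * pi * of_int k < tH)" for t
    proof
      assume pos: "M1 t > 0 \<and> M2 t > 0"
      obtain k :: int where "P - pi + \<zeta> \<le> t + 2 * pi * of_int k" "t + 2 * pi * of_int k < P - pi + \<zeta> + 2 * pi"
        using window_shift by blast
      then show "\<exists>k::int. tP < t + 2 * pi * of_int k \<and> t + 2 * pi * of_int k < tH"
        using out[of "t + 2 * pi * of_int k"] pos per by auto
    next
      assume "\<exists>k::int. tP < t + 2 * pi * of_int k \<and> t + 2 * pi * of_int k < tH"
      then show "M1 t > 0 \<and> M2 t > 0" using in_seg per by metis
    qed
    have "M1 tP > 0" using tH(5)[of tP] P H \<zeta> by auto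
    moreover have "M2 tH > 0" using tP(4)[of tH] P H \<zeta> by auto
    ultimately show ?thesis
      using order iff tP(2,3) tH(2,3) by (intro exI[of _ tP] exI[of _ tH]) auto
  qed
  then show ?thesis by (rule that[OF \<kappa>(1)])
qed

text \<open>Polar coordinates for the columns of the matrix turn the linearized branch on the unit
  circle into two sine waves with phases \<open>H\<close> and \<open>P\<close>, and the determinant
  into the relation \<open>R1 * R2 * sin (H - P) = \<bar>\<Delta>\<bar>\<close>. So a nonzero
  determinant places \<open>H\<close> less than half a period after \<open>P\<close>. For negative
  \<open>\<Delta>\<close> the loop is traversed backwards, by replacing t with
  \<open>s * t\<close>.\<close>

lemma loop_around_axis:
  fixes a b c d :: real
  assumes \<Delta>: "a * d - c * b \<noteq> 0"
  defines "\<Delta> \<equiv> a * d - c * b"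
  obtains \<kappa> where "\<kappa> > 0" "\<And>M1 M1' M2 M2'. C1_close_loop \<kappa>
      (\<lambda>t. (sin t * b - cos t * d) / \<Delta>) (\<lambda>t. (cos t * b + sin t * d) / \<Delta>)
      (\<lambda>t. (cos t * c - sin t * a) / \<Delta>) (\<lambda>t. (- sin t * c - cos t * a) / \<Delta>) M1 M1' M2 M2' \<Longrightarrow>
    \<exists>tP tH. positive_arc M1 M2 tP tH \<and> M2' tP \<noteq> 0 \<and> M1' tH \<noteq> 0"
proof -
  have Dn: "\<Delta> \<noteq> 0" using \<Delta> by (simp add: \<Delta>_def)
  define s where "s = sgn \<Delta>"
  have s: "s * s = 1" "s * \<bar>\<Delta>\<bar> = \<Delta>" "s = 1 \<or> s = -1" using \<Delta> by (auto simp: s_def \<Delta>_def sgn_if)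
  define R1 R2 where "R1 = sqrt (a\<^sup>2 + c\<^sup>2)" and "R2 = sqrt (b\<^sup>2 + d\<^sup>2)"
  have "a \<noteq> 0 \<or> c \<noteq> 0" "b \<noteq> 0 \<or> d \<noteq> 0" using \<Delta> by auto
  then have R: "R1 > 0" "R2 > 0" by (simp_all add: R1_def R2_def sum_power2_gt_zero_iff)
  have "(- a)\<^sup>2 + (- s * c)\<^sup>2 = R1\<^sup>2" "(- b)\<^sup>2 + (- s * d)\<^sup>2 = R2\<^sup>2"
    using s by (auto simp: R1_def R2_def power_mult_distrib)
  then obtain P H0 where P: "- a = R1 * cos P" "- s * c = R1 * sin P"
    and H0: "- b = R2 * cos H0" "- s * d = R2 * sin H0"
    using polar_angle by metis
  \<comment> \<open>This picks the representative of the phase in the period starting at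
    \<open>P\<close>; there a positive sine means 0 < H - P < pi.\<close>
  obtain k :: int where k: "P \<le> H0 + 2 * pi * of_int k" "H0 + 2 * pi * of_int k < P + 2 * pi"
    using window_shift by blast
  define H where "H = H0 + 2 * pi * of_int k"
  have HH: "cos H = cos H0" "sin H = sin H0"
    using periodic_int[of cos H0 k] periodic_int[of sin H0 k] by (simp_all add: H_def)
  have "R1 * R2 * sin (H - P) = (R2 * sin H0) * (R1 * cos P) - (R2 * cos H0) * (R1 * sin P)"
    by (simp add: sin_diff HH algebra_simps)
  also have "\<dots> = s * (a * d - c * b)" unfolding P[symmetric] H0[symmetric] by (simp add: algebra_simps)
  also have "\<dots> = \<bar>\<Delta>\<bar>" by (simp add: s_def \<Delta>_def abs_sgn mult.commute)
  finally have "R1 * R2 * sin (H - P) > 0" using \<Delta> by (simp add: \<Delta>_def)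
  moreover have "R1 * R2 > 0" using R by simp
  ultimately have "sin (H - P) > 0" by (rule zero_less_mult_pos)
  moreover have "0 \<le> H - P" "H - P < 2 * pi" using k by (auto simp: H_def)
  ultimately have PH: "0 < H - P" "H - P < pi"
    using sin_le_zero[of "H - P"] by (cases "H = P"; force)+
  define K1 K2 where "K1 = R2 / \<bar>\<Delta>\<bar>" and "K2 = R1 / \<bar>\<Delta>\<bar>"
  have K: "K1 > 0" "K2 > 0" using R \<Delta> by (simp_all add: K1_def K2_def \<Delta>_def)
  have id: "x / \<bar>\<Delta>\<bar> = s * x / \<Delta>" for x using Dn by (auto simp: s_def sgn_if abs_if)
  have A1: "K1 * sin (H - t) = (sin (s * t) * b - cos (s * t) * d) / \<Delta>" for t
  proof -
    have "R2 * sin (H - t) = (R2 * sin H0) * cos t - (R2 * cos H0) * sin t" by (simp add: sin_diff HH algebra_simps)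
    also have "\<dots> = - s * d * cos t + b * sin t" unfolding H0[symmetric] by simp
    finally show ?thesis unfolding K1_def times_divide_eq_left id using s(3) by (auto simp: algebra_simps)
  qed
  have A1': "- K1 * cos (H - t) = s * (cos (s * t) * b + sin (s * t) * d) / \<Delta>" for t
  proof -
    have "R2 * cos (H - t) = (R2 * cos H0) * cos t + (R2 * sin H0) * sin t" by (simp add: cos_diff HH algebra_simps)
    also have "\<dots> = - b * cos t - s * d * sin t" unfolding H0[symmetric] by simp
    finally have e: "R2 * cos (H - t) = - b * cos t - s * d * sin t" .
    have "- K1 * cos (H - t) = - (R2 * cos (H - t)) / \<bar>\<Delta>\<bar>" by (simp add: K1_def)
    then show ?thesis unfolding e id using s(3) by (auto simp: algebra_simps)
  qed
  have A2: "K2 * sin (t - P) = (cos (s * t) * c - sin (s * t) * a) / \<Delta>" for t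
  proof -
    have "R1 * sin (t - P) = (R1 * cos P) * sin t - (R1 * sin P) * cos t" by (simp add: sin_diff algebra_simps)
    also have "\<dots> = - a * sin t + s * c * cos t" unfolding P[symmetric] by simp
    finally show ?thesis unfolding K2_def times_divide_eq_left id using s(3) by (auto simp: algebra_simps)
  qed
  have A2': "K2 * cos (t - P) = s * (- sin (s * t) * c - cos (s * t) * a) / \<Delta>" for t
  proof -
    have "R1 * cos (t - P) = (R1 * cos P) * cos t + (R1 * sin P) * sin t" by (simp add: cos_diff algebra_simps)
    also have "\<dots> = - a * cos t - s * c * sin t" unfolding P[symmetric] by simp
    finally show ?thesis unfolding K2_def times_divide_eq_left id using s(3) by (auto simp: algebra_simps)
  qed
  obtain \<kappa> where "\<kappa> > 0" and \<kappa>: "\<And>M1 M1' M2 M2'.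
    C1_close_loop \<kappa> (\<lambda>t. K1 * sin (H - t)) (\<lambda>t. - K1 * cos (H - t))
      (\<lambda>t. K2 * sin (t - P)) (\<lambda>t. K2 * cos (t - P)) M1 M1' M2 M2' \<Longrightarrow>
    \<exists>tP tH. tP < tH \<and> tH < tP + pi \<and>
      (\<forall>t. M1 t > 0 \<and> M2 t > 0 \<longleftrightarrow> (\<exists>k::int. tP < t + 2 * pi * of_int k \<and> t + 2 * pi * of_int k < tH)) \<and>
      M1 tP > 0 \<and> M2 tP = 0 \<and> M1 tH = 0 \<and> M2 tH > 0 \<and> M2' tP \<noteq> 0 \<and> M1' tH \<noteq> 0"
    by (rule oriented_loop[OF PH K]) (rule that)
  have main: "\<exists>tP tH. positive_arc M1 M2 tP tH \<and> M2' tP \<noteq> 0 \<and> M1' tH \<noteq> 0"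
    if close: "C1_close_loop \<kappa> (\<lambda>t. (sin t * b - cos t * d) / \<Delta>) (\<lambda>t. (cos t * b + sin t * d) / \<Delta>)
      (\<lambda>t. (cos t * c - sin t * a) / \<Delta>) (\<lambda>t. (- sin t * c - cos t * a) / \<Delta>) M1 M1' M2 M2'"
    for M1 M1' M2 M2'
  proof -
    note M = close[unfolded C1_close_loop_def]
    \<comment> \<open>The loop run in the orientation that \<open>oriented_loop\<close> expects; the
      derivatives acquire the factor \<open>s\<close>.\<close>
    define N1 N2 N1' N2' where "N1 t = M1 (s * t)" and "N2 t = M2 (s * t)"
      and "N1' t = s * M1' (s * t)" and "N2' t = s * M2' (s * t)" for t
    have sabs: "\<bar>s * x\<bar> = \<bar>x\<bar>" for x using s(3) by auto
    have dist: "\<bar>s * x - s * y / \<Delta>\<bar> = \<bar>x - y / \<Delta>\<bar>" for x y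
      using sabs[of "x - y / \<Delta>"] by (simp add: right_diff_distrib)
    have N: "C1_close_loop \<kappa> (\<lambda>t. K1 * sin (H - t)) (\<lambda>t. - K1 * cos (H - t))
      (\<lambda>t. K2 * sin (t - P)) (\<lambda>t. K2 * cos (t - P)) N1 N1' N2 N2'"
      unfolding C1_close_loop_def
    proof (intro allI conjI)
      fix t
      have "N1 (t + 2 * pi) = N1 t \<and> N2 (t + 2 * pi) = N2 t"
        using s(3)
      proof
        assume "s = 1" then show ?thesis using M by (simp add: N1_def N2_def)
      next
        assume "s = -1"
        moreover have "M1 (- t) = M1 (- t - 2 * pi + 2 * pi)" "M2 (- t) = M2 (- t - 2 * pi + 2 * pi)" by simp_all
        ultimately show ?thesis using M[rule_format, of "- t - 2 * pi"] by (simp add: N1_def N2_def)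
      qed
      then show "N1 (t + 2 * pi) = N1 t" "N2 (t + 2 * pi) = N2 t" by blast+
      have ds: "((\<lambda>t. s * t) has_real_derivative s) (at t)" by (auto intro!: derivative_eq_intros)
      show "(N1 has_real_derivative N1' t) (at t)" "(N2 has_real_derivative N2' t) (at t)"
        using DERIV_chain2[OF _ ds, of M1 "M1' (s * t)"] DERIV_chain2[OF _ ds, of M2 "M2' (s * t)"] M
        by (simp_all add: N1_def[abs_def] N2_def[abs_def] N1'_def N2'_def mult.commute)
      have m: "\<bar>M1 (s * t) - (sin (s * t) * b - cos (s * t) * d) / \<Delta>\<bar> < \<kappa>"
        "\<bar>M1' (s * t) - (cos (s * t) * b + sin (s * t) * d) / \<Delta>\<bar> < \<kappa>"
        "\<bar>M2 (s * t) - (cos (s * t) * c - sin (s * t) * a) / \<Delta>\<bar> < \<kappa>"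
        "\<bar>M2' (s * t) - (- sin (s * t) * c - cos (s * t) * a) / \<Delta>\<bar> < \<kappa>" using M by blast+
      show "\<bar>N1 t - K1 * sin (H - t)\<bar> < \<kappa>" "\<bar>N2 t - K2 * sin (t - P)\<bar> < \<kappa>"
        using m(1,3) unfolding A1 A2 by (simp_all only: N1_def N2_def)
      have "N1' t - - K1 * cos (H - t) = s * M1' (s * t) - s * (cos (s * t) * b + sin (s * t) * d) / \<Delta>"
        unfolding A1'[symmetric] by (simp add: N1'_def)
      then show "\<bar>N1' t - - K1 * cos (H - t)\<bar> < \<kappa>" using m(2) by (simp only: dist)
      show "\<bar>N2' t - K2 * cos (t - P)\<bar> < \<kappa>" using m(4) unfolding A2' N2'_def by (simp only: dist)
    qed
    obtain xP xH where x: "xP < xH" "xH < xP + pi"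
      and iff: "\<And>t. N1 t > 0 \<and> N2 t > 0 \<longleftrightarrow> (\<exists>k::int. xP < t + 2 * pi * of_int k \<and> t + 2 * pi * of_int k < xH)"
      and ends: "N1 xP > 0" "N2 xP = 0" "N1 xH = 0" "N2 xH > 0" "N2' xP \<noteq> 0" "N1' xH \<noteq> 0"
      using \<kappa>[OF N] by blast
    \<comment> \<open>Reversing time changes the sign of the integer shift, which does not affect
      its existence.\<close>
    have neg: "(\<exists>k::int. Q k) \<longleftrightarrow> (\<exists>k. Q (- k))" for Q by (metis minus_minus)
    have seg: "t + 2 * pi * of_int k \<in> open_segment (s * xP) (s * xH) \<longleftrightarrow>
       xP < s * t + 2 * pi * of_int (if s = 1 then k else - k) \<and> s * t + 2 * pi * of_int (if s = 1 then k else - k) < xH" for t and k :: int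
      using s(3) x(1) by (auto simp: open_segment_eq_real_ivl)
    have "M1 t > 0 \<and> M2 t > 0 \<longleftrightarrow> (\<exists>k::int. t + 2 * pi * of_int k \<in> open_segment (s * xP) (s * xH))" for t
    proof -
      have "M1 t = N1 (s * t)" "M2 t = N2 (s * t)" using s(1) by (simp_all add: N1_def N2_def flip: mult.assoc)
      then have "M1 t > 0 \<and> M2 t > 0 \<longleftrightarrow> (\<exists>k::int. xP < s * t + 2 * pi * of_int k \<and> s * t + 2 * pi * of_int k < xH)"
        using iff[of "s * t"] by simp
      also have "\<dots> \<longleftrightarrow> (\<exists>k::int. t + 2 * pi * of_int k \<in> open_segment (s * xP) (s * xH))"
        using s(3)
      proof
        assume "s = 1" then show ?thesis unfolding seg by simp
      next
        assume "s = -1" then show ?thesis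
          unfolding seg neg[of "\<lambda>k. xP < s * t + 2 * pi * of_int k \<and> s * t + 2 * pi * of_int k < xH"] by simp
      qed
      finally show ?thesis .
    qed
    moreover have "s * xP \<noteq> s * xH" using s(3) x(1) by auto
    moreover have "\<bar>s * xP - s * xH\<bar> < pi" using s(3) x by auto
    moreover have "M1 (s * xP) > 0" "M2 (s * xP) = 0" "M1 (s * xH) = 0" "M2 (s * xH) > 0" "M2' (s * xP) \<noteq> 0" "M1' (s * xH) \<noteq> 0"
      using ends by (auto simp: N1_def N2_def N1'_def N2'_def)
    ultimately show ?thesis unfolding positive_arc_def by blast
  qed
  show ?thesis by (rule that[OF \<open>\<kappa> > 0\<close> main])
qed

section \<open>Truncated and full branches\<close>

text \<open>The assumptions cover a mixed mode with one vanishing component: its points then lie on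
  P or H1 and do not add to the number of pure modes.\<close>

lemma branch_counts_branches:
  assumes P: "snd m = 0 \<Longrightarrow> fst m = p" and H: "fst m = 0 \<Longrightarrow> snd m = h"
  shows "branch_counts (branches p h m) p h m"
proof -
  have sq: "{y::real. y\<^sup>2 = c} = (if c < 0 then {} else {sqrt c, - sqrt c})" for c
  proof (cases "c < 0")
    case True
    then show ?thesis using zero_le_power2 by (auto simp: not_less[symmetric])
  next
    case False
    then show ?thesis by (auto simp flip: real_sqrt_abs) (metis abs_if minus_minus real_sqrt_abs)
  qed
  then have fin: "finite {y::real. y\<^sup>2 = c}" for c by simp
  have sub: "branches p h m \<subseteq> ({y. y\<^sup>2 = 0} \<union> {y. y\<^sup>2 = p} \<union> {y. y\<^sup>2 = fst m}) \<times> ({r. r\<^sup>2 = 0} \<union> {r. r\<^sup>2 = h} \<union> {r. r\<^sup>2 = snd m})"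
    by (auto simp: branches_def)
  have fB: "finite (branches p h m)"
    by (rule finite_subset[OF sub]) (intro finite_cartesian_product finite_UnI fin)
  have card2: "card {y::real. y\<^sup>2 = c \<and> y \<noteq> 0} = (if c > 0 then 2 else 0)" for c
  proof (cases "c > 0")
    case True
    then have "{y::real. y\<^sup>2 = c \<and> y \<noteq> 0} = {sqrt c, - sqrt c}" using sq[of c] by auto
    then show ?thesis using True by simp
  next
    case False
    then have "\<not> (y\<^sup>2 = c \<and> y \<noteq> 0)" for y :: real using zero_less_power2[of y] by auto
    then have "{y::real. y\<^sup>2 = c \<and> y \<noteq> 0} = {}" by blast
    then show ?thesis using False by (simp only: card.empty if_False)
  qed
  have m_eq: "m = (u, v) \<longleftrightarrow> fst m = u \<and> snd m = v" for u v by auto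
  have 1: "{(y1, r) \<in> branches p h m. y1 \<noteq> 0 \<and> r = 0} = {y. y\<^sup>2 = p \<and> y \<noteq> 0} \<times> {0}"
    using P by (auto simp: branches_def prod_eq_iff)
  have 2: "{(y1, r) \<in> branches p h m. y1 = 0 \<and> r \<noteq> 0} = {0} \<times> {r. r\<^sup>2 = h \<and> r \<noteq> 0}"
    using H by (auto simp: branches_def prod_eq_iff)
  have 3: "{(y1, r) \<in> branches p h m. y1 \<noteq> 0 \<and> r \<noteq> 0} = {y. y\<^sup>2 = fst m \<and> y \<noteq> 0} \<times> {r. r\<^sup>2 = snd m \<and> r \<noteq> 0}"
    by (auto simp: branches_def prod_eq_iff)
  show ?thesis
    unfolding branch_counts_def 1 2 3 card_cartesian_product card2 using fB by simp
qed

text \<open>The cases are which of y and r vanish. The mixed point annihilates both brackets, by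
  Cramer's rule, even when one of its components is zero, so it may be listed
  unconditionally.\<close>

lemma truncated_solutions:
  fixes a b c d :: real
  assumes \<Delta>: "a * d - c * b \<noteq> 0" and ad: "a \<noteq> 0" "d \<noteq> 0"
  shows "0 = (\<alpha>1 + a * y\<^sup>2 + b * r\<^sup>2) * y \<and> 0 = (\<alpha>3 + c * y\<^sup>2 + d * r\<^sup>2) * r \<longleftrightarrow>
    (y\<^sup>2, r\<^sup>2) \<in> {(0, 0), (- \<alpha>1 / a, 0), (0, - \<alpha>3 / d),
      ((\<alpha>3 * b - \<alpha>1 * d) / (a * d - c * b), (\<alpha>1 * c - \<alpha>3 * a) / (a * d - c * b))}" (is "?L \<longleftrightarrow> ?R")
proof -
  have mixed: "\<alpha>1 + a * u + b * v = 0 \<and> \<alpha>3 + c * u + d * v = 0 \<longleftrightarrow>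
    u = (\<alpha>3 * b - \<alpha>1 * d) / (a * d - c * b) \<and> v = (\<alpha>1 * c - \<alpha>3 * a) / (a * d - c * b)" for u v
  proof
    assume "\<alpha>1 + a * u + b * v = 0 \<and> \<alpha>3 + c * u + d * v = 0"
    then have "u * (a * d - c * b) = \<alpha>3 * b - \<alpha>1 * d" "v * (a * d - c * b) = \<alpha>1 * c - \<alpha>3 * a" by algebra+
    then show "u = (\<alpha>3 * b - \<alpha>1 * d) / (a * d - c * b) \<and> v = (\<alpha>1 * c - \<alpha>3 * a) / (a * d - c * b)"
      using \<Delta> by (simp add: eq_divide_eq)
  next
    assume "u = (\<alpha>3 * b - \<alpha>1 * d) / (a * d - c * b) \<and> v = (\<alpha>1 * c - \<alpha>3 * a) / (a * d - c * b)"
    then have u: "u * (a * d - c * b) = \<alpha>3 * b - \<alpha>1 * d" and v: "v * (a * d - c * b) = \<alpha>1 * c - \<alpha>3 * a" using \<Delta> by simp_all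
    have "(a * d - c * b) * (\<alpha>1 + a * u + b * v) = 0" "(a * d - c * b) * (\<alpha>3 + c * u + d * v) = 0"
      using u v by algebra+
    then show "\<alpha>1 + a * u + b * v = 0 \<and> \<alpha>3 + c * u + d * v = 0" using \<Delta> by simp
  qed
  have P: "\<alpha>1 + a * u = 0 \<longleftrightarrow> u = - \<alpha>1 / a" and H: "\<alpha>3 + d * v = 0 \<longleftrightarrow> v = - \<alpha>3 / d" for u v
    using ad by (auto simp: field_simps eq_neg_iff_add_eq_0)
  show ?thesis
    using mixed[of "y\<^sup>2" "r\<^sup>2"] mixed[of "y\<^sup>2" 0] mixed[of 0 "r\<^sup>2"] mixed[of 0 0] P[of "y\<^sup>2"] H[of "r\<^sup>2"]
    by (cases "y = 0"; cases "r = 0") auto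
qed

text \<open>The vanishing of one component is a linear relation between the parameters, under which
  the other component agrees with the pure mode after cross-multiplication. This is how the
  truncated mixed mode meets P and H1.\<close>

lemma truncated_ends:
  fixes a b c d :: real
  assumes \<Delta>: "a * d - c * b \<noteq> 0" and ad: "a \<noteq> 0" "d \<noteq> 0"
  shows "(\<alpha>1 * c - \<alpha>3 * a) / (a * d - c * b) = 0 \<Longrightarrow> (\<alpha>3 * b - \<alpha>1 * d) / (a * d - c * b) = - \<alpha>1 / a"
    "(\<alpha>3 * b - \<alpha>1 * d) / (a * d - c * b) = 0 \<Longrightarrow> (\<alpha>1 * c - \<alpha>3 * a) / (a * d - c * b) = - \<alpha>3 / d"
proof -
  assume "(\<alpha>1 * c - \<alpha>3 * a) / (a * d - c * b) = 0"
  then have "\<alpha>1 * c = \<alpha>3 * a" using \<Delta> by simp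
  then have "(\<alpha>3 * b - \<alpha>1 * d) * a = - \<alpha>1 * (a * d - c * b)" by algebra
  then show "(\<alpha>3 * b - \<alpha>1 * d) / (a * d - c * b) = - \<alpha>1 / a" by (simp only: frac_eq_eq[OF \<Delta> ad(1)])
next
  assume "(\<alpha>3 * b - \<alpha>1 * d) / (a * d - c * b) = 0"
  then have "\<alpha>3 * b = \<alpha>1 * d" using \<Delta> by simp
  then have "(\<alpha>1 * c - \<alpha>3 * a) * d = - \<alpha>3 * (a * d - c * b)" by algebra
  then show "(\<alpha>1 * c - \<alpha>3 * a) / (a * d - c * b) = - \<alpha>3 / d" by (simp only: frac_eq_eq[OF \<Delta> ad(2)])
qed

lemma truncated_equations:
  assumes "Delta1 \<phi> \<noteq> 0" "coeff2 (\<phi> 1) 1 0 * coeff2 (\<phi> 3) 0 1 \<noteq> 0"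
  shows "{(y1, r). truncated_eqs \<phi> \<alpha>1 \<alpha>3 y1 r} =
        branches (trunc_P \<phi> \<alpha>1) (trunc_H \<phi> \<alpha>3) (trunc_M \<phi> (\<alpha>1, \<alpha>3))"
    "branch_counts {(y1, r). truncated_eqs \<phi> \<alpha>1 \<alpha>3 y1 r}
        (trunc_P \<phi> \<alpha>1) (trunc_H \<phi> \<alpha>3) (trunc_M \<phi> (\<alpha>1, \<alpha>3))"
proof -
  have nz: "coeff2 (\<phi> 1) 1 0 \<noteq> 0" "coeff2 (\<phi> 3) 0 1 \<noteq> 0" using assms(2) by auto
  show eq: "{(y1, r). truncated_eqs \<phi> \<alpha>1 \<alpha>3 y1 r} =
        branches (trunc_P \<phi> \<alpha>1) (trunc_H \<phi> \<alpha>3) (trunc_M \<phi> (\<alpha>1, \<alpha>3))"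
    unfolding truncated_eqs_def branches_def trunc_P_def trunc_H_def trunc_M_def Delta1_def prod.case
    by (subst truncated_solutions[OF assms(1)[unfolded Delta1_def] nz]) (rule refl)
  show "branch_counts {(y1, r). truncated_eqs \<phi> \<alpha>1 \<alpha>3 y1 r}
        (trunc_P \<phi> \<alpha>1) (trunc_H \<phi> \<alpha>3) (trunc_M \<phi> (\<alpha>1, \<alpha>3))"
    unfolding eq
    by (rule branch_counts_branches; unfold trunc_P_def trunc_H_def trunc_M_def prod.case fst_conv snd_conv Delta1_def)
      (rule truncated_ends[OF assms(1)[unfolded Delta1_def] nz]; assumption)+
qed

text \<open>The truncated mixed mode is linear in the parameters, so on the circle of radius
  \<open>\<epsilon>\<close> it is \<open>\<epsilon>\<close> times the model loop itself. The
  perturbation is zero, and every positive \<open>\<epsilon>\<close> is allowed.\<close>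

lemma truncated_loop:
  assumes \<Delta>: "Delta1 \<phi> \<noteq> 0" and "coeff2 (\<phi> 1) 1 0 * coeff2 (\<phi> 3) 0 1 \<noteq> 0" and \<epsilon>: "\<epsilon> > 0"
  shows "\<exists>tP tH. mixed_mode_joins
      (\<lambda>t. trunc_P \<phi> (\<epsilon> * cos t)) (\<lambda>t. trunc_H \<phi> (\<epsilon> * sin t))
      (\<lambda>t. trunc_M \<phi> (\<epsilon> * cos t, \<epsilon> * sin t)) tP tH"
proof -
  define a b c d where "a = coeff2 (\<phi> 1) 1 0" and "b = coeff2 (\<phi> 1) 0 1" and "c = coeff2 (\<phi> 3) 1 0" and "d = coeff2 (\<phi> 3) 0 1"
  have nz: "a \<noteq> 0" "d \<noteq> 0" and D: "a * d - c * b \<noteq> 0" using assms by (auto simp: a_def b_def c_def d_def Delta1_def)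
  define M1 M2 where "M1 t = (sin t * b - cos t * d) / (a * d - c * b)" and "M2 t = (cos t * c - sin t * a) / (a * d - c * b)" for t
  define M1' M2' where "M1' t = (cos t * b + sin t * d) / (a * d - c * b)" and "M2' t = (- sin t * c - cos t * a) / (a * d - c * b)" for t
  have per: "M1 (t + 2 * pi) = M1 t \<and> M2 (t + 2 * pi) = M2 t" for t by (simp add: M1_def M2_def)
  have der: "(M1 has_real_derivative M1' t) (at t) \<and> (M2 has_real_derivative M2' t) (at t)" for t
    unfolding M1_def[abs_def] M2_def[abs_def] M1'_def M2'_def by (auto intro!: derivative_eq_intros DERIV_cdivide)
  obtain \<kappa> where "\<kappa> > 0" and \<kappa>: "\<And>M1 M1' M2 M2'. C1_close_loop \<kappa>
      (\<lambda>t. (sin t * b - cos t * d) / (a * d - c * b)) (\<lambda>t. (cos t * b + sin t * d) / (a * d - c * b))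
      (\<lambda>t. (cos t * c - sin t * a) / (a * d - c * b)) (\<lambda>t. (- sin t * c - cos t * a) / (a * d - c * b)) M1 M1' M2 M2' \<Longrightarrow>
    \<exists>tP tH. positive_arc M1 M2 tP tH \<and> M2' tP \<noteq> 0 \<and> M1' tH \<noteq> 0"
    by (rule loop_around_axis[OF D]) (rule that)
  have "C1_close_loop \<kappa> (\<lambda>t. (sin t * b - cos t * d) / (a * d - c * b)) (\<lambda>t. (cos t * b + sin t * d) / (a * d - c * b))
      (\<lambda>t. (cos t * c - sin t * a) / (a * d - c * b)) (\<lambda>t. (- sin t * c - cos t * a) / (a * d - c * b)) M1 M1' M2 M2'"
    unfolding C1_close_loop_def using per der \<open>\<kappa> > 0\<close>
    by (intro allI conjI) (simp_all only: M1_def M2_def M1'_def M2'_def diff_self abs_zero)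
  then obtain tP tH where arc: "positive_arc M1 M2 tP tH" using \<kappa> by blast
  then have t: "tP \<noteq> tH" "\<bar>tP - tH\<bar> < pi"
    and iff: "\<forall>t. M1 t > 0 \<and> M2 t > 0 \<longleftrightarrow> (\<exists>k::int. t + 2 * pi * of_int k \<in> open_segment tP tH)"
    and ends: "M1 tP > 0" "M2 tP = 0" "M1 tH = 0" "M2 tH > 0"
    unfolding positive_arc_def by blast+
  have tm: "trunc_M \<phi> (\<epsilon> * cos t, \<epsilon> * sin t) = (\<epsilon> * M1 t, \<epsilon> * M2 t)" for t
    by (simp add: trunc_M_def Delta1_def M1_def M2_def a_def b_def c_def d_def algebra_simps)
  have tm1: "(\<epsilon> * sin t * b - \<epsilon> * cos t * d) / (a * d - c * b) = \<epsilon> * M1 t"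
    and tm2: "(\<epsilon> * cos t * c - \<epsilon> * sin t * a) / (a * d - c * b) = \<epsilon> * M2 t" for t
    by (simp_all add: M1_def M2_def algebra_simps)
  have TP: "trunc_P \<phi> (\<epsilon> * cos tP) = \<epsilon> * M1 tP"
    using truncated_ends(1)[OF D nz, of "\<epsilon> * cos tP" "\<epsilon> * sin tP", unfolded tm1 tm2] ends(2)
    unfolding trunc_P_def a_def[symmetric] by simp
  have TH: "trunc_H \<phi> (\<epsilon> * sin tH) = \<epsilon> * M2 tH"
    using truncated_ends(2)[OF D nz, of "\<epsilon> * sin tH" "\<epsilon> * cos tH", unfolded tm1 tm2] ends(3)
    unfolding trunc_H_def d_def[symmetric] by simp
  have cont: "isCont (\<lambda>t. trunc_M \<phi> (\<epsilon> * cos t, \<epsilon> * sin t)) t" for t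
    unfolding tm M1_def M2_def using D by (intro continuous_intros) auto
  show ?thesis
    unfolding mixed_mode_joins_def
    by (rule exI[of _ tP], rule exI[of _ tH], intro conjI t cont)
      (use iff ends \<epsilon> in \<open>auto simp: tm TP TH zero_less_mult_iff\<close>)
qed

lemma isCont_pair_close:
  fixes k :: "real \<times> real \<Rightarrow> real"
  assumes "isCont k (0, 0)" "e > 0"
  shows "\<exists>d>0. \<forall>s t. norm (s, t) < d \<longrightarrow> \<bar>k (s, t) - k (0, 0)\<bar> < e"
proof -
  obtain d where "d > 0" and d: "\<And>z. dist z (0, 0) < d \<Longrightarrow> dist (k z) (k (0, 0)) < e"
    using assms unfolding continuous_at_eps_delta by blast
  show ?thesis using d \<open>d > 0\<close> by (intro exI[of _ d]) (auto simp: dist_norm)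
qed

lemma norm_circle: "\<epsilon> > 0 \<Longrightarrow> norm (\<epsilon> * cos t, \<epsilon> * sin t) = \<epsilon>"
  by (simp add: norm_Pair power_mult_distrib flip: distrib_left)

lemma circle_in_square:
  fixes \<epsilon> \<delta> :: real
  assumes "0 < \<epsilon>" "\<epsilon> < \<delta>"
  shows "\<bar>\<epsilon> * cos t\<bar> < \<delta>" "\<bar>\<epsilon> * sin t\<bar> < \<delta>"
proof -
  have "\<epsilon> * \<bar>cos t\<bar> \<le> \<epsilon> * 1" "\<epsilon> * \<bar>sin t\<bar> \<le> \<epsilon> * 1" using assms(1) by (intro mult_left_mono; simp)+
  moreover have "\<bar>\<epsilon> * cos t\<bar> = \<epsilon> * \<bar>cos t\<bar>" "\<bar>\<epsilon> * sin t\<bar> = \<epsilon> * \<bar>sin t\<bar>" using assms(1) by (simp_all add: abs_mult)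
  ultimately show "\<bar>\<epsilon> * cos t\<bar> < \<delta>" "\<bar>\<epsilon> * sin t\<bar> < \<delta>" using assms(2) by linarith+
qed

section \<open>The parameter region around the axis and small loops for the full equations\<close>

context mode_branches
begin

text \<open>The damping has to be negative at P and at H1 themselves, not only at the origin. As
  \<open>p\<close> and \<open>h\<close> vanish on the axis, the region contains its whole negative
  half; the width around it may depend on \<alpha>2.\<close>

definition param_region :: "(real \<times> real \<times> real) set" where
  "param_region = {(\<alpha>1, \<alpha>2, \<alpha>3). \<bar>\<alpha>1\<bar> < \<delta> \<and> \<alpha>2 < 0 \<and> \<bar>\<alpha>3\<bar> < \<delta> \<and>
    \<alpha>2 + f 2 (p \<alpha>1, 0) < 0 \<and> \<alpha>2 + f 2 (0, h \<alpha>3) < 0}"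

lemma open_param_region: "open param_region"
proof -
  define T where "T = {x :: real \<times> real \<times> real. \<bar>fst x\<bar> < \<delta> \<and> fst (snd x) < 0 \<and> \<bar>snd (snd x)\<bar> < \<delta>}"
  have "open T" unfolding T_def by (intro open_Collect_conj open_Collect_less continuous_intros)
  have cp: "continuous_on {-\<delta><..<\<delta>} p" "continuous_on {-\<delta><..<\<delta>} h"
    by (auto intro!: continuous_at_imp_continuous_on DERIV_isCont[OF p_deriv] DERIV_isCont[OF h_deriv])
  have c: "continuous_on T (\<lambda>x. p (fst x))" "continuous_on T (\<lambda>x. h (snd (snd x)))"
    by (rule continuous_on_compose2[OF cp(1)] continuous_on_compose2[OF cp(2)];
        force intro!: continuous_intros simp: T_def)+
  have "continuous_on T (\<lambda>x. f 2 (p (fst x), 0))"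
  proof (rule continuous_on_compose2[OF cont_f[of 2]])
    show "continuous_on T (\<lambda>x. (p (fst x), 0::real))" by (intro continuous_intros c)
  qed (use p box[of _ 0] eta_pos in \<open>auto simp: T_def\<close>)
  moreover have "continuous_on T (\<lambda>x. f 2 (0, h (snd (snd x))))"
  proof (rule continuous_on_compose2[OF cont_f[of 2]])
    show "continuous_on T (\<lambda>x. (0::real, h (snd (snd x))))" by (intro continuous_intros c)
  qed (use h box[of 0] eta_pos in \<open>auto simp: T_def\<close>)
  ultimately have "continuous_on T (\<lambda>x. fst (snd x) + f 2 (p (fst x), 0))" "continuous_on T (\<lambda>x. fst (snd x) + f 2 (0, h (snd (snd x))))"
    by (auto intro!: continuous_intros)
  then have "open (T \<inter> (\<lambda>x. fst (snd x) + f 2 (p (fst x), 0)) -` {..<0} \<inter> (T \<inter> (\<lambda>x. fst (snd x) + f 2 (0, h (snd (snd x)))) -` {..<0}))"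
    using \<open>open T\<close> by (intro open_Int continuous_open_preimage) auto
  moreover have "T \<inter> (\<lambda>x. fst (snd x) + f 2 (p (fst x), 0)) -` {..<0} \<inter> (T \<inter> (\<lambda>x. fst (snd x) + f 2 (0, h (snd (snd x)))) -` {..<0}) = param_region"
    by (auto simp: param_region_def T_def)
  ultimately show ?thesis by simp
qed

lemma axis_in_param_region: "a < 0 \<Longrightarrow> (0, a, 0) \<in> param_region"
  using delta_pos f_zero[of 2] by (simp add: param_region_def zero_values)

lemma branches_iff:
  assumes \<alpha>: "\<bar>\<alpha>1\<bar> < \<delta>" "\<bar>\<alpha>3\<bar> < \<delta>"
  shows "(y, r) \<in> branches (p \<alpha>1) (h \<alpha>3) (m (\<alpha>1, \<alpha>3)) \<longleftrightarrow>
    (\<alpha>1 + f 1 (y\<^sup>2, r\<^sup>2)) * y = 0 \<and> (\<alpha>3 + f 3 (y\<^sup>2, r\<^sup>2)) * r = 0 \<and> y\<^sup>2 < \<eta> \<and> r\<^sup>2 < \<eta>" (is "?L \<longleftrightarrow> ?R")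
proof
  assume ?L
  then have "(y\<^sup>2, r\<^sup>2) = (0, 0) \<or> (y\<^sup>2, r\<^sup>2) = (p \<alpha>1, 0) \<or> (y\<^sup>2, r\<^sup>2) = (0, h \<alpha>3) \<or> (y\<^sup>2, r\<^sup>2) = m (\<alpha>1, \<alpha>3)"
    by (auto simp: branches_def)
  then consider "(y\<^sup>2, r\<^sup>2) = (0, 0)" | "(y\<^sup>2, r\<^sup>2) = (p \<alpha>1, 0)" | "(y\<^sup>2, r\<^sup>2) = (0, h \<alpha>3)" | "(y\<^sup>2, r\<^sup>2) = m (\<alpha>1, \<alpha>3)" by blast
  then show ?R
  proof cases
    case 4
    then have e: "m (\<alpha>1, \<alpha>3) = (y\<^sup>2, r\<^sup>2)" by simp
    show ?thesis using m[OF \<alpha>] by (simp add: e)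
  qed (use p[OF \<alpha>(1)] h[OF \<alpha>(2)] eta_pos in auto)
next
  assume R: ?R
  then have b: "\<bar>y\<^sup>2\<bar> < \<eta>" "\<bar>r\<^sup>2\<bar> < \<eta>" by auto
  show ?L
    using R p_unique[OF \<alpha>(1) b(1)] h_unique[OF \<alpha>(2) b(2)] m_unique[OF \<alpha> b]
    by (cases "y = 0"; cases "r = 0") (auto simp: branches_def)
qed

lemma polar_steady_states:
  assumes \<alpha>: "\<bar>\<alpha>1\<bar> < \<delta>" "\<bar>\<alpha>3\<bar> < \<delta>"
  shows "{(y1, y2, r). polar_field f (\<alpha>1, \<alpha>2, \<alpha>3) (y1, y2, r) = (0, 0, 0) \<and> y1\<^sup>2 < \<eta> \<and> r\<^sup>2 < \<eta>} =
    {(y1, y2, r). y2 = 0 \<and> (y1, r) \<in> branches (p \<alpha>1) (h \<alpha>3) (m (\<alpha>1, \<alpha>3))}"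
  by (auto simp: branches_iff[OF \<alpha>] polar_field_def)

lemma branch_counts_full:
  assumes \<alpha>: "\<bar>\<alpha>1\<bar> < \<delta>" "\<bar>\<alpha>3\<bar> < \<delta>"
  shows "branch_counts (branches (p \<alpha>1) (h \<alpha>3) (m (\<alpha>1, \<alpha>3))) (p \<alpha>1) (h \<alpha>3) (m (\<alpha>1, \<alpha>3))"
  by (intro branch_counts_branches m_snd_zero[OF \<alpha>] m_fst_zero[OF \<alpha>])

text \<open>Waiting half a period, \<open>pi / \<omega>\<close>, changes the sign of z; this
  identifies the solutions for r and - r.\<close>

lemma rotating_orbits:
  assumes \<alpha>: "\<bar>\<alpha>1\<bar> < \<delta>" "\<bar>\<alpha>3\<bar> < \<delta>" and B: "(y1, r) \<in> branches (p \<alpha>1) (h \<alpha>3) (m (\<alpha>1, \<alpha>3))" and r: "r \<noteq> 0"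
  defines "\<omega> \<equiv> 1 + f 4 (y1\<^sup>2, r\<^sup>2)"
  shows "(y1, - r) \<in> branches (p \<alpha>1) (h \<alpha>3) (m (\<alpha>1, \<alpha>3)) \<and>
    \<omega> > 0 \<and> solution (nf_field f (\<alpha>1, \<alpha>2, \<alpha>3)) (rotating y1 r \<omega>) \<and> solution (nf_field f (\<alpha>1, \<alpha>2, \<alpha>3)) (rotating y1 (- r) \<omega>) \<and>
    (\<forall>t. rotating y1 (- r) \<omega> t = rotating y1 r \<omega> (t + pi / \<omega>)) \<and>
    range (rotating y1 r \<omega>) = circ y1 (r\<^sup>2) \<and>
    periodic_orbit (nf_field f (\<alpha>1, \<alpha>2, \<alpha>3)) (circ y1 (r\<^sup>2))"
proof -
  have e: "(\<alpha>1 + f 1 (y1\<^sup>2, r\<^sup>2)) * y1 = 0" "\<alpha>3 + f 3 (y1\<^sup>2, r\<^sup>2) = 0" "\<bar>y1\<^sup>2\<bar> < \<eta>" "\<bar>r\<^sup>2\<bar> < \<eta>"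
    using B r by (auto simp: branches_iff[OF \<alpha>])
  have w4: "f 4 (y1\<^sup>2, r\<^sup>2) > -1" using box[OF e(3,4)] by blast
  then have w: "\<omega> > 0" by (simp add: \<omega>_def)
  have shift: "rotating y1 (- r) \<omega> t = rotating y1 r \<omega> (t + pi / \<omega>)" for t
  proof -
    have "\<omega> * (t + pi / \<omega>) = \<omega> * t + pi" using w by (simp add: field_simps)
    then show ?thesis by (simp add: rotating_def)
  qed
  have "(y1, - r) \<in> branches (p \<alpha>1) (h \<alpha>3) (m (\<alpha>1, \<alpha>3))" using B by (simp add: branches_def)
  moreover have "solution (nf_field f (\<alpha>1, \<alpha>2, \<alpha>3)) (rotating y1 r \<omega>)"
    by (rule solution_rotating) (use e in \<open>simp_all add: \<omega>_def\<close>)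
  moreover have "solution (nf_field f (\<alpha>1, \<alpha>2, \<alpha>3)) (rotating y1 (- r) \<omega>)"
    by (rule solution_rotating) (use e in \<open>simp_all add: \<omega>_def\<close>)
  moreover have "periodic_orbit (nf_field f (\<alpha>1, \<alpha>2, \<alpha>3)) (circ y1 (r\<^sup>2))"
    by (rule periodic_orbit_circ) (use r e w4 in simp_all)
  moreover have "range (rotating y1 r \<omega>) = circ y1 (r\<^sup>2)" using range_rotating[of \<omega> y1 r] w by simp
  ultimately show ?thesis using w shift by blast
qed

lemma bij_inv_jac:
  assumes "jac z \<noteq> 0"
  shows "bij (inv_jac z)"
proof (rule bij_betw_byWitness[where f' = "\<lambda>(s, t). (- (fu 1 z * s + fv 1 z * t), - (fu 3 z * s + fv 3 z * t))"])
  show "\<forall>a\<in>UNIV. (case inv_jac z a of (s, t) \<Rightarrow> (- (fu 1 z * s + fv 1 z * t), - (fu 3 z * s + fv 3 z * t))) = a"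
    using assms by (auto simp: inv_jac_def divide_simps) (auto simp: jac_def algebra_simps)
  show "\<forall>a'\<in>UNIV. inv_jac z (case a' of (s, t) \<Rightarrow> (- (fu 1 z * s + fv 1 z * t), - (fu 3 z * s + fv 3 z * t))) = a'"
    using assms by (auto simp: inv_jac_def divide_simps) (auto simp: jac_def algebra_simps)
qed auto

text \<open>Division by \<open>\<epsilon>\<close> blows the loop up to unit size, where it is C^1
  close to the linearization for small \<open>\<epsilon>\<close>. Closeness of the values is
  differentiability of \<open>m\<close> at the origin; closeness of the derivatives is continuity of
  the partial derivatives along the branch.\<close>

lemma loop_full:
  obtains \<epsilon>0 where "\<epsilon>0 > 0" "\<And>\<epsilon>. 0 < \<epsilon> \<Longrightarrow> \<epsilon> < \<epsilon>0 \<Longrightarrow> \<epsilon> < \<delta> \<and>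
    (\<exists>tP tH. positive_arc (\<lambda>t. fst (m (\<epsilon> * cos t, \<epsilon> * sin t))) (\<lambda>t. snd (m (\<epsilon> * cos t, \<epsilon> * sin t))) tP tH \<and>
      (\<exists>d. ((\<lambda>t. snd (m (\<epsilon> * cos t, \<epsilon> * sin t))) has_real_derivative d) (at tP) \<and> d \<noteq> 0) \<and>
      (\<exists>d. ((\<lambda>t. fst (m (\<epsilon> * cos t, \<epsilon> * sin t))) has_real_derivative d) (at tH) \<and> d \<noteq> 0))"
proof -
  define a b c d where "a = fu 1 (0, 0)" and "b = fv 1 (0, 0)" and "c = fu 3 (0, 0)" and "d = fv 3 (0, 0)"
  have D: "a * d - c * b \<noteq> 0" using nondeg(1) by (simp add: a_def b_def c_def d_def)
  have j0: "jac (0, 0) = a * d - c * b" by (simp add: jac_def a_def b_def c_def d_def)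
  obtain \<kappa> where "\<kappa> > 0" and \<kappa>: "\<And>M1 M1' M2 M2'. C1_close_loop \<kappa>
      (\<lambda>t. (sin t * b - cos t * d) / (a * d - c * b)) (\<lambda>t. (cos t * b + sin t * d) / (a * d - c * b))
      (\<lambda>t. (cos t * c - sin t * a) / (a * d - c * b)) (\<lambda>t. (- sin t * c - cos t * a) / (a * d - c * b)) M1 M1' M2 M2' \<Longrightarrow>
    \<exists>tP tH. positive_arc M1 M2 tP tH \<and> M2' tP \<noteq> 0 \<and> M1' tH \<noteq> 0"
    by (rule loop_around_axis[OF D]) (rule that)
  have dm0: "(m has_derivative inv_jac (0, 0)) (at (0, 0))"
    using m_deriv[of 0 0] delta_pos zero_values(3) by simp
  \<comment> \<open>Each derivative combines two quotients with coefficients bounded by one, so half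
    of \<open>\<kappa>\<close> is allotted to each; for the values the half yields the strict
    inequality.\<close>
  have "\<kappa> / 2 > 0" using \<open>\<kappa> > 0\<close> by simp
  with dm0 obtain r0 where "r0 > 0" and r0: "\<And>z. norm (z - (0, 0)) < r0 \<Longrightarrow>
      norm (m z - m (0, 0) - inv_jac (0, 0) (z - (0, 0))) \<le> \<kappa> / 2 * norm (z - (0, 0))"
    unfolding has_derivative_at_alt by blast
  have j: "1 \<in> {1..4::nat}" "3 \<in> {1..4::nat}" by auto
  have at0: "isCont k (0, 0)" if "continuous_on S k" for k :: "real \<times> real \<Rightarrow> real"
    using that continuous_on_eq_continuous_at[OF open_S] zero_S by blast
  have cm: "isCont m (0, 0)" using has_derivative_continuous[OF dm0] .
  have cq: "isCont (\<lambda>z. k (m z) / jac (m z)) (0, 0)" if "continuous_on S k" for k :: "real \<times> real \<Rightarrow> real"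
  proof -
    have "continuous_on S jac" unfolding jac_def by (intro continuous_intros cont_fu cont_fv j)
    then have "isCont (\<lambda>z. k z / jac z) (m (0, 0))"
      unfolding zero_values(3) using D j0 by (intro continuous_intros at0 that) auto
    then show ?thesis using isCont_o2[OF cm] by blast
  qed
  have near: "\<exists>r>0. \<forall>s t. norm (s, t) < r \<longrightarrow> \<bar>k (m (s, t)) / jac (m (s, t)) - k (0, 0) / jac (0, 0)\<bar> < \<kappa> / 2"
    if "continuous_on S k" for k :: "real \<times> real \<Rightarrow> real"
    using isCont_pair_close[OF cq[OF that] \<open>\<kappa> / 2 > 0\<close>] by (simp add: zero_values(3))
  obtain r1 r2 r3 r4 where r: "r1 > 0" "r2 > 0" "r3 > 0" "r4 > 0"
    and q1: "\<And>s t. norm (s, t) < r1 \<Longrightarrow> \<bar>fu 1 (m (s, t)) / jac (m (s, t)) - a / (a * d - c * b)\<bar> < \<kappa> / 2"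
    and q2: "\<And>s t. norm (s, t) < r2 \<Longrightarrow> \<bar>fv 1 (m (s, t)) / jac (m (s, t)) - b / (a * d - c * b)\<bar> < \<kappa> / 2"
    and q3: "\<And>s t. norm (s, t) < r3 \<Longrightarrow> \<bar>fu 3 (m (s, t)) / jac (m (s, t)) - c / (a * d - c * b)\<bar> < \<kappa> / 2"
    and q4: "\<And>s t. norm (s, t) < r4 \<Longrightarrow> \<bar>fv 3 (m (s, t)) / jac (m (s, t)) - d / (a * d - c * b)\<bar> < \<kappa> / 2"
    using near[OF cont_fu[OF j(1)]] near[OF cont_fv[OF j(1)]] near[OF cont_fu[OF j(2)]] near[OF cont_fv[OF j(2)]]
    unfolding j0 a_def[symmetric] b_def[symmetric] c_def[symmetric] d_def[symmetric] by metis
  define \<epsilon>0 where "\<epsilon>0 = Min {\<delta>, r0, r1, r2, r3, r4}"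
  have \<epsilon>0: "\<epsilon>0 > 0" "\<epsilon>0 \<le> \<delta>" "\<epsilon>0 \<le> r0" "\<epsilon>0 \<le> r1" "\<epsilon>0 \<le> r2" "\<epsilon>0 \<le> r3" "\<epsilon>0 \<le> r4"
    using r \<open>r0 > 0\<close> delta_pos by (auto simp: \<epsilon>0_def)
  have main: "\<epsilon> < \<delta> \<and>
    (\<exists>tP tH. positive_arc (\<lambda>t. fst (m (\<epsilon> * cos t, \<epsilon> * sin t))) (\<lambda>t. snd (m (\<epsilon> * cos t, \<epsilon> * sin t))) tP tH \<and>
      (\<exists>d. ((\<lambda>t. snd (m (\<epsilon> * cos t, \<epsilon> * sin t))) has_real_derivative d) (at tP) \<and> d \<noteq> 0) \<and>
      (\<exists>d. ((\<lambda>t. fst (m (\<epsilon> * cos t, \<epsilon> * sin t))) has_real_derivative d) (at tH) \<and> d \<noteq> 0))"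
    if \<epsilon>: "0 < \<epsilon>" "\<epsilon> < \<epsilon>0" for \<epsilon>
  proof -
    define z where "z t = m (\<epsilon> * cos t, \<epsilon> * sin t)" for t
    define M1 M2 where "M1 t = fst (z t) / \<epsilon>" and "M2 t = snd (z t) / \<epsilon>" for t
    define M1' M2' where "M1' t = cos t * (fv 1 (z t) / jac (z t)) + sin t * (fv 3 (z t) / jac (z t))"
      and "M2' t = - sin t * (fu 3 (z t) / jac (z t)) - cos t * (fu 1 (z t) / jac (z t))" for t
    have nrm: "norm (\<epsilon> * cos t, \<epsilon> * sin t) = \<epsilon>" for t using norm_circle[OF \<epsilon>(1)] .
    have "\<epsilon> < \<delta>" using \<epsilon>(2) \<epsilon>0(2) by linarith
    note par = circle_in_square[OF \<epsilon>(1) \<open>\<epsilon> < \<delta>\<close>]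
    have dc: "((\<lambda>t. \<epsilon> * cos t) has_real_derivative - \<epsilon> * sin t) (at t)" "((\<lambda>t. \<epsilon> * sin t) has_real_derivative \<epsilon> * cos t) (at t)" for t
      by (auto intro!: derivative_eq_intros)
    have dz: "((\<lambda>t. fst (z t)) has_real_derivative \<epsilon> * M1' t) (at t)" "((\<lambda>t. snd (z t)) has_real_derivative \<epsilon> * M2' t) (at t)" for t
      using m_path[OF dc par] unfolding z_def[symmetric] by (simp_all add: M1'_def M2'_def algebra_simps diff_divide_distrib add_divide_distrib)
    have dM: "(M1 has_real_derivative M1' t) (at t)" "(M2 has_real_derivative M2' t) (at t)" for t
      using DERIV_cdivide[OF dz(1)[of t], of \<epsilon>] DERIV_cdivide[OF dz(2)[of t], of \<epsilon>] \<epsilon>(1) by (simp_all add: M1_def[abs_def] M2_def[abs_def])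
    have cs: "\<bar>cos t * x + sin t * y\<bar> < \<kappa>" if "\<bar>x\<bar> < \<kappa> / 2" "\<bar>y\<bar> < \<kappa> / 2" for t x y
    proof -
      have "\<bar>cos t * x\<bar> \<le> 1 * \<bar>x\<bar>" "\<bar>sin t * y\<bar> \<le> 1 * \<bar>y\<bar>" unfolding abs_mult by (intro mult_right_mono; simp)+
      then show ?thesis using that by linarith
    qed
    have c0: "\<bar>M1 t - (sin t * b - cos t * d) / (a * d - c * b)\<bar> < \<kappa>" "\<bar>M2 t - (cos t * c - sin t * a) / (a * d - c * b)\<bar> < \<kappa>" for t
    proof -
      have inv: "inv_jac (0, 0) (\<epsilon> * cos t, \<epsilon> * sin t) = (\<epsilon> * ((sin t * b - cos t * d) / (a * d - c * b)), \<epsilon> * ((cos t * c - sin t * a) / (a * d - c * b)))"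
        by (simp add: inv_jac_def j0 a_def b_def c_def d_def algebra_simps)
      have zero: "(0::real, 0::real) = 0" by (simp add: zero_prod_def)
      have bound: "norm (z t - inv_jac (0, 0) (\<epsilon> * cos t, \<epsilon> * sin t)) \<le> \<kappa> / 2 * \<epsilon>"
        using r0[of "(\<epsilon> * cos t, \<epsilon> * sin t)"] \<epsilon> \<epsilon>0(3) nrm[of t] zero_values(3) by (simp add: zero z_def)
      have comp: "\<bar>fst u\<bar> \<le> norm u" "\<bar>snd u\<bar> \<le> norm u" for u :: "real \<times> real"
        using norm_fst_le[of "fst u" "snd u"] norm_snd_le[of "snd u" "fst u"] by simp_all
      have "\<bar>fst (z t) - \<epsilon> * ((sin t * b - cos t * d) / (a * d - c * b))\<bar> \<le> \<kappa> / 2 * \<epsilon>"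
        "\<bar>snd (z t) - \<epsilon> * ((cos t * c - sin t * a) / (a * d - c * b))\<bar> \<le> \<kappa> / 2 * \<epsilon>"
        using order_trans[OF comp(1) bound] order_trans[OF comp(2) bound] by (simp_all only: inv fst_diff snd_diff fst_conv snd_conv)
      moreover have "\<bar>u / \<epsilon> - w\<bar> < \<kappa>" if "\<bar>u - \<epsilon> * w\<bar> \<le> \<kappa> / 2 * \<epsilon>" for u w
      proof -
        have "\<bar>u - \<epsilon> * w\<bar> = \<epsilon> * \<bar>u / \<epsilon> - w\<bar>"
          using \<epsilon>(1) abs_mult[of \<epsilon> "u / \<epsilon> - w"] by (simp add: right_diff_distrib)
        then have "\<epsilon> * \<bar>u / \<epsilon> - w\<bar> \<le> \<epsilon> * (\<kappa> / 2)" using that by (simp only: mult.commute[of "\<kappa> / 2"])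
        then have "\<bar>u / \<epsilon> - w\<bar> \<le> \<kappa> / 2" using \<epsilon>(1) by (simp only: mult_le_cancel_left_pos)
        then show ?thesis using \<open>\<kappa> > 0\<close> by linarith
      qed
      ultimately show "\<bar>M1 t - (sin t * b - cos t * d) / (a * d - c * b)\<bar> < \<kappa>" "\<bar>M2 t - (cos t * c - sin t * a) / (a * d - c * b)\<bar> < \<kappa>"
        unfolding M1_def M2_def by blast+
    qed
    have c1: "\<bar>M1' t - (cos t * b + sin t * d) / (a * d - c * b)\<bar> < \<kappa>" for t
    proof -
      have "M1' t - (cos t * b + sin t * d) / (a * d - c * b) =
        cos t * (fv 1 (z t) / jac (z t) - b / (a * d - c * b)) + sin t * (fv 3 (z t) / jac (z t) - d / (a * d - c * b))"
        by (simp add: M1'_def right_diff_distrib add_divide_distrib)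
      then show ?thesis
        using cs q2[of "\<epsilon> * cos t" "\<epsilon> * sin t"] q4[of "\<epsilon> * cos t" "\<epsilon> * sin t"] nrm[of t] \<epsilon> \<epsilon>0 by (simp add: z_def)
    qed
    have c2: "\<bar>M2' t - (- sin t * c - cos t * a) / (a * d - c * b)\<bar> < \<kappa>" for t
    proof -
      have e: "M2' t - (- sin t * c - cos t * a) / (a * d - c * b) =
        - (cos t * (fu 1 (z t) / jac (z t) - a / (a * d - c * b)) + sin t * (fu 3 (z t) / jac (z t) - c / (a * d - c * b)))"
        by (simp add: M2'_def right_diff_distrib diff_divide_distrib)
      show ?thesis unfolding e abs_minus_cancel
        by (rule cs) (use q1[of "\<epsilon> * cos t" "\<epsilon> * sin t"] q3[of "\<epsilon> * cos t" "\<epsilon> * sin t"] nrm[of t] \<epsilon> \<epsilon>0 in \<open>simp_all add: z_def\<close>)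
    qed
    have "C1_close_loop \<kappa> (\<lambda>t. (sin t * b - cos t * d) / (a * d - c * b)) (\<lambda>t. (cos t * b + sin t * d) / (a * d - c * b))
      (\<lambda>t. (cos t * c - sin t * a) / (a * d - c * b)) (\<lambda>t. (- sin t * c - cos t * a) / (a * d - c * b)) M1 M1' M2 M2'"
      unfolding C1_close_loop_def
      by (intro allI conjI dM c0 c1 c2) (simp_all add: M1_def M2_def z_def)
    then obtain tP tH where arc: "positive_arc M1 M2 tP tH" and ends: "M2' tP \<noteq> 0" "M1' tH \<noteq> 0" using \<kappa> by blast
    have pos: "M1 t > 0 \<longleftrightarrow> fst (z t) > 0" "M2 t > 0 \<longleftrightarrow> snd (z t) > 0" "M1 t = 0 \<longleftrightarrow> fst (z t) = 0" "M2 t = 0 \<longleftrightarrow> snd (z t) = 0" for t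
      using \<epsilon>(1) by (simp_all add: M1_def M2_def zero_less_divide_iff)
    have dP: "\<exists>d. ((\<lambda>t. snd (z t)) has_real_derivative d) (at tP) \<and> d \<noteq> 0"
      using dz(2)[of tP] ends(1) \<epsilon>(1) by (intro exI[of _ "\<epsilon> * M2' tP"]) simp
    have dH: "\<exists>d. ((\<lambda>t. fst (z t)) has_real_derivative d) (at tH) \<and> d \<noteq> 0"
      using dz(1)[of tH] ends(2) \<epsilon>(1) by (intro exI[of _ "\<epsilon> * M1' tH"]) simp
    have "positive_arc (\<lambda>t. fst (z t)) (\<lambda>t. snd (z t)) tP tH"
      using arc unfolding positive_arc_def pos .
    then show ?thesis
      unfolding z_def[symmetric] using \<open>\<epsilon> < \<delta>\<close> dP dH by blast
  qed
  show ?thesis by (rule that[OF \<epsilon>0(1) main])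
qed

end

context mode_branches
begin

lemma mixed_mode_joins_full:
  assumes \<epsilon>: "0 < \<epsilon>" "\<epsilon> < \<delta>"
    and arc: "positive_arc (\<lambda>t. fst (m (\<epsilon> * cos t, \<epsilon> * sin t))) (\<lambda>t. snd (m (\<epsilon> * cos t, \<epsilon> * sin t))) tP tH"
  shows "mixed_mode_joins (\<lambda>t. p (\<epsilon> * cos t)) (\<lambda>t. h (\<epsilon> * sin t)) (\<lambda>t. m (\<epsilon> * cos t, \<epsilon> * sin t)) tP tH"
proof -
  note par = circle_in_square[OF \<epsilon>]
  have cont: "isCont (\<lambda>t. m (\<epsilon> * cos t, \<epsilon> * sin t)) t" for t
    using isCont_o2[where f = "\<lambda>t. (\<epsilon> * cos t, \<epsilon> * sin t)", OF _ has_derivative_continuous[OF m_deriv[OF par]]]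
    by (simp add: continuous_intros)
  have "p (\<epsilon> * cos tP) = fst (m (\<epsilon> * cos tP, \<epsilon> * sin tP))" "h (\<epsilon> * sin tH) = snd (m (\<epsilon> * cos tH, \<epsilon> * sin tH))"
    using arc m_snd_zero[OF par] m_fst_zero[OF par] by (simp_all add: positive_arc_def)
  then show ?thesis
    unfolding mixed_mode_joins_def using arc cont by (simp add: positive_arc_def prod_eq_iff)
qed

end

section \<open>Assembly on one parameter region around the negative \<alpha>2-axis\<close>

theorem mainTheorem6:
  fixes \<phi> :: "nat \<Rightarrow> real fps fps" and f :: "nat \<Rightarrow> real \<times> real \<Rightarrow> real"
  assumes "\<forall>j\<in>{1..4}. coeff2 (\<phi> j) 0 0 = 0"
    and "\<forall>j\<in>{1..4}. realizes (f j) (\<phi> j)"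
    and "Delta1 \<phi> \<noteq> 0"
    and "coeff2 (\<phi> 1) 1 0 * coeff2 (\<phi> 3) 0 1 \<noteq> 0"
  shows
    \<comment> \<open>the truncated equations\<close>
    "(\<forall>\<alpha>1 \<alpha>3.
      {(y1, r). truncated_eqs \<phi> \<alpha>1 \<alpha>3 y1 r} =
        branches (trunc_P \<phi> \<alpha>1) (trunc_H \<phi> \<alpha>3) (trunc_M \<phi> (\<alpha>1, \<alpha>3)) \<and>
      branch_counts {(y1, r). truncated_eqs \<phi> \<alpha>1 \<alpha>3 y1 r}
        (trunc_P \<phi> \<alpha>1) (trunc_H \<phi> \<alpha>3) (trunc_M \<phi> (\<alpha>1, \<alpha>3))) \<and>
    (\<forall>\<epsilon>>0. \<exists>tP tH. mixed_mode_joins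
      (\<lambda>t. trunc_P \<phi> (\<epsilon> * cos t)) (\<lambda>t. trunc_H \<phi> (\<epsilon> * sin t))
      (\<lambda>t. trunc_M \<phi> (\<epsilon> * cos t, \<epsilon> * sin t)) tP tH) \<and>
    \<comment> \<open>the full equations\<close>
    (\<exists>\<eta>>0. \<exists>\<delta>>0. \<exists>N. \<exists>p h :: real \<Rightarrow> real. \<exists>m :: real \<times> real \<Rightarrow> real \<times> real.
      open N \<and> (\<forall>a<0. (0, a, 0) \<in> N) \<and>
      (\<forall>(\<alpha>1, \<alpha>2, \<alpha>3)\<in>N. \<bar>\<alpha>1\<bar> < \<delta> \<and> \<alpha>2 < 0 \<and> \<bar>\<alpha>3\<bar> < \<delta>) \<and>
      \<comment> \<open>the branches are differentiable in the parameters, with the truncated ones as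
        linear parts\<close>
      (\<forall>\<alpha>1. \<bar>\<alpha>1\<bar> < \<delta> \<longrightarrow> p differentiable (at \<alpha>1) \<and> \<bar>p \<alpha>1\<bar> < \<eta> \<and> (p \<alpha>1 > 0 \<longleftrightarrow> trunc_P \<phi> \<alpha>1 > 0)) \<and>
      p 0 = 0 \<and> (p has_derivative trunc_P \<phi>) (at 0) \<and>
      (\<forall>\<alpha>3. \<bar>\<alpha>3\<bar> < \<delta> \<longrightarrow> h differentiable (at \<alpha>3) \<and> \<bar>h \<alpha>3\<bar> < \<eta> \<and> (h \<alpha>3 > 0 \<longleftrightarrow> trunc_H \<phi> \<alpha>3 > 0)) \<and>
      h 0 = 0 \<and> (h has_derivative trunc_H \<phi>) (at 0) \<and>
      (\<forall>\<alpha>1 \<alpha>3. \<bar>\<alpha>1\<bar> < \<delta> \<and> \<bar>\<alpha>3\<bar> < \<delta> \<longrightarrow>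
        (\<exists>D. (m has_derivative D) (at (\<alpha>1, \<alpha>3)) \<and> bij D) \<and>
        \<bar>fst (m (\<alpha>1, \<alpha>3))\<bar> < \<eta> \<and> \<bar>snd (m (\<alpha>1, \<alpha>3))\<bar> < \<eta>) \<and>
      m (0, 0) = (0, 0) \<and> (m has_derivative trunc_M \<phi>) (at (0, 0)) \<and>
      (\<forall>(\<alpha>1, \<alpha>2, \<alpha>3)\<in>N.
        let F = nf_field f (\<alpha>1, \<alpha>2, \<alpha>3);
            R = polar_field f (\<alpha>1, \<alpha>2, \<alpha>3);
            B = branches (p \<alpha>1) (h \<alpha>3) (m (\<alpha>1, \<alpha>3))
        in
          \<comment> \<open>steady states of the polar system\<close>
          {(y1, y2, r). R (y1, y2, r) = (0, 0, 0) \<and> y1^2 < \<eta> \<and> r^2 < \<eta>} =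
            {(y1, y2, r). y2 = 0 \<and> (y1, r) \<in> B} \<and>
          branch_counts B (p \<alpha>1) (h \<alpha>3) (m (\<alpha>1, \<alpha>3)) \<and>
          \<comment> \<open>the equilibria are the trivial one and the pair P\<close>
          {x. F x = 0 \<and> (x$1)^2 < \<eta> \<and> (x$3)^2 + (x$4)^2 < \<eta>} =
            (if p \<alpha>1 > 0 then {0, eq_pt (sqrt (p \<alpha>1)), eq_pt (- sqrt (p \<alpha>1))} else {0}) \<and>
          \<comment> \<open>H1 is a limit cycle, and the only periodic orbit in the z-plane near 0\<close>
          {C. periodic_orbit F C \<and> C \<subseteq> {x. x$1 = 0 \<and> x$2 = 0 \<and> (x$3)^2 + (x$4)^2 < \<eta>}} =
            (if h \<alpha>3 > 0 then {circ 0 (h \<alpha>3)} else {}) \<and>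
          (h \<alpha>3 > 0 \<longrightarrow> limit_cycle F (circ 0 (h \<alpha>3))) \<and>
          \<comment> \<open>\<open>r\<close> and \<open>-r\<close> give the same periodic orbit, with a phase shift\<close>
          (\<forall>(y1, r)\<in>B. r \<noteq> 0 \<longrightarrow> (y1, - r) \<in> B \<and>
            (let \<omega> = 1 + f 4 (y1^2, r^2) in
              \<omega> > 0 \<and> solution F (rotating y1 r \<omega>) \<and> solution F (rotating y1 (- r) \<omega>) \<and>
              (\<forall>t. rotating y1 (- r) \<omega> t = rotating y1 r \<omega> (t + pi / \<omega>)) \<and>
              range (rotating y1 r \<omega>) = circ y1 (r^2) \<and>
              periodic_orbit F (circ y1 (r^2))))) \<and>
      \<comment> \<open>bifurcations along an arbitrary one-parameter path that crosses transversally\<close>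
      (\<forall>a1 a2 a3 :: real \<Rightarrow> real. \<forall>\<mu> d1 d2 d3.
        (a1 has_real_derivative d1) (at \<mu>) \<and> (a2 has_real_derivative d2) (at \<mu>) \<and>
        (a3 has_real_derivative d3) (at \<mu>) \<and> (a1 \<mu>, a2 \<mu>, a3 \<mu>) \<in> N \<longrightarrow>
        (let F = (\<lambda>s. nf_field f (a1 s, a2 s, a3 s));
             P = (\<lambda>\<sigma> s. eq_pt (\<sigma> * sqrt (p (a1 s))));
             H = (\<lambda>s. circ 0 (h (a3 s)));
             M = (\<lambda>\<sigma> s. circ (\<sigma> * sqrt (fst (m (a1 s, a3 s)))) (snd (m (a1 s, a3 s))))
         in
          (a1 \<mu> = 0 \<and> d1 \<noteq> 0 \<and> a3 \<mu> \<noteq> 0 \<longrightarrow>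
            pitchfork_of_equilibria F y_flip \<mu> (\<lambda>_. 0) (P 1) (P (- 1))) \<and>
          (a3 \<mu> = 0 \<and> d3 \<noteq> 0 \<and> a1 \<mu> \<noteq> 0 \<longrightarrow>
            andronov_hopf F \<mu> (\<lambda>_. 0) H) \<and>
          (fst (m (a1 \<mu>, a3 \<mu>)) > 0 \<and> snd (m (a1 \<mu>, a3 \<mu>)) = 0 \<and>
           (\<exists>d. ((\<lambda>s. snd (m (a1 s, a3 s))) has_real_derivative d) (at \<mu>) \<and> d \<noteq> 0) \<longrightarrow>
            fst (m (a1 \<mu>, a3 \<mu>)) = p (a1 \<mu>) \<and>
            andronov_hopf F \<mu> (P 1) (M 1) \<and> andronov_hopf F \<mu> (P (- 1)) (M (- 1))) \<and>
          (fst (m (a1 \<mu>, a3 \<mu>)) = 0 \<and> snd (m (a1 \<mu>, a3 \<mu>)) > 0 \<and>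
           (\<exists>d. ((\<lambda>s. fst (m (a1 s, a3 s))) has_real_derivative d) (at \<mu>) \<and> d \<noteq> 0) \<longrightarrow>
            snd (m (a1 \<mu>, a3 \<mu>)) = h (a3 \<mu>) \<and>
            pitchfork_of_cycles F y_flip \<mu> H (M 1) (M (- 1))))) \<and>
      \<comment> \<open>on small loops around the axis the mixed mode joins P and H1, in secondary
        bifurcations at the two ends of its interval of existence\<close>
      (\<forall>\<alpha>2<0. \<exists>\<epsilon>0>0. \<forall>\<epsilon>\<in>{0<..<\<epsilon>0}.
        (\<forall>t. (\<epsilon> * cos t, \<alpha>2, \<epsilon> * sin t) \<in> N) \<and>
        (let F = (\<lambda>t. nf_field f (\<epsilon> * cos t, \<alpha>2, \<epsilon> * sin t));
             P = (\<lambda>\<sigma> t. eq_pt (\<sigma> * sqrt (p (\<epsilon> * cos t))));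
             H = (\<lambda>t. circ 0 (h (\<epsilon> * sin t)));
             mt = (\<lambda>t. m (\<epsilon> * cos t, \<epsilon> * sin t));
             M = (\<lambda>\<sigma> t. circ (\<sigma> * sqrt (fst (mt t))) (snd (mt t)))
         in \<exists>tP tH.
          mixed_mode_joins (\<lambda>t. p (\<epsilon> * cos t)) (\<lambda>t. h (\<epsilon> * sin t)) mt tP tH \<and>
          andronov_hopf F tP (P 1) (M 1) \<and> andronov_hopf F tP (P (- 1)) (M (- 1)) \<and>
          pitchfork_of_cycles F y_flip tH H (M 1) (M (- 1)))))"
proof -
  obtain S where "mode_interaction f (\<lambda>j. partial1 (f j)) (\<lambda>j. partial2 (f j)) S"
    and coef1: "\<And>j. j \<in> {1..4} \<Longrightarrow> partial1 (f j) (0, 0) = coeff2 (\<phi> j) 1 0"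
    and coef2: "\<And>j. j \<in> {1..4} \<Longrightarrow> partial2 (f j) (0, 0) = coeff2 (\<phi> j) 0 1"
    by (rule realizes_mode_interaction[OF assms]) (rule that; assumption)
  then interpret mode_interaction f "\<lambda>j. partial1 (f j)" "\<lambda>j. partial2 (f j)" S by blast
  obtain \<eta> \<delta> p h m where "mode_branches f (\<lambda>j. partial1 (f j)) (\<lambda>j. partial2 (f j)) S \<eta> \<delta> p h m"
    using branches_exist by blast
  then interpret mode_branches f "\<lambda>j. partial1 (f j)" "\<lambda>j. partial2 (f j)" S \<eta> \<delta> p h m .
  \<comment> \<open>The realization makes the first-order coefficients equal to the partial
    derivatives at the origin, so the truncated branches are the derivatives of the full ones
    there.\<close>
  have trunc: "trunc_P \<phi> = (\<lambda>\<alpha>. - \<alpha> / partial1 (f 1) (0, 0))" "trunc_H \<phi> = (\<lambda>\<alpha>. - \<alpha> / partial2 (f 3) (0, 0))"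
    "trunc_M \<phi> = inv_jac (0, 0)"
    by (simp_all add: fun_eq_iff trunc_P_def trunc_H_def trunc_M_def Delta1_def inv_jac_def jac_def coef1 coef2)
  have scale: "(*) (- 1 / c) = (\<lambda>\<alpha>. - \<alpha> / c)" for c :: real by (simp add: fun_eq_iff)
  have p_branch: "\<forall>\<alpha>1. \<bar>\<alpha>1\<bar> < \<delta> \<longrightarrow> p differentiable (at \<alpha>1) \<and> \<bar>p \<alpha>1\<bar> < \<eta> \<and> (p \<alpha>1 > 0 \<longleftrightarrow> trunc_P \<phi> \<alpha>1 > 0)"
    using p p_pos p_deriv unfolding trunc by (meson differentiableI has_field_derivative_imp_has_derivative)
  have p_linear: "(p has_derivative trunc_P \<phi>) (at 0)"
    using p_deriv[of 0] delta_pos by (simp only: trunc has_field_derivative_def scale zero_values abs_zero)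
  have h_branch: "\<forall>\<alpha>3. \<bar>\<alpha>3\<bar> < \<delta> \<longrightarrow> h differentiable (at \<alpha>3) \<and> \<bar>h \<alpha>3\<bar> < \<eta> \<and> (h \<alpha>3 > 0 \<longleftrightarrow> trunc_H \<phi> \<alpha>3 > 0)"
    using h h_pos h_deriv unfolding trunc by (meson differentiableI has_field_derivative_imp_has_derivative)
  have h_linear: "(h has_derivative trunc_H \<phi>) (at 0)"
    using h_deriv[of 0] delta_pos by (simp only: trunc has_field_derivative_def scale zero_values abs_zero)
  have m_branch: "\<forall>\<alpha>1 \<alpha>3. \<bar>\<alpha>1\<bar> < \<delta> \<and> \<bar>\<alpha>3\<bar> < \<delta> \<longrightarrow>
        (\<exists>D. (m has_derivative D) (at (\<alpha>1, \<alpha>3)) \<and> bij D) \<and>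
        \<bar>fst (m (\<alpha>1, \<alpha>3))\<bar> < \<eta> \<and> \<bar>snd (m (\<alpha>1, \<alpha>3))\<bar> < \<eta>"
  proof (intro allI impI, elim conjE)
    fix \<alpha>1 \<alpha>3 assume \<alpha>: "\<bar>\<alpha>1\<bar> < \<delta>" "\<bar>\<alpha>3\<bar> < \<delta>"
    have "jac (m (\<alpha>1, \<alpha>3)) \<noteq> 0"
      using m[OF \<alpha>] box[of "fst (m (\<alpha>1, \<alpha>3))" "snd (m (\<alpha>1, \<alpha>3))"] by simp
    then show "(\<exists>D. (m has_derivative D) (at (\<alpha>1, \<alpha>3)) \<and> bij D) \<and>
        \<bar>fst (m (\<alpha>1, \<alpha>3))\<bar> < \<eta> \<and> \<bar>snd (m (\<alpha>1, \<alpha>3))\<bar> < \<eta>"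
      using m_deriv[OF \<alpha>] bij_inv_jac m[OF \<alpha>] by blast
  qed
  have m_linear: "(m has_derivative trunc_M \<phi>) (at (0, 0))"
    using m_deriv[of 0 0] delta_pos by (simp add: trunc zero_values)
  have region: "\<forall>(\<alpha>1, \<alpha>2, \<alpha>3)\<in>param_region. \<bar>\<alpha>1\<bar> < \<delta> \<and> \<alpha>2 < 0 \<and> \<bar>\<alpha>3\<bar> < \<delta>"
    by (auto simp: param_region_def)
  have truncated: "\<forall>\<alpha>1 \<alpha>3.
      {(y1, r). truncated_eqs \<phi> \<alpha>1 \<alpha>3 y1 r} =
        branches (trunc_P \<phi> \<alpha>1) (trunc_H \<phi> \<alpha>3) (trunc_M \<phi> (\<alpha>1, \<alpha>3)) \<and>
      branch_counts {(y1, r). truncated_eqs \<phi> \<alpha>1 \<alpha>3 y1 r}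
        (trunc_P \<phi> \<alpha>1) (trunc_H \<phi> \<alpha>3) (trunc_M \<phi> (\<alpha>1, \<alpha>3))"
    using truncated_equations[OF assms(3,4)] by blast
  have truncated_joins: "\<forall>\<epsilon>>0. \<exists>tP tH. mixed_mode_joins
      (\<lambda>t. trunc_P \<phi> (\<epsilon> * cos t)) (\<lambda>t. trunc_H \<phi> (\<epsilon> * sin t))
      (\<lambda>t. trunc_M \<phi> (\<epsilon> * cos t, \<epsilon> * sin t)) tP tH"
    using truncated_loop[OF assms(3,4)] by blast
  have axis: "\<forall>a<0. (0, a, 0) \<in> param_region" using axis_in_param_region by blast
  show ?thesis
  proof (rule conjI[OF truncated], rule conjI[OF truncated_joins],
      rule exI[of _ \<eta>], rule conjI[OF eta_pos], rule exI[of _ \<delta>], rule conjI[OF delta_pos],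
      rule exI[of _ param_region], rule exI[of _ p], rule exI[of _ h], rule exI[of _ m],
      intro conjI open_param_region axis region p_branch p_linear h_branch h_linear m_branch m_linear zero_values, goal_cases)
    case 1
    show ?case
    proof (intro ballI, goal_cases)
      case (1 z)
      obtain \<alpha>1 \<alpha>2 \<alpha>3 where z: "z = (\<alpha>1, \<alpha>2, \<alpha>3)" by (cases z) auto
      then have \<alpha>: "\<bar>\<alpha>1\<bar> < \<delta>" "\<bar>\<alpha>3\<bar> < \<delta>" "\<alpha>2 + f 2 (0, h \<alpha>3) < 0" using 1 by (auto simp: param_region_def)
      have rot: "\<forall>(y1, r)\<in>branches (p \<alpha>1) (h \<alpha>3) (m (\<alpha>1, \<alpha>3)). r \<noteq> 0 \<longrightarrow>
        (y1, - r) \<in> branches (p \<alpha>1) (h \<alpha>3) (m (\<alpha>1, \<alpha>3)) \<and> 1 + f 4 (y1\<^sup>2, r\<^sup>2) > 0 \<and>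
        solution (nf_field f (\<alpha>1, \<alpha>2, \<alpha>3)) (rotating y1 r (1 + f 4 (y1\<^sup>2, r\<^sup>2))) \<and>
        solution (nf_field f (\<alpha>1, \<alpha>2, \<alpha>3)) (rotating y1 (- r) (1 + f 4 (y1\<^sup>2, r\<^sup>2))) \<and>
        (\<forall>t. rotating y1 (- r) (1 + f 4 (y1\<^sup>2, r\<^sup>2)) t = rotating y1 r (1 + f 4 (y1\<^sup>2, r\<^sup>2)) (t + pi / (1 + f 4 (y1\<^sup>2, r\<^sup>2)))) \<and>
        range (rotating y1 r (1 + f 4 (y1\<^sup>2, r\<^sup>2))) = circ y1 (r\<^sup>2) \<and>
        periodic_orbit (nf_field f (\<alpha>1, \<alpha>2, \<alpha>3)) (circ y1 (r\<^sup>2))"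
      proof (intro ballI, goal_cases)
        case (1 w)
        then show ?case using rotating_orbits[OF \<alpha>(1,2), of "fst w" "snd w" \<alpha>2] by (simp add: case_prod_beta)
      qed
      show ?case
        unfolding z Let_def prod.case
        by (intro conjI polar_steady_states[OF \<alpha>(1,2)] branch_counts_full[OF \<alpha>(1,2)] equilibria[OF \<alpha>(1)]
            periodic_orbits_plane[OF \<alpha>(2)] rot) (rule impI, rule limit_cycle_h[OF \<alpha>])
    qed
  next
    case 2
    show ?case
    proof (intro allI impI, elim conjE, goal_cases)
      case (1 a1 a2 a3 \<mu> d1 d2 d3)
      note a = 1(1-3)
      have \<mu>: "\<bar>a1 \<mu>\<bar> < \<delta>" "\<bar>a3 \<mu>\<bar> < \<delta>" "a2 \<mu> < 0" "a2 \<mu> + f 2 (p (a1 \<mu>), 0) < 0" "a2 \<mu> + f 2 (0, h (a3 \<mu>)) < 0"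
        using 1(4) by (auto simp: param_region_def)
      show ?case
        unfolding Let_def
      proof (intro conjI impI; elim conjE exE)
        assume "a1 \<mu> = 0" "d1 \<noteq> 0" "a3 \<mu> \<noteq> 0"
        then show "pitchfork_of_equilibria (\<lambda>s. nf_field f (a1 s, a2 s, a3 s)) y_flip \<mu> (\<lambda>_. 0)
          (\<lambda>s. eq_pt (1 * sqrt (p (a1 s)))) (\<lambda>s. eq_pt (- 1 * sqrt (p (a1 s))))"
          by (intro pitchfork_at_origin[OF a(1,2)] \<mu>)
      next
        assume "a3 \<mu> = 0" "d3 \<noteq> 0" "a1 \<mu> \<noteq> 0"
        then show "andronov_hopf (\<lambda>s. nf_field f (a1 s, a2 s, a3 s)) \<mu> (\<lambda>_. 0) (\<lambda>s. circ 0 (h (a3 s)))"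
          by (intro hopf_at_origin[OF a] \<mu>)
      next
        assume "snd (m (a1 \<mu>, a3 \<mu>)) = 0"
        then show "fst (m (a1 \<mu>, a3 \<mu>)) = p (a1 \<mu>)" by (rule m_snd_zero[OF \<mu>(1,2)])
      next
        fix d assume *: "fst (m (a1 \<mu>, a3 \<mu>)) > 0" "snd (m (a1 \<mu>, a3 \<mu>)) = 0"
          "((\<lambda>s. snd (m (a1 s, a3 s))) has_real_derivative d) (at \<mu>)" "d \<noteq> 0"
        show "andronov_hopf (\<lambda>s. nf_field f (a1 s, a2 s, a3 s)) \<mu> (\<lambda>s. eq_pt (1 * sqrt (p (a1 s))))
            (\<lambda>s. circ (1 * sqrt (fst (m (a1 s, a3 s)))) (snd (m (a1 s, a3 s))))"
          "andronov_hopf (\<lambda>s. nf_field f (a1 s, a2 s, a3 s)) \<mu> (\<lambda>s. eq_pt (- 1 * sqrt (p (a1 s))))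
            (\<lambda>s. circ (- 1 * sqrt (fst (m (a1 s, a3 s)))) (snd (m (a1 s, a3 s))))"
          by (rule hopf_at_P[OF a \<mu>(1,2,4) *]; simp)+
      next
        assume "fst (m (a1 \<mu>, a3 \<mu>)) = 0"
        then show "snd (m (a1 \<mu>, a3 \<mu>)) = h (a3 \<mu>)" by (rule m_fst_zero[OF \<mu>(1,2)])
      next
        fix d assume "fst (m (a1 \<mu>, a3 \<mu>)) = 0" "snd (m (a1 \<mu>, a3 \<mu>)) > 0"
          "((\<lambda>s. fst (m (a1 s, a3 s))) has_real_derivative d) (at \<mu>)" "d \<noteq> 0"
        then show "pitchfork_of_cycles (\<lambda>s. nf_field f (a1 s, a2 s, a3 s)) y_flip \<mu> (\<lambda>s. circ 0 (h (a3 s)))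
          (\<lambda>s. circ (1 * sqrt (fst (m (a1 s, a3 s)))) (snd (m (a1 s, a3 s))))
          (\<lambda>s. circ (- 1 * sqrt (fst (m (a1 s, a3 s)))) (snd (m (a1 s, a3 s))))"
          by (rule pitchfork_of_H[OF a \<mu>(1,2,5)])
      qed
    qed
  next
    case 3
    show ?case
    proof (intro allI impI, goal_cases)
      case (1 \<alpha>2)
      \<comment> \<open>The loop of radius \<open>\<epsilon>\<close> stays at distance
        \<open>\<epsilon>\<close> from the point of the axis, so this \<open>e\<close> keeps it
        inside the region; \<open>e'\<close> comes from the closeness to the linearization.\<close>
      obtain e where "e > 0" and e: "ball (0, \<alpha>2, 0) e \<subseteq> param_region"
        using open_param_region axis_in_param_region[OF 1] open_contains_ball by blast
      obtain e' where "e' > 0" and e': "\<And>\<epsilon>. 0 < \<epsilon> \<Longrightarrow> \<epsilon> < e' \<Longrightarrow> \<epsilon> < \<delta> \<and>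
        (\<exists>tP tH. positive_arc (\<lambda>t. fst (m (\<epsilon> * cos t, \<epsilon> * sin t))) (\<lambda>t. snd (m (\<epsilon> * cos t, \<epsilon> * sin t))) tP tH \<and>
          (\<exists>d. ((\<lambda>t. snd (m (\<epsilon> * cos t, \<epsilon> * sin t))) has_real_derivative d) (at tP) \<and> d \<noteq> 0) \<and>
          (\<exists>d. ((\<lambda>t. fst (m (\<epsilon> * cos t, \<epsilon> * sin t))) has_real_derivative d) (at tH) \<and> d \<noteq> 0))"
        by (rule loop_full) (rule that)
      show ?case
      proof (rule exI[of _ "min e e'"], intro conjI ballI, goal_cases)
        case 1
        show ?case using \<open>e > 0\<close> \<open>e' > 0\<close> by simp
      next
        case (2 \<epsilon>)
        have "dist (0, \<alpha>2, 0) (\<epsilon> * cos t, \<alpha>2, \<epsilon> * sin t) = norm (\<epsilon> * cos t, \<epsilon> * sin t)" for t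
          by (simp add: dist_Pair_Pair norm_Pair dist_real_def)
        then show ?case using 2 e norm_circle[of \<epsilon>] by (auto simp: subset_iff)
      next
        case (3 \<epsilon>)
        then have \<epsilon>: "0 < \<epsilon>" "\<epsilon> < e" "\<epsilon> < e'" by auto
        have "dist (0, \<alpha>2, 0) (\<epsilon> * cos t, \<alpha>2, \<epsilon> * sin t) = norm (\<epsilon> * cos t, \<epsilon> * sin t)" for t
          by (simp add: dist_Pair_Pair norm_Pair dist_real_def)
        then have "(\<epsilon> * cos t, \<alpha>2, \<epsilon> * sin t) \<in> param_region" for t
          using \<epsilon> e norm_circle[of \<epsilon> t] by (auto simp: subset_iff)
        then have reg: "\<alpha>2 + f 2 (p (\<epsilon> * cos t), 0) < 0" "\<alpha>2 + f 2 (0, h (\<epsilon> * sin t)) < 0" for t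
          by (auto simp: param_region_def)
        have \<delta>: "\<epsilon> < \<delta>" using e' \<epsilon> by blast
        note par = circle_in_square[OF \<epsilon>(1) \<delta>]
        obtain tP tH dP dH
          where arc: "positive_arc (\<lambda>t. fst (m (\<epsilon> * cos t, \<epsilon> * sin t))) (\<lambda>t. snd (m (\<epsilon> * cos t, \<epsilon> * sin t))) tP tH"
          and dP: "((\<lambda>t. snd (m (\<epsilon> * cos t, \<epsilon> * sin t))) has_real_derivative dP) (at tP)" "dP \<noteq> 0"
          and dH: "((\<lambda>t. fst (m (\<epsilon> * cos t, \<epsilon> * sin t))) has_real_derivative dH) (at tH)" "dH \<noteq> 0"
          using e'[OF \<epsilon>(1,3)] by (elim exE conjE) (rule that)
        then have P: "fst (m (\<epsilon> * cos tP, \<epsilon> * sin tP)) > 0" "snd (m (\<epsilon> * cos tP, \<epsilon> * sin tP)) = 0"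
          and H: "fst (m (\<epsilon> * cos tH, \<epsilon> * sin tH)) = 0" "snd (m (\<epsilon> * cos tH, \<epsilon> * sin tH)) > 0"
          unfolding positive_arc_def by blast+
        have d: "((\<lambda>t. \<epsilon> * cos t) has_real_derivative \<epsilon> * - sin t) (at t)" "((\<lambda>t. \<alpha>2) has_real_derivative 0) (at t)"
          "((\<lambda>t. \<epsilon> * sin t) has_real_derivative \<epsilon> * cos t) (at t)" for t
          by (auto intro!: derivative_eq_intros)
        show ?case
          unfolding Let_def
        proof (rule exI[of _ tP], rule exI[of _ tH], intro conjI)
          show "mixed_mode_joins (\<lambda>t. p (\<epsilon> * cos t)) (\<lambda>t. h (\<epsilon> * sin t)) (\<lambda>t. m (\<epsilon> * cos t, \<epsilon> * sin t)) tP tH"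
            by (rule mixed_mode_joins_full[OF \<epsilon>(1) \<delta> arc])
          show "andronov_hopf (\<lambda>t. nf_field f (\<epsilon> * cos t, \<alpha>2, \<epsilon> * sin t)) tP (\<lambda>t. eq_pt (1 * sqrt (p (\<epsilon> * cos t))))
              (\<lambda>t. circ (1 * sqrt (fst (m (\<epsilon> * cos t, \<epsilon> * sin t)))) (snd (m (\<epsilon> * cos t, \<epsilon> * sin t))))"
            "andronov_hopf (\<lambda>t. nf_field f (\<epsilon> * cos t, \<alpha>2, \<epsilon> * sin t)) tP (\<lambda>t. eq_pt (- 1 * sqrt (p (\<epsilon> * cos t))))
              (\<lambda>t. circ (- 1 * sqrt (fst (m (\<epsilon> * cos t, \<epsilon> * sin t)))) (snd (m (\<epsilon> * cos t, \<epsilon> * sin t))))"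
            by (rule hopf_at_P[OF d par reg(1) P dP]; simp)+
          show "pitchfork_of_cycles (\<lambda>t. nf_field f (\<epsilon> * cos t, \<alpha>2, \<epsilon> * sin t)) y_flip tH (\<lambda>t. circ 0 (h (\<epsilon> * sin t)))
              (\<lambda>t. circ (1 * sqrt (fst (m (\<epsilon> * cos t, \<epsilon> * sin t)))) (snd (m (\<epsilon> * cos t, \<epsilon> * sin t))))
              (\<lambda>t. circ (- 1 * sqrt (fst (m (\<epsilon> * cos t, \<epsilon> * sin t)))) (snd (m (\<epsilon> * cos t, \<epsilon> * sin t))))"
            by (rule pitchfork_of_H[OF d par reg(2) H dH])
        qed
      qed
    qed
  qed
qed

end
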